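(* Let $f=(f_1,f_2,f_3)$ be a general polynomial vector with $f_1,f_2,f_3\in\mathbb{C}[x_0,x_1,x_2]_3$. Then $f$ has exactly two simultaneous Waring decompositions over $\mathbb{C}$ with $k=6$ summands.
   Context: $\mathbb{C}[x_0,x_1,x_2]_d$ is the space of homogeneous forms of degree $d$ in three variables. "General" means: for all $(f_1,f_2,f_3)$ in a non-empty Zariski open subset of $(\mathbb{C}[x_0,x_1,x_2]_3)^{3}$. A simultaneous Waring decomposition of $f$ with $k$ summands is given by linear forms $\ell_1,\dots,\ell_k\in\mathbb{C}[x_0,x_1,x_2]_1$ and scalar vectors $(\lambda_1^j,\dots,\lambda_k^j)\in\mathbb{C}^k\setminus\{0\}$, $j\in\{1,2,3\}$, such that $f_j=\lambda_1^j\ell_1^3+\dots+\lambda_k^j\ell_k^3$ for all $j$; equivalently $f=\sum_{i=1}^k(\lambda_i^1\ell_i^3,\lambda_i^2\ell_i^3,\lambda_i^3\ell_i^3)$. Decompositions are counted up to reordering the summands and rescaling the $\ell_i$ (with the compensating rescaling of the $\lambda_i^j$), i.e. a decomposition is identified with its set of vector summands. *)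

theory Defs
  imports "HOL-Library.Poly_Mapping" "HOL-Analysis.Finite_Cartesian_Product"
begin

text \<open>
  Polynomials in variables of type \<open>'v\<close> are finitely supported functions on exponent
  vectors; the library multiplies them by convolution.
\<close>

type_synonym ('v, 'a) mpolynomial = "('v \<Rightarrow>\<^sub>0 nat) \<Rightarrow>\<^sub>0 'a"

definition mpoly_const :: "'a::zero \<Rightarrow> ('v, 'a) mpolynomial" where
  "mpoly_const c = Poly_Mapping.single 0 c"

definition mpoly_eval :: "('v \<Rightarrow> 'a::comm_ring_1) \<Rightarrow> ('v, 'a) mpolynomial \<Rightarrow> 'a" where
  "mpoly_eval a p =
     (\<Sum>m\<in>Poly_Mapping.keys p. Poly_Mapping.lookup p m *
        (\<Prod>v\<in>Poly_Mapping.keys m. a v ^ Poly_Mapping.lookup m v))"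

text \<open>
  The three variables are indexed by the three-element type \<open>3\<close>, so \<open>forms d\<close> is
  \<open>\<complex>[x\<^sub>0,x\<^sub>1,x\<^sub>2]\<^sub>d\<close>; it contains the zero polynomial.
\<close>

type_synonym ternary = "(3, complex) mpolynomial"

definition forms :: "nat \<Rightarrow> ternary set" where
  "forms d = {p. \<forall>m\<in>Poly_Mapping.keys p. (\<Sum>i\<in>UNIV. Poly_Mapping.lookup m i) = d}"

definition cubic_vectors :: "(ternary ^ 3) set" where
  "cubic_vectors = {f. \<forall>j. f $ j \<in> forms 3}"

text \<open>
  The affine coordinates on \<open>cubic_vectors\<close> are the coefficients of the three components.
  Coordinates belonging to monomials of degree other than 3 vanish identically there, so it is
  harmless that the defining equations may mention them.
\<close>

definition coordinate :: "ternary ^ 3 \<Rightarrow> 3 \<times> (3 \<Rightarrow>\<^sub>0 nat) \<Rightarrow> complex" where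
  "coordinate f = (\<lambda>(j, m). Poly_Mapping.lookup (f $ j) m)"

definition zariski_closed :: "(ternary ^ 3) set \<Rightarrow> bool" where
  "zariski_closed Z \<longleftrightarrow>
     (\<exists>Ps. Z = {f \<in> cubic_vectors. \<forall>P\<in>Ps. mpoly_eval (coordinate f) P = 0})"

definition zariski_open :: "(ternary ^ 3) set \<Rightarrow> bool" where
  "zariski_open U \<longleftrightarrow> U \<subseteq> cubic_vectors \<and> zariski_closed (cubic_vectors - U)"

text \<open>
  The linear forms are \<open>l i\<close> and the scalars \<open>c j i\<close> (written \<open>\<lambda>\<close> with upper index \<open>j\<close> and
  lower index \<open>i\<close> on paper), for \<open>i < k\<close>; values at \<open>i \<ge> k\<close> are irrelevant.  The three
  components are indexed by the type \<open>3\<close>, where \<open>3 = 0\<close>.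
\<close>

definition waring_summand ::
    "(nat \<Rightarrow> ternary) \<Rightarrow> (3 \<Rightarrow> nat \<Rightarrow> complex) \<Rightarrow> nat \<Rightarrow> ternary ^ 3" where
  "waring_summand l c i = (\<chi> j. mpoly_const (c j i) * l i ^ 3)"

definition is_waring_decomposition ::
    "nat \<Rightarrow> ternary ^ 3 \<Rightarrow> (nat \<Rightarrow> ternary) \<Rightarrow> (3 \<Rightarrow> nat \<Rightarrow> complex) \<Rightarrow> bool" where
  "is_waring_decomposition k f l c \<longleftrightarrow>
     (\<forall>i<k. l i \<in> forms 1) \<and>
     (\<forall>j. \<exists>i<k. c j i \<noteq> 0) \<and>
     f = (\<Sum>i<k. waring_summand l c i)"

text \<open>
  Decompositions up to reordering the summands and rescaling the linear forms: each one is
  represented by its set of vector summands.  This forgets multiplicities of repeated summands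
  and the linear forms of vanishing ones, but a general vector of cubics has no decomposition
  with \<open>k = 6\<close> of either kind, since it is not a sum of five vector summands.
\<close>

definition waring_decompositions :: "nat \<Rightarrow> ternary ^ 3 \<Rightarrow> (ternary ^ 3) set set" where
  "waring_decompositions k f =
     {waring_summand l c ` {..<k} | l c. is_waring_decomposition k f l c}"

end

theory Submission
  imports Defs "HOL-Analysis.Analysis" "HOL-Computational_Algebra.Polynomial"
begin

text \<open>
  A summand \<open>(\<lambda>^1 l^3, \<lambda>^2 l^3, \<lambda>^3 l^3)\<close> is a point \<open>(l, \<lambda>)\<close> of \<open>P^2 \<times> P^2\<close> in the embedding by forms
  of bidegree (3,1), and \<open>f\<close> is a linear functional on these forms.  The bilinear forms \<open>B\<close> with
  \<open>f (q B) = 0\<close> for every conic \<open>q\<close> depend only on \<open>f\<close> and form a net, which cuts out an elliptic curve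
  containing the six points of every decomposition of \<open>f\<close>.  On this curve \<open>O(3,1)\<close> has degree 12, and
  a general point of the space of an elliptic normal curve of degree 12 lies on two 6-secant spaces.

  Uniqueness of the second decomposition is proved by linear algebra instead of residues.  If
  \<open>\<Sum> z_i = \<Sum> w_j\<close> are two decompositions, some (3,1)-form \<open>G\<close> vanishes at all twelve points but not on
  the curve.  Given two points \<open>z_i\<close>, \<open>z_k\<close>, let \<open>r\<close> be the line through their first components and \<open>\<mu>\<close> a
  linear form vanishing at its third intersection with the curve; then \<open>H = \<mu> G / r\<close> is again a
  (3,1)-form on the curve, vanishing at the twelve points except \<open>z_i\<close> and \<open>z_k\<close>, so that
  \<open>H z_i + H z_k = 0\<close>.  This determines the derivatives of \<open>G\<close> along the curve at the \<open>z_i\<close>, hence \<open>G\<close>, up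
  to a scalar, by the first decomposition alone.

  That a general \<open>f\<close> has two general decompositions is a statement on the square polynomial map
  sending six points to their sum.  Outside a hypersurface of the target its fibres are bounded and
  contain only regular, general points, so the set of values with two inequivalent preimages is open
  and closed in a connected set; one explicit example shows that it is not empty.
\<close>

section \<open>Polynomial functions on complex coordinate space\<close>

text \<open>The canonical class of P^2 x P^2 is (-3,-3), so three forms of bidegree (1,1) cut out a
  curve with trivial canonical class; its degree under O(3,1) is the coefficient of h^2 k^2 in (3h +
  k)(h + k)^3, which is 12. Its first projection is the plane cubic given by the determinant of the
  net, which is why the line through two of the points meets the curve in just one further point.

  The obstacle is that the competing decompositions are arbitrary: a priori their linear forms may
  lie outside a given chart, coincide or vanish. All genericity is therefore put on one
  decomposition, and duality is carried over to the others by inverting a 6 by 6 pairing of conics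
  with bilinear forms. This bounds the number of decompositions by two but constructs no second one.
  Existence rests on the equality of 30 parameters and 30 coefficients, and on two regular preimages
  of one value that no permutation relates. The value of the example may itself lie on the bad
  hypersurface, so an open condition is what spreads from it.\<close>

inductive cpoly :: "(complex ^ 'n \<Rightarrow> complex) \<Rightarrow> bool" where
  cpoly_const: "cpoly (\<lambda>x. c)"
| cpoly_comp: "cpoly (\<lambda>x. x $ i)"
| cpoly_add: "cpoly f \<Longrightarrow> cpoly g \<Longrightarrow> cpoly (\<lambda>x. f x + g x)"
| cpoly_mult: "cpoly f \<Longrightarrow> cpoly g \<Longrightarrow> cpoly (\<lambda>x. f x * g x)"

lemma cpoly_sum: "(\<And>i. i \<in> A \<Longrightarrow> cpoly (f i)) \<Longrightarrow> cpoly (\<lambda>x. \<Sum>i\<in>A. f i x)"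
  by (induction A rule: infinite_finite_induct) (auto intro: cpoly.intros)

lemma cpoly_prod: "(\<And>i. i \<in> A \<Longrightarrow> cpoly (f i)) \<Longrightarrow> cpoly (\<lambda>x. \<Prod>i\<in>A. f i x)"
  by (induction A rule: infinite_finite_induct) (auto intro: cpoly.intros)

lemma cpoly_power: "cpoly f \<Longrightarrow> cpoly (\<lambda>x. f x ^ k)"
  by (induction k) (auto intro: cpoly.intros)

lemma cpoly_uminus: "cpoly f \<Longrightarrow> cpoly (\<lambda>x. - f x)"
  using cpoly_mult[OF cpoly_const[of "-1"], of f] by simp

lemma cpoly_diff: "cpoly f \<Longrightarrow> cpoly g \<Longrightarrow> cpoly (\<lambda>x. f x - g x)"
  using cpoly_add[OF _ cpoly_uminus, of f g] by simp

lemmas cpoly_intros = cpoly_const cpoly_comp cpoly_add cpoly_mult cpoly_sum cpoly_prod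
  cpoly_power cpoly_uminus cpoly_diff

lemma cpoly_det:
  assumes "\<And>i j. cpoly (\<lambda>x. M x $ i $ j)"
  shows "cpoly (\<lambda>x. det (M x))"
  unfolding det_def by (intro cpoly_intros assms)

lemma cpoly_compose:
  assumes "cpoly f" and "\<And>i. cpoly (\<lambda>x. h x $ i)"
  shows "cpoly (\<lambda>x. f (h x))"
  using assms(1) by induction (auto intro: cpoly.intros assms(2))

lemma cpoly_line:
  assumes "cpoly f"
  obtains p where "\<And>t. f (a + t *s b) = poly p t"
proof -
  from assms have "\<exists>p. \<forall>t. f (a + t *s b) = poly p t"
  proof induction
    case (cpoly_const c)
    show ?case by (intro exI[of _ "[:c:]"]) simp
  next
    case (cpoly_comp i)
    show ?case by (intro exI[of _ "[:a $ i, b $ i:]"]) simp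
  next
    case (cpoly_add f g)
    then show ?case by (metis poly_add)
  next
    case (cpoly_mult f g)
    then show ?case by (metis poly_mult)
  qed
  with that show ?thesis by blast
qed

lemma cpoly_line_finite:
  assumes "cpoly f" and "f a \<noteq> 0"
  shows "finite {t. f (a + t *s b) = 0}"
proof -
  obtain p where p: "\<And>t. f (a + t *s b) = poly p t"
    using cpoly_line[OF assms(1)] by blast
  have "p \<noteq> 0"
    using p[of 0] assms(2) by auto
  then show ?thesis
    using poly_roots_finite[of p] by (simp add: p)
qed

text \<open>Polynomial functions form an integral domain: on the line through \<open>a\<close> and
  \<open>b\<close> each factor vanishes for finitely many parameters only.\<close>

lemma cpoly_mult_nonzero:
  assumes "cpoly f" "cpoly g" and "f a \<noteq> 0" "g b \<noteq> 0"
  obtains c where "f c \<noteq> 0" "g c \<noteq> 0"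
proof -
  have "finite {t. f (a + t *s (b - a)) = 0}"
    by (rule cpoly_line_finite) fact+
  \<comment> \<open>\<open>g\<close> is known to be nonzero at \<open>b\<close>, so its restriction
    is parametrised from \<open>b\<close>; \<open>t\<close> and \<open>1 - t\<close> then describe
    the same point.\<close>
  moreover have "finite ((\<lambda>t. 1 - t) ` {t. g (b + t *s (a - b)) = 0})"
    by (intro finite_imageI cpoly_line_finite) fact+
  ultimately have "finite ({t. f (a + t *s (b - a)) = 0} \<union> (\<lambda>t. 1 - t) ` {t. g (b + t *s (a - b)) = 0})"
    (is "finite ?S") by blast
  then obtain t where t: "t \<notin> ?S"
    using infinite_UNIV_char_0 ex_new_if_finite by blast
  have eq: "b + (1 - t) *s (a - b) = a + t *s (b - a)"
    by (simp add: vec_eq_iff algebra_simps)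
  have "g (b + (1 - t) *s (a - b)) \<noteq> 0"
  proof
    assume "g (b + (1 - t) *s (a - b)) = 0"
    then have "1 - (1 - t) \<in> (\<lambda>t. 1 - t) ` {t. g (b + t *s (a - b)) = 0}" by blast
    with t show False by simp
  qed
  with t that[of "a + t *s (b - a)"] show ?thesis
    unfolding eq by simp
qed

lemma cpoly_prod_nonzero:
  assumes "finite A" and "\<And>i. i \<in> A \<Longrightarrow> cpoly (f i)" and "\<And>i. i \<in> A \<Longrightarrow> \<exists>a. f i a \<noteq> 0"
  shows "\<exists>a. (\<Prod>i\<in>A. f i a) \<noteq> 0"
  using assms
proof (induction A rule: finite_induct)
  case (insert i A)
  then obtain a b where "f i a \<noteq> 0" "(\<Prod>i\<in>A. f i b) \<noteq> 0" by blast
  moreover have "cpoly (f i)" "cpoly (\<lambda>x. \<Prod>i\<in>A. f i x)"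
    using insert.prems by (auto intro!: cpoly_prod)
  ultimately obtain c where "f i c \<noteq> 0" "(\<Prod>i\<in>A. f i c) \<noteq> 0"
    using cpoly_mult_nonzero[of "f i" "\<lambda>x. \<Prod>i\<in>A. f i x" a b] by metis
  then show ?case using insert.hyps by auto
qed simp

lemma cpoly_has_derivative:
  fixes f :: "complex ^ 'n \<Rightarrow> complex"
  assumes "cpoly f"
  obtains D where "\<And>i. cpoly (D i)"
    and "\<And>x. (f has_derivative (\<lambda>h. \<Sum>i\<in>UNIV. D i x * h $ i)) (at x)"
proof -
  from assms have "\<exists>D. (\<forall>i. cpoly (D i)) \<and>
      (\<forall>x. (f has_derivative (\<lambda>h. \<Sum>i\<in>UNIV. D i x * h $ i)) (at x))"
  proof induction
    case (cpoly_const c)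
    show ?case
      by (intro exI[of _ "\<lambda>i x. 0"]) (auto intro: cpoly.intros)
  next
    case (cpoly_comp i)
    have "((\<lambda>x. x $ i) has_derivative (\<lambda>h. h $ i)) (at x)" for x :: "complex ^ 'n"
      by (intro bounded_linear_imp_has_derivative bounded_linear_vec_nth)
    moreover have "(\<lambda>h::complex ^ 'n. \<Sum>j\<in>UNIV. (if j = i then 1 else 0) * h $ j) = (\<lambda>h. h $ i)"
      by (simp add: if_distrib[of "\<lambda>c. c * _"] cong: if_cong)
    ultimately show ?case
      by (intro exI[of _ "\<lambda>j x. if j = i then 1 else 0"]) (auto intro: cpoly.intros)
  next
    case (cpoly_add f g)
    then obtain D E where D: "\<And>i. cpoly (D i)" "\<And>i. cpoly (E i)"
      "\<And>x. (f has_derivative (\<lambda>h. \<Sum>i\<in>UNIV. D i x * h $ i)) (at x)"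
      "\<And>x. (g has_derivative (\<lambda>h. \<Sum>i\<in>UNIV. E i x * h $ i)) (at x)" by blast
    show ?case
    proof (intro exI[of _ "\<lambda>i x. D i x + E i x"] conjI allI)
      show "cpoly (\<lambda>x. D i x + E i x)" for i by (intro cpoly_intros D)
      show "((\<lambda>x. f x + g x) has_derivative (\<lambda>h. \<Sum>i\<in>UNIV. (D i x + E i x) * h $ i)) (at x)" for x
        using has_derivative_add[OF D(3) D(4)] by (simp add: distrib_right sum.distrib)
    qed
  next
    case (cpoly_mult f g)
    then obtain D E where D: "\<And>i. cpoly (D i)" "\<And>i. cpoly (E i)"
      "\<And>x. (f has_derivative (\<lambda>h. \<Sum>i\<in>UNIV. D i x * h $ i)) (at x)"
      "\<And>x. (g has_derivative (\<lambda>h. \<Sum>i\<in>UNIV. E i x * h $ i)) (at x)" by blast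
    show ?case
    proof (intro exI[of _ "\<lambda>i x. f x * E i x + g x * D i x"] conjI allI)
      show "cpoly (\<lambda>x. f x * E i x + g x * D i x)" for i by (intro cpoly_intros D cpoly_mult)
      show "((\<lambda>x. f x * g x) has_derivative
          (\<lambda>h. \<Sum>i\<in>UNIV. (f x * E i x + g x * D i x) * h $ i)) (at x)" for x
        using has_derivative_mult[OF D(3) D(4)]
        by (rule has_derivative_eq_rhs)
          (simp add: fun_eq_iff distrib_left sum.distrib sum_distrib_left mult_ac)
    qed
  qed
  with that show ?thesis by blast
qed

lemma cpoly_continuous: "cpoly f \<Longrightarrow> continuous_on A f"
  by (induction rule: cpoly.induct) (auto intro!: continuous_intros)

lemma cpoly_vec_continuous:
  fixes F :: "complex ^ 'n \<Rightarrow> complex ^ 'm"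
  assumes "\<And>i. cpoly (\<lambda>x. F x $ i)"
  shows "continuous_on A F"
proof -
  have "continuous_on A (\<lambda>x. \<chi> i. F x $ i)"
    by (intro continuous_on_vec_lambda cpoly_continuous assms)
  then show ?thesis by simp
qed

section \<open>Algebraic dependence\<close>

text \<open>Gaussian elimination, one equation at a time. The index sets are arbitrary finite sets
  because the unknowns below are indexed by pairs of exponents or by a disjoint union, and because
  one equation is often left out.\<close>

lemma homogeneous_system:
  fixes M :: "'a \<Rightarrow> 'b \<Rightarrow> complex"
  assumes "finite B" "finite A" "card B < card A"
  obtains c where "\<exists>a\<in>A. c a \<noteq> 0" and "\<And>b. b \<in> B \<Longrightarrow> (\<Sum>a\<in>A. c a * M a b) = 0"
proof -
  have "\<exists>c. (\<exists>a\<in>A. c a \<noteq> 0) \<and> (\<forall>b\<in>B. (\<Sum>a\<in>A. c a * M a b) = 0)"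
    using assms
  proof (induction B arbitrary: A M rule: finite_induct)
    case empty
    then have "A \<noteq> {}" by auto
    then show ?case by (intro exI[of _ "\<lambda>_. 1"]) auto
  next
    case (insert b B)
    show ?case
    proof (cases "\<forall>a\<in>A. M a b = 0")
      case True
      obtain c where "\<exists>a\<in>A. c a \<noteq> 0" "\<forall>b\<in>B. (\<Sum>a\<in>A. c a * M a b) = 0"
        using insert.IH[of A M] insert.prems insert.hyps by auto
      with True show ?thesis by (intro exI[of _ c]) auto
    next
      case False
      then obtain a0 where a0: "a0 \<in> A" "M a0 b \<noteq> 0" by blast
      \<comment> \<open>\<open>a0\<close> is the pivot: \<open>M'\<close> clears equation
        \<open>b\<close> from the other unknowns, and \<open>c'\<close> solves that equation for
        \<open>a0\<close>.\<close>
      define M' where "M' = (\<lambda>a b'. M a b' - M a b / M a0 b * M a0 b')"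
      have "card B < card (A - {a0})"
        using insert a0 by auto
      then obtain c where c: "\<exists>a\<in>A - {a0}. c a \<noteq> 0"
          "\<forall>b\<in>B. (\<Sum>a\<in>A - {a0}. c a * M' a b) = 0"
        using insert.IH[of "A - {a0}" M'] insert.prems by auto
      define c' where "c' = c(a0 := - (\<Sum>a\<in>A - {a0}. c a * M a b) / M a0 b)"
      have eq: "(\<Sum>a\<in>A. c' a * M a b') =
          c' a0 * M a0 b' + (\<Sum>a\<in>A - {a0}. c a * M a b')" for b'
        using sum.remove[OF \<open>finite A\<close> a0(1), of "\<lambda>a. c' a * M a b'"]
        by (simp add: c'_def)
      have "(\<Sum>a\<in>A. c' a * M a b) = 0"
        unfolding eq using a0 by (simp add: c'_def)
      moreover have "(\<Sum>a\<in>A. c' a * M a b') = 0" if "b' \<in> B" for b'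
      proof -
        have "0 = (\<Sum>a\<in>A - {a0}. c a * M' a b')" using c that by simp
        also have "\<dots> = (\<Sum>a\<in>A - {a0}. c a * M a b') - (\<Sum>a\<in>A - {a0}. c a * M a b) / M a0 b * M a0 b'"
          by (simp add: M'_def sum_subtractf right_diff_distrib sum_distrib_left sum_divide_distrib mult_ac)
        finally show ?thesis
          unfolding eq by (simp add: c'_def)
      qed
      moreover have "\<exists>a\<in>A. c' a \<noteq> 0"
        using c by (auto simp: c'_def)
      ultimately show ?thesis by blast
    qed
  qed
  with that show ?thesis by blast
qed

section \<open>Polynomials of bounded degree in each variable\<close>

text \<open>A box of exponents instead of a bound on the total degree: its size is a plain power,
  which keeps the count in \<open>algebraic_dependence\<close> free of binomial
  coefficients.\<close>

definition expts :: "nat \<Rightarrow> ('n::finite \<Rightarrow> nat) set" where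
  "expts N = {\<alpha>. \<forall>i. \<alpha> i \<le> N}"

lemma expts_PiE: "expts N = PiE UNIV (\<lambda>_. {..N})"
  unfolding expts_def PiE_def Pi_def extensional_def by simp

lemma finite_expts [simp]: "finite (expts N)"
  unfolding expts_PiE by (intro finite_PiE) auto

lemma card_expts: "card (expts N :: ('n::finite \<Rightarrow> nat) set) = (N + 1) ^ CARD('n)"
  unfolding expts_PiE by (simp add: card_PiE)

definition xpow :: "('n::finite \<Rightarrow> nat) \<Rightarrow> complex ^ 'n \<Rightarrow> complex" where
  "xpow \<alpha> x = (\<Prod>i\<in>UNIV. x $ i ^ \<alpha> i)"

lemma xpow_add: "xpow (\<lambda>i. \<alpha> i + \<beta> i) x = xpow \<alpha> x * xpow \<beta> x"
  by (simp add: xpow_def power_add prod.distrib)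

lemma cpoly_xpow: "cpoly (xpow \<alpha>)"
  unfolding xpow_def by (intro cpoly_intros)

definition cexp :: "nat \<Rightarrow> (complex ^ 'n::finite \<Rightarrow> complex) \<Rightarrow> bool" where
  "cexp N f \<longleftrightarrow> (\<exists>c. \<forall>x. f x = (\<Sum>\<alpha>\<in>expts N. c \<alpha> * xpow \<alpha> x))"

lemma cexp_weaken:
  assumes "cexp N f" "N \<le> M"
  shows "cexp M f"
proof -
  obtain c where c: "\<And>x. f x = (\<Sum>\<alpha>\<in>expts N. c \<alpha> * xpow \<alpha> x)"
    using assms by (auto simp: cexp_def)
  have "expts N \<subseteq> (expts M :: ('a \<Rightarrow> nat) set)"
    using assms(2) order_trans by (auto simp: expts_def)
  then have "f x = (\<Sum>\<alpha>\<in>expts M. (if \<alpha> \<in> expts N then c \<alpha> else 0) * xpow \<alpha> x)" for x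
    unfolding c by (intro sum.mono_neutral_cong_left) auto
  then show ?thesis unfolding cexp_def by metis
qed

lemma cexp_xpow: "\<alpha> \<in> expts N \<Longrightarrow> cexp N (\<lambda>x. c * xpow \<alpha> x)"
  unfolding cexp_def
  by (intro exI[of _ "\<lambda>\<beta>. if \<beta> = \<alpha> then c else 0"])
    (simp add: if_distrib[of "\<lambda>c. c * _"] cong: if_cong)

lemma cexp_const: "cexp N (\<lambda>x. c)"
  using cexp_xpow[of "\<lambda>_. 0" N c] by (simp add: expts_def xpow_def)

lemma cexp_comp: "cexp 1 (\<lambda>x. x $ i)"
proof -
  have "xpow (\<lambda>j. if j = i then 1 else 0) x = x $ i" for x :: "complex ^ 'a"
    by (simp add: xpow_def if_distrib[of "\<lambda>k. _ ^ k"] prod.delta cong: if_cong)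
  then show ?thesis
    using cexp_xpow[of "\<lambda>j. if j = i then 1 else 0" 1 1] by (simp add: expts_def)
qed

lemma cexp_add:
  assumes "cexp N f" "cexp N g"
  shows "cexp N (\<lambda>x. f x + g x)"
proof -
  obtain c d where "\<And>x. f x = (\<Sum>\<alpha>\<in>expts N. c \<alpha> * xpow \<alpha> x)" "\<And>x. g x = (\<Sum>\<alpha>\<in>expts N. d \<alpha> * xpow \<alpha> x)"
    using assms by (auto simp: cexp_def)
  then show ?thesis
    unfolding cexp_def by (intro exI[of _ "\<lambda>\<alpha>. c \<alpha> + d \<alpha>"]) (simp add: distrib_right sum.distrib)
qed

lemma cexp_mult:
  fixes f g :: "complex ^ 'n::finite \<Rightarrow> complex"
  assumes "cexp N f" "cexp M g"
  shows "cexp (N + M) (\<lambda>x. f x * g x)"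
proof -
  obtain c d where c: "\<And>x. f x = (\<Sum>\<alpha>\<in>expts N. c \<alpha> * xpow \<alpha> x)"
    and d: "\<And>x. g x = (\<Sum>\<alpha>\<in>expts M. d \<alpha> * xpow \<alpha> x)"
    using assms by (auto simp: cexp_def)
  let ?P = "expts N \<times> expts M :: (('n \<Rightarrow> nat) \<times> ('n \<Rightarrow> nat)) set"
  let ?s = "\<lambda>p i. fst p i + snd p i :: nat"
  have "f x * g x = (\<Sum>\<gamma>\<in>expts (N + M). (\<Sum>p\<in>{p\<in>?P. ?s p = \<gamma>}. c (fst p) * d (snd p)) * xpow \<gamma> x)" for x
  proof -
    have "f x * g x = (\<Sum>p\<in>?P. c (fst p) * d (snd p) * xpow (?s p) x)"
      unfolding c d sum_product by (simp add: sum.cartesian_product xpow_add case_prod_unfold mult_ac)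
    also have "\<dots> = (\<Sum>\<gamma>\<in>expts (N + M). \<Sum>p\<in>{p\<in>?P. ?s p = \<gamma>}. c (fst p) * d (snd p) * xpow (?s p) x)"
      by (rule sum.group[symmetric]) (simp, simp, auto simp: expts_def add_mono)
    also have "\<dots> = (\<Sum>\<gamma>\<in>expts (N + M). (\<Sum>p\<in>{p\<in>?P. ?s p = \<gamma>}. c (fst p) * d (snd p)) * xpow \<gamma> x)"
      by (intro sum.cong refl) (simp add: sum_distrib_right)
    finally show ?thesis .
  qed
  then show ?thesis
    unfolding cexp_def
    by (intro exI[of _ "\<lambda>\<gamma>. \<Sum>p\<in>{p\<in>?P. ?s p = \<gamma>}. c (fst p) * d (snd p)"] allI)
qed

lemma cpoly_cexp:
  assumes "cpoly f"
  obtains N where "cexp N f"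
proof -
  from assms have "\<exists>N. cexp N f"
  proof induction
    case (cpoly_add f g)
    then obtain N M where "cexp N f" "cexp M g" by blast
    then have "cexp (max N M) f" "cexp (max N M) g"
      using cexp_weaken[of N f "max N M"] cexp_weaken[of M g "max N M"] by simp_all
    then show ?case using cexp_add[of "max N M" f g] by blast
  next
    case (cpoly_mult f g)
    then obtain N M where "cexp N f" "cexp M g" by blast
    then show ?case using cexp_mult[of N f M g] by blast
  next
    case (cpoly_const c)
    show ?case using cexp_const[of 0 c] by blast
  next
    case (cpoly_comp i)
    show ?case using cexp_comp[of i] by blast
  qed
  with that show ?thesis by blast
qed

lemma cexp_power: "cexp N f \<Longrightarrow> cexp (k * N) (\<lambda>x. f x ^ k)"
proof (induction k)
  case 0
  show ?case by (simp add: cexp_const)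
next
  case (Suc k)
  then show ?case using cexp_mult[of N f "k * N" "\<lambda>x. f x ^ k"] by simp
qed

lemma cexp_prod:
  assumes "finite A" and "\<And>i. i \<in> A \<Longrightarrow> cexp N (f i)"
  shows "cexp (card A * N) (\<lambda>x. \<Prod>i\<in>A. f i x)"
  using assms
proof (induction A rule: finite_induct)
  case empty
  show ?case by (simp add: cexp_const)
next
  case (insert i A)
  then show ?case using cexp_mult[of N "f i" "card A * N" "\<lambda>x. \<Prod>i\<in>A. f i x"] by simp
qed

text \<open>Induction on the variables: with the others fixed, the sum is a univariate polynomial in
  \<open>v\<close> that vanishes everywhere, so each of its coefficients, a sum over the remaining
  variables \<open>S\<close>, vanishes identically.\<close>

lemma monomials_independent_PiE:
  fixes c :: "('i \<Rightarrow> nat) \<Rightarrow> complex"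
  assumes "finite S"
    and "\<And>x :: 'i \<Rightarrow> complex. (\<Sum>\<alpha>\<in>PiE S (\<lambda>_. {..k}). c \<alpha> * (\<Prod>i\<in>S. x i ^ \<alpha> i)) = 0"
    and "\<alpha> \<in> PiE S (\<lambda>_. {..k})"
  shows "c \<alpha> = 0"
  using assms
proof (induction S arbitrary: c \<alpha> rule: finite_induct)
  case empty
  then show ?case by simp
next
  case (insert v S)
  let ?E = "PiE S (\<lambda>_. {..k})"
  have *: "(\<Sum>y\<le>k. (\<Sum>\<beta>\<in>?E. c (\<beta>(v := y)) * (\<Prod>i\<in>S. x i ^ \<beta> i)) * t ^ y) = 0"
    for x :: "'i \<Rightarrow> complex" and t
  proof -
    have "0 = (\<Sum>\<alpha>\<in>PiE (insert v S) (\<lambda>_. {..k}). c \<alpha> * (\<Prod>i\<in>insert v S. (x(v := t)) i ^ \<alpha> i))"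
      using insert.prems(1)[of "x(v := t)"] by simp
    also have "\<dots> = (\<Sum>(y, \<beta>)\<in>{..k} \<times> ?E. c (\<beta>(v := y)) * (\<Prod>i\<in>insert v S. (x(v := t)) i ^ (\<beta>(v := y)) i))"
      unfolding PiE_insert_eq
      using inj_combinator[OF insert.hyps(2), of "\<lambda>_. {..k}"]
      by (subst sum.reindex) (auto simp: case_prod_unfold)
    also have "\<dots> = (\<Sum>(y, \<beta>)\<in>{..k} \<times> ?E. c (\<beta>(v := y)) * (t ^ y * (\<Prod>i\<in>S. x i ^ \<beta> i)))"
    proof (intro sum.cong refl, clarify)
      fix y \<beta>
      have "(\<Prod>i\<in>S. (x(v := t)) i ^ (\<beta>(v := y)) i) = (\<Prod>i\<in>S. x i ^ \<beta> i)"
        using insert.hyps(2) by (intro prod.cong) auto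
      then show "c (\<beta>(v := y)) * (\<Prod>i\<in>insert v S. (x(v := t)) i ^ (\<beta>(v := y)) i) =
          c (\<beta>(v := y)) * (t ^ y * (\<Prod>i\<in>S. x i ^ \<beta> i))"
        using insert.hyps by simp
    qed
    finally show ?thesis
      by (simp add: sum.cartesian_product[symmetric] sum_distrib_left mult_ac)
  qed
  have zero: "(\<Sum>\<beta>\<in>?E. c (\<beta>(v := y)) * (\<Prod>i\<in>S. x i ^ \<beta> i)) = 0" if "y \<le> k" for x y
    using * polyfun_eq_0[of "\<lambda>y. \<Sum>\<beta>\<in>?E. c (\<beta>(v := y)) * (\<Prod>i\<in>S. x i ^ \<beta> i)" k] that by blast
  from insert.prems(2) obtain y \<beta> where "y \<le> k" "\<beta> \<in> ?E" "\<alpha> = \<beta>(v := y)"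
    unfolding PiE_insert_eq by auto
  then show ?case
    using insert.IH[of "\<lambda>\<beta>. c (\<beta>(v := y))" \<beta>] zero by blast
qed

lemma monomials_independent:
  assumes "\<And>x :: complex ^ 'n::finite. (\<Sum>\<alpha>\<in>expts k. c \<alpha> * xpow \<alpha> x) = 0" and "\<alpha> \<in> expts k"
  shows "c \<alpha> = 0"
proof (rule monomials_independent_PiE[where S = UNIV and k = k and c = c])
  show "(\<Sum>\<alpha>\<in>UNIV \<rightarrow>\<^sub>E {..k}. c \<alpha> * (\<Prod>i\<in>UNIV. x i ^ \<alpha> i)) = 0" for x :: "'n \<Rightarrow> complex"
    using assms(1)[of "\<chi> i. x i"] by (simp add: xpow_def expts_PiE)
qed (use assms(2) in \<open>auto simp: expts_PiE\<close>)

text \<open>Siegel-style counting: the \<open>(k + 1)^(n + 1)\<close> products \<open>g^e * F^\<beta>\<close> with exponents at most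
  \<open>k\<close> lie in a space of dimension \<open>O(k^n)\<close>.\<close>

lemma algebraic_dependence:
  fixes F :: "complex ^ 'n \<Rightarrow> complex ^ 'n"
  assumes F: "\<And>i. cpoly (\<lambda>x. F x $ i)" and g: "cpoly g"
  obtains K r where "\<And>k. cpoly (r k)" and "\<exists>k\<le>K. \<exists>y. r k y \<noteq> 0"
    and "\<And>x. (\<Sum>k\<le>K. r k (F x) * g x ^ k) = 0"
proof -
  obtain N where N: "\<And>i. cexp N (\<lambda>x. F x $ i)" "cexp N g"
  proof -
    have "\<exists>N. cexp N (\<lambda>x. F x $ i)" for i using F cpoly_cexp by blast
    then obtain d where d: "\<And>i. cexp (d i) (\<lambda>x. F x $ i)" by metis
    obtain e where e: "cexp e g" using g cpoly_cexp by blast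
    show ?thesis
    proof (rule that[of "e + sum d UNIV"])
      show "cexp (e + sum d UNIV) (\<lambda>x. F x $ i)" for i
        using d member_le_sum[of i UNIV d] by (intro cexp_weaken[OF d[of i]]) (auto intro: trans_le_add2)
      show "cexp (e + sum d UNIV) g" using e by (rule cexp_weaken) simp
    qed
  qed
  define n where "n = CARD('n)"
  \<comment> \<open>\<open>C\<close> satisfies \<open>L + 1 \<le> C * (k + 1)\<close>, and
    \<open>k = C ^ n\<close> turns this into \<open>(L + 1) ^ n \<le> k * (k + 1) ^ n\<close>, which
    is below the number \<open>(k + 1) ^ (n + 1)\<close> of products.\<close>
  define C where "C = (n + 1) * N + 1"
  define k where "k = C ^ n"
  define L where "L = (n + 1) * (k * N)"
  have cexp_term: "cexp L (\<lambda>x. g x ^ e * xpow \<beta> (F x))" if "e \<le> k" "\<beta> \<in> expts k" for e \<beta>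
  proof -
    have "cexp (k * N) (\<lambda>x. F x $ i ^ \<beta> i)" for i
      using that(2) by (intro cexp_weaken[OF cexp_power[OF N(1)]]) (auto simp: expts_def)
    then have "cexp (n * (k * N)) (\<lambda>x. xpow \<beta> (F x))"
      unfolding xpow_def n_def by (intro cexp_prod) auto
    moreover have "cexp (k * N) (\<lambda>x. g x ^ e)"
      using that(1) by (intro cexp_weaken[OF cexp_power[OF N(2)]]) auto
    ultimately show ?thesis
      using cexp_mult[of "k * N" "\<lambda>x. g x ^ e" "n * (k * N)" "\<lambda>x. xpow \<beta> (F x)"]
      by (simp add: L_def algebra_simps)
  qed
  have "\<exists>m. \<forall>x. g x ^ e * xpow \<beta> (F x) = (\<Sum>\<alpha>\<in>expts L. m \<alpha> * xpow \<alpha> x)"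
    if "e \<le> k" "\<beta> \<in> expts k" for e \<beta>
    using cexp_term[OF that] by (simp add: cexp_def)
  then obtain m where m: "\<And>e \<beta> x. e \<le> k \<Longrightarrow> \<beta> \<in> expts k \<Longrightarrow>
      g x ^ e * xpow \<beta> (F x) = (\<Sum>\<alpha>\<in>expts L. m e \<beta> \<alpha> * xpow \<alpha> x)"
    by metis
  let ?A = "{..k} \<times> (expts k :: ('n \<Rightarrow> nat) set)"
  have "card (expts L :: ('n \<Rightarrow> nat) set) < card ?A"
  proof -
    have "L + 1 \<le> C * (k + 1)" by (simp add: L_def C_def algebra_simps)
    then have "(L + 1) ^ n \<le> k * (k + 1) ^ n"
      using power_mono[of "L + 1" "C * (k + 1)" n] by (simp only: power_mult_distrib k_def)
    also have "\<dots> < (k + 1) * (k + 1) ^ n" by simp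
    finally show ?thesis by (simp add: card_expts card_cartesian_product n_def)
  qed
  from homogeneous_system[OF finite_expts _ this, of "\<lambda>p \<alpha>. m (fst p) (snd p) \<alpha>"]
  obtain c where c: "\<exists>p\<in>?A. c p \<noteq> 0"
    "\<And>\<alpha>. \<alpha> \<in> expts L \<Longrightarrow> (\<Sum>p\<in>?A. c p * m (fst p) (snd p) \<alpha>) = 0"
    by auto
  define r where "r = (\<lambda>e y. \<Sum>\<beta>\<in>expts k. c (e, \<beta>) * xpow \<beta> y)"
  show ?thesis
  proof
    show "cpoly (r e)" for e
      unfolding r_def by (intro cpoly_intros cpoly_xpow)
    obtain e \<beta> where e: "e \<le> k" "\<beta> \<in> expts k" "c (e, \<beta>) \<noteq> 0" using c(1) by auto
    have "\<exists>y. r e y \<noteq> 0"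
      using monomials_independent[where k = k and c = "\<lambda>\<beta>. c (e, \<beta>)" and \<alpha> = \<beta>] e by (auto simp: r_def)
    with e show "\<exists>e\<le>k. \<exists>y. r e y \<noteq> 0" by blast
    fix x
    have "(\<Sum>e\<le>k. r e (F x) * g x ^ e) = (\<Sum>e\<le>k. \<Sum>\<beta>\<in>expts k. c (e, \<beta>) * (g x ^ e * xpow \<beta> (F x)))"
      by (simp add: r_def sum_distrib_left mult_ac)
    also have "\<dots> = (\<Sum>p\<in>?A. c p * (g x ^ fst p * xpow (snd p) (F x)))"
      by (simp add: sum.cartesian_product case_prod_unfold)
    also have "\<dots> = (\<Sum>p\<in>?A. \<Sum>\<alpha>\<in>expts L. c p * m (fst p) (snd p) \<alpha> * xpow \<alpha> x)"
      by (intro sum.cong refl) (auto simp: m sum_distrib_left mult.assoc)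
    also have "\<dots> = (\<Sum>\<alpha>\<in>expts L. (\<Sum>p\<in>?A. c p * m (fst p) (snd p) \<alpha>) * xpow \<alpha> x)"
      by (subst sum.swap) (simp add: sum_distrib_right)
    also have "\<dots> = 0" using c(2) by simp
    finally show "(\<Sum>e\<le>k. r e (F x) * g x ^ e) = 0" .
  qed
qed

section \<open>Generic fibres of polynomial maps\<close>

lemma continuous_on_line:
  fixes a b :: "complex ^ 'n"
  shows "continuous_on A (\<lambda>t. a + t *s b)"
proof -
  have "continuous_on A (\<lambda>t. \<chi> i. a $ i + t * b $ i)"
    by (intro continuous_on_vec_lambda continuous_intros)
  then show ?thesis by (simp add: vec_eq_iff plus_vec_def vector_scalar_mult_def)
qed

text \<open>On the complex line through \<open>x\<close> and a point of \<open>S\<close>, the finite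
  zero set would contain a nonempty open set.\<close>

lemma cpoly_zero_on_open:
  assumes "cpoly f" and "open S" "S \<noteq> {}" and zero: "\<And>x. x \<in> S \<Longrightarrow> f x = 0"
  shows "f x = 0"
proof (rule ccontr)
  assume nz: "f x \<noteq> 0"
  obtain a where a: "a \<in> S" using assms by blast
  define T where "T = (\<lambda>t. x + t *s (a - x)) -` S"
  have "open T"
    unfolding T_def by (intro open_vimage \<open>open S\<close> continuous_on_line)
  moreover have "1 \<in> T"
    using a by (simp add: T_def)
  moreover have "T \<subseteq> {t. f (x + t *s (a - x)) = 0}"
    using zero by (auto simp: T_def)
  then have "finite T"
    using cpoly_line_finite[OF assms(1) nz] finite_subset by blast
  ultimately show False
    using clopen[of T] finite_imp_closed[of T] infinite_UNIV_char_0[where ?'a = complex] by auto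
qed

text \<open>Two points outside the zero set are joined by a complex line that meets it in finitely
  many points, and the complex plane stays connected when finitely many points are removed.\<close>

lemma connected_cpoly_nonzero:
  fixes P :: "complex ^ 'n \<Rightarrow> complex"
  assumes "cpoly P"
  shows "connected {y. P y \<noteq> 0}"
  unfolding connected_iff_connected_component
proof (intro ballI)
  fix a b assume ab: "a \<in> {y. P y \<noteq> 0}" "b \<in> {y. P y \<noteq> 0}"
  let ?l = "\<lambda>t. a + t *s (b - a)"
  let ?Z = "{t. P (?l t) = 0}"
  have "finite ?Z" using ab by (intro cpoly_line_finite assms) auto
  then have "connected (- ?Z)"
    by (intro path_connected_imp_connected path_connected_complement_countable)
      (auto intro: countable_finite)
  then have "connected (?l ` (- ?Z))"
    by (intro connected_continuous_image continuous_on_line)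
  moreover have "?l ` (- ?Z) \<subseteq> {y. P y \<noteq> 0}" by auto
  moreover have "?l 0 = a" "?l 1 = b" by simp_all
  then have "a \<in> ?l ` (- ?Z)" "b \<in> ?l ` (- ?Z)"
    using ab image_eqI[of a ?l 0 "- ?Z"] image_eqI[of b ?l 1 "- ?Z"] by auto
  ultimately show "connected_component {y. P y \<noteq> 0} a b"
    unfolding connected_component_def by blast
qed

text \<open>Dividing the relation of \<open>g\<close> over \<open>F\<close> by the lowest power of \<open>g\<close> makes its constant coefficient
  nonzero.  The locale \<open>polynomial_map\<close> below supplies \<open>indep\<close> at a regular point.\<close>

lemma elimination_nonzero:
  fixes F :: "complex ^ 'n \<Rightarrow> complex ^ 'n"
  assumes F: "\<And>i. cpoly (\<lambda>x. F x $ i)" and g: "cpoly g" "g a \<noteq> 0"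
    and indep: "\<And>r. cpoly r \<Longrightarrow> \<exists>y. r y \<noteq> 0 \<Longrightarrow> \<exists>x. r (F x) \<noteq> 0"
  obtains r where "cpoly r" "\<exists>y. r y \<noteq> 0" "\<And>x. r (F x) \<noteq> 0 \<Longrightarrow> g x \<noteq> 0"
proof -
  obtain r K where r: "\<And>k. cpoly (r k)" "\<exists>k\<le>K. \<exists>y. r k y \<noteq> 0"
    "\<And>x. (\<Sum>k\<le>K. r k (F x) * g x ^ k) = 0"
    by (rule algebraic_dependence[OF F g(1)]) (rule that; assumption)
  define k0 where "k0 = (LEAST k. k \<le> K \<and> (\<exists>y. r k y \<noteq> 0))"
  have k0: "k0 \<le> K" "\<exists>y. r k0 y \<noteq> 0"
    using LeastI_ex[OF r(2)] unfolding k0_def by auto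
  have below: "r k y = 0" if "k < k0" for k y
    using not_less_Least[of k "\<lambda>k. k \<le> K \<and> (\<exists>y. r k y \<noteq> 0)"] that k0(1) unfolding k0_def by auto
  have rF: "cpoly (\<lambda>x. r k (F x))" for k
    by (rule cpoly_compose[OF r(1)]) (rule F)
  let ?h = "\<lambda>x. \<Sum>k\<in>{k0..K}. r k (F x) * g x ^ (k - k0)"
  have h: "cpoly ?h"
    by (intro cpoly_sum cpoly_mult cpoly_power g(1) rF)
  have prod0: "g x ^ k0 * ?h x = 0" for x
  proof -
    have "g x ^ k0 * ?h x = (\<Sum>k\<in>{k0..K}. r k (F x) * g x ^ k)"
      unfolding sum_distrib_left
      by (intro sum.cong refl) (simp add: mult.left_commute flip: power_add)
    also have "\<dots> = (\<Sum>k\<le>K. r k (F x) * g x ^ k)"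
      using below by (intro sum.mono_neutral_left) auto
    finally show ?thesis using r(3) by simp
  qed
  have h0: "?h x = 0" for x
  proof (rule ccontr)
    assume "?h x \<noteq> 0"
    from cpoly_mult_nonzero[OF g(1) h g(2) this] obtain c where "g c \<noteq> 0" "?h c \<noteq> 0" by blast
    with prod0[of c] show False by simp
  qed
  show ?thesis
  proof (rule that[of "r k0"])
    show "g x \<noteq> 0" if "r k0 (F x) \<noteq> 0" for x
    proof
      assume "g x = 0"
      then have "?h x = (\<Sum>k\<in>{k0..K}. if k = k0 then r k0 (F x) else 0)"
        by (intro sum.cong refl) (auto simp: power_0_left)
      then show False using h0[of x] that k0(1) by simp
    qed
  qed (use r k0 in auto)
qed

text \<open>Off the zeros of the leading coefficient \<open>r N\<close>, the relation bounds its
  root \<open>g x\<close> in terms of \<open>F x\<close>, as in Cauchy's bound for the roots of a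
  polynomial; \<open>indep\<close> excludes a relation of degree 0 in \<open>g\<close>. Applied to
  the coordinates of \<open>x\<close>, this makes fibres bounded away from a hypersurface.\<close>

lemma elimination_bounded:
  fixes F :: "complex ^ 'n \<Rightarrow> complex ^ 'n"
  assumes F: "\<And>i. cpoly (\<lambda>x. F x $ i)" and g: "cpoly g"
    and indep: "\<And>r. cpoly r \<Longrightarrow> \<exists>y. r y \<noteq> 0 \<Longrightarrow> \<exists>x. r (F x) \<noteq> 0"
  obtains r b where "cpoly r" "\<exists>y. r y \<noteq> 0" "continuous_on UNIV (b :: _ \<Rightarrow> real)"
    and "\<And>x. norm (g x) * norm (r (F x)) \<le> b (F x)"
proof -
  obtain r K where r: "\<And>k. cpoly (r k)" "\<exists>k\<le>K. \<exists>y. r k y \<noteq> 0"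
    "\<And>x. (\<Sum>k\<le>K. r k (F x) * g x ^ k) = 0"
    by (rule algebraic_dependence[OF F g]) (rule that; assumption)
  define N where "N = (GREATEST k. k \<le> K \<and> (\<exists>y. r k y \<noteq> 0))"
  have N: "N \<le> K" "\<exists>y. r N y \<noteq> 0"
    using GreatestI_ex_nat[OF r(2), of K] unfolding N_def by auto
  have above: "r k y = 0" if "N < k" "k \<le> K" for k y
    using Greatest_le_nat[of "\<lambda>k. k \<le> K \<and> (\<exists>y. r k y \<noteq> 0)" k K] that unfolding N_def by force
  have eq: "(\<Sum>k\<le>N. r k (F x) * g x ^ k) = 0" for x
  proof -
    have "(\<Sum>k\<le>N. r k (F x) * g x ^ k) = (\<Sum>k\<le>K. r k (F x) * g x ^ k)"
      using above N(1) by (intro sum.mono_neutral_left) auto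
    then show ?thesis using r(3) by simp
  qed
  have "N \<noteq> 0"
  proof
    assume "N = 0"
    then have "r N (F x) = 0" for x using eq[of x] by simp
    with indep[OF r(1) N(2)] show False by blast
  qed
  then obtain M where M: "N = Suc M" by (cases N) auto
  let ?b = "\<lambda>y. norm (r N y) + (\<Sum>k\<le>M. norm (r k y))"
  show ?thesis
  proof (rule that[of "r N" ?b])
    show "continuous_on UNIV ?b"
      using cpoly_continuous[OF r(1), of UNIV]
      by (intro continuous_on_add continuous_on_norm continuous_on_sum) simp_all
    fix x
    let ?y = "F x" and ?t = "norm (g x)"
    show "?t * norm (r N ?y) \<le> ?b ?y"
    proof (cases "?t \<le> 1")
      case True
      then have "?t * norm (r N ?y) \<le> 1 * norm (r N ?y)" by (intro mult_right_mono) auto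
      moreover have "0 \<le> (\<Sum>k\<le>M. norm (r k ?y))" by (intro sum_nonneg) auto
      ultimately show ?thesis by simp
    next
      case False
      have "r N ?y * g x ^ N = - (\<Sum>k\<le>M. r k ?y * g x ^ k)"
        using eq[of x] eq_neg_iff_add_eq_0[of "r N ?y * g x ^ N"] by (simp add: M add.commute)
      then have "norm (r N ?y * g x ^ N) = norm (\<Sum>k\<le>M. r k ?y * g x ^ k)"
        by simp
      then have "norm (r N ?y) * ?t ^ N = norm (\<Sum>k\<le>M. r k ?y * g x ^ k)"
        by (simp only: norm_mult norm_power)
      also have "\<dots> \<le> (\<Sum>k\<le>M. norm (r k ?y) * ?t ^ k)"
        by (rule order_trans[OF norm_sum]) (simp add: norm_mult norm_power)
      also have "\<dots> \<le> (\<Sum>k\<le>M. norm (r k ?y) * ?t ^ M)"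
        using False by (intro sum_mono mult_left_mono power_increasing) auto
      finally have "norm (r N ?y) * ?t * ?t ^ M \<le> (\<Sum>k\<le>M. norm (r k ?y)) * ?t ^ M"
        by (simp add: M sum_distrib_right mult.assoc)
      then have "norm (r N ?y) * ?t \<le> (\<Sum>k\<le>M. norm (r k ?y))"
        using False by (subst (asm) mult_le_cancel_right_pos) (auto intro!: zero_less_power)
      then show ?thesis by (simp add: mult.commute add_increasing)
    qed
  qed (use r N in auto)
qed

lemma open_separated_pairs:
  fixes \<Sigma> :: "('a::t2_space \<Rightarrow> 'a) set"
  assumes "finite \<Sigma>" and "\<And>\<sigma>. \<sigma> \<in> \<Sigma> \<Longrightarrow> continuous_on UNIV \<sigma>"
  shows "open {(p, q). \<forall>\<sigma>\<in>\<Sigma>. \<sigma> p \<noteq> q}"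
proof -
  have "{(p, q). \<forall>\<sigma>\<in>\<Sigma>. \<sigma> p \<noteq> q} = (\<Inter>\<sigma>\<in>\<Sigma>. {z. \<sigma> (fst z) \<noteq> snd z})" by auto
  moreover have "open {z. \<sigma> (fst z) \<noteq> snd z}" if "\<sigma> \<in> \<Sigma>" for \<sigma>
    by (intro open_Collect_neq continuous_on_snd continuous_on_id
        continuous_on_compose2[OF assms(2)[OF that] continuous_on_fst]) auto
  ultimately show ?thesis using assms(1) by (simp add: open_INT)
qed

lemma component_norm_le: "norm (x $ i) \<le> norm x"
  unfolding norm_vec_def by (rule member_le_L2_set) auto

lemma norm_le_l1_vec: "norm x \<le> (\<Sum>i\<in>UNIV. norm (x $ i))"
  unfolding norm_vec_def by (rule L2_set_le_sum) auto

section \<open>Square polynomial maps and their regular points\<close>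

locale polynomial_map =
  fixes F :: "complex ^ 'n \<Rightarrow> complex ^ 'n" and jac :: "complex ^ 'n \<Rightarrow> complex ^ 'n ^ 'n"
  assumes F: "\<And>i. cpoly (\<lambda>x. F x $ i)"
    and jac: "\<And>i j. cpoly (\<lambda>x. jac x $ i $ j)"
    and deriv_F: "\<And>x. (F has_derivative (\<lambda>h. jac x *v h)) (at x)"
begin

lemma continuous_F: "continuous_on A F"
  using F by (rule cpoly_vec_continuous)

lemma bounded_linear_matrix: "bounded_linear (\<lambda>h. M *v h)" for M :: "complex ^ 'n ^ 'n"
  by (simp add: linear_conv_bounded_linear[symmetric] linear_iff vec_eq_iff
      matrix_vector_mult_def scaleR_sum_right distrib_left sum.distrib)

lemma inverse_matrix:
  assumes "det (jac x) \<noteq> 0"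
  obtains B where "jac x ** B = mat 1" "B ** jac x = mat 1"
  using assms invertible_det_nz[of "jac x"] unfolding invertible_def by blast

lemma open_map:
  assumes "det (jac x) \<noteq> 0" "x \<in> interior T"
  shows "F x \<in> interior (F ` T)"
proof -
  obtain B where B: "jac x ** B = mat 1" using inverse_matrix[OF assms(1)] by blast
  show ?thesis
  proof (rule sussmann_open_mapping[OF open_UNIV continuous_F _ deriv_F _ _ _ assms(2)])
    show "bounded_linear (\<lambda>h. B *v h)" by (rule bounded_linear_matrix)
    show "(\<lambda>h. jac x *v h) \<circ> (\<lambda>h. B *v h) = id"
      by (simp add: fun_eq_iff matrix_vector_mul_assoc B)
  qed auto
qed

lemma locally_injective:
  assumes "det (jac a) \<noteq> 0"
  obtains r where "r > 0" "inj_on F (ball a r)"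
proof -
  obtain B where B: "B ** jac a = mat 1" using inverse_matrix[OF assms(1)] by blast
  \<comment> \<open>The criterion for local injectivity wants the derivative to be continuous in
    operator norm, which the sum \<open>?s\<close> of entry differences dominates.\<close>
  have small: "\<exists>d>0. \<forall>x. dist a x < d \<longrightarrow> onorm (\<lambda>v. jac x *v v - jac a *v v) < e" if "e > 0" for e
  proof -
    let ?s = "\<lambda>x. \<Sum>i\<in>UNIV. \<Sum>j\<in>UNIV. norm (jac x $ i $ j - jac a $ i $ j)"
    have bound: "onorm (\<lambda>v. jac x *v v - jac a *v v) \<le> ?s x" for x
    proof (rule onorm_bound)
      show "0 \<le> ?s x" by (intro sum_nonneg) auto
      fix v
      have "norm (jac x *v v - jac a *v v) \<le> (\<Sum>i\<in>UNIV. norm ((jac x *v v - jac a *v v) $ i))"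
        by (rule norm_le_l1_vec)
      also have "\<dots> \<le> (\<Sum>i\<in>UNIV. \<Sum>j\<in>UNIV. norm (jac x $ i $ j - jac a $ i $ j) * norm v)"
      proof (intro sum_mono)
        fix i
        have "(jac x *v v - jac a *v v) $ i = (\<Sum>j\<in>UNIV. (jac x $ i $ j - jac a $ i $ j) * v $ j)"
          by (simp add: matrix_vector_mult_def sum_subtractf left_diff_distrib)
        also have "norm \<dots> \<le> (\<Sum>j\<in>UNIV. norm (jac x $ i $ j - jac a $ i $ j) * norm v)"
          by (intro sum_norm_le) (simp add: norm_mult mult_left_mono component_norm_le)
        finally show "norm ((jac x *v v - jac a *v v) $ i) \<le> \<dots>" .
      qed
      finally show "norm (jac x *v v - jac a *v v) \<le> ?s x * norm v"
        by (simp add: sum_distrib_right)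
    qed
    have "continuous_on UNIV ?s"
      by (intro continuous_on_sum continuous_on_norm continuous_on_diff continuous_on_const
          cpoly_continuous jac)
    then have "isCont ?s a" by (simp add: continuous_on_eq_continuous_at)
    then have "\<forall>\<^sub>F x in nhds a. dist (?s x) (?s a) < e"
      using \<open>e > 0\<close> tendsto_at_iff_tendsto_nhds[of ?s a] tendstoD[of ?s "?s a" "nhds a" e]
      unfolding isCont_def by blast
    then obtain d where d: "d > 0" "\<And>x. dist x a < d \<Longrightarrow> dist (?s x) (?s a) < e"
      unfolding eventually_nhds_metric by blast
    have "?s x < e" if "dist a x < d" for x
    proof -
      have "dist x a < d" using that by (simp add: dist_commute)
      from d(2)[OF this] show ?thesis by (simp add: dist_real_def abs_less_iff)
    qed
    with bound d(1) show ?thesis by (meson order_le_less_trans)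
  qed
  have "(\<lambda>h. B *v h) \<circ> (\<lambda>h. jac a *v h) = id"
    by (simp add: fun_eq_iff matrix_vector_mul_assoc B)
  from has_derivative_locally_injective[of a UNIV "\<lambda>h. B *v h" "\<lambda>x h. jac x *v h" F, OF _ _ bounded_linear_matrix this deriv_F small]
  show ?thesis using that by auto
qed

text \<open>The image of \<open>F\<close> contains an open set near the image of a regular point,
  and a relation vanishing on it would vanish identically.\<close>

lemma algebraically_independent:
  assumes "det (jac a) \<noteq> 0" "cpoly r" "\<exists>y. r y \<noteq> 0"
  shows "\<exists>x. r (F x) \<noteq> 0"
proof (rule ccontr)
  assume "\<not> (\<exists>x. r (F x) \<noteq> 0)"
  then have "r y = 0" if "y \<in> interior (range F)" for y
    using that interior_subset[of "range F"] by auto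
  moreover have "interior (range F) \<noteq> {}"
    using open_map[OF assms(1), of UNIV] by auto
  ultimately have "r y = 0" for y
    using cpoly_zero_on_open[OF assms(2) open_interior, of "range F"] by blast
  with assms(3) show False by blast
qed

text \<open>The eliminants of \<open>g\<close> and of the Jacobian determinant keep fibres away from
  their zeros, those of the coordinates bound the fibres; \<open>P\<close> is the product of all of
  them.\<close>

lemma generic_fibre_bounds:
  assumes "det (jac a) \<noteq> 0" and g: "cpoly g" "g b \<noteq> 0"
  obtains P B where "cpoly P" "\<exists>y. P y \<noteq> 0" "continuous_on {y. P y \<noteq> 0} (B :: _ \<Rightarrow> real)"
    and "\<And>x. P (F x) \<noteq> 0 \<Longrightarrow> g x \<noteq> 0 \<and> det (jac x) \<noteq> 0 \<and> norm x \<le> B (F x)"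
proof -
  note indep = algebraically_independent[OF assms(1)]
  obtain r1 where r1: "cpoly r1" "\<exists>y. r1 y \<noteq> 0" "\<And>x. r1 (F x) \<noteq> 0 \<Longrightarrow> g x \<noteq> 0"
    by (rule elimination_nonzero[OF F g], erule (1) indep) (rule that; assumption)
  have "cpoly (\<lambda>x. det (jac x))"
    by (intro cpoly_det jac)
  note det = elimination_nonzero[OF F this assms(1)]
  obtain r2 where r2: "cpoly r2" "\<exists>y. r2 y \<noteq> 0" "\<And>x. r2 (F x) \<noteq> 0 \<Longrightarrow> det (jac x) \<noteq> 0"
    by (rule det, erule (1) indep) (rule that; assumption)
  have "\<exists>r b. cpoly r \<and> (\<exists>y. r y \<noteq> 0) \<and> continuous_on UNIV (b :: _ \<Rightarrow> real) \<and>
      (\<forall>x. norm (x $ i) * norm (r (F x)) \<le> b (F x))" for i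
    by (rule elimination_bounded[OF F cpoly_comp[of i]], erule (1) indep) blast
  then obtain r b where r: "\<And>i. cpoly (r i)" "\<And>i. \<exists>y. r i y \<noteq> 0"
      "\<And>i. continuous_on UNIV (b i :: _ \<Rightarrow> real)"
      "\<And>i x. norm (x $ i) * norm (r i (F x)) \<le> b i (F x)"
    by metis
  let ?R = "\<lambda>y. \<Prod>i\<in>UNIV. r i y"
  have R: "cpoly ?R" by (intro cpoly_prod r)
  obtain y where y: "?R y \<noteq> 0"
    using cpoly_prod_nonzero[of UNIV r] r by auto
  obtain y1 y2 where y12: "r1 y1 \<noteq> 0" "r2 y2 \<noteq> 0" using r1 r2 by blast
  obtain y3 where y3: "r1 y3 \<noteq> 0" "r2 y3 \<noteq> 0"
    using cpoly_mult_nonzero[OF r1(1) r2(1) y12] by blast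
  obtain y4 where y4: "r1 y4 * r2 y4 \<noteq> 0" "?R y4 \<noteq> 0"
    using cpoly_mult_nonzero[OF cpoly_mult[OF r1(1) r2(1)] R _ y] y3 by (metis mult_eq_0_iff)
  let ?P = "\<lambda>y. r1 y * r2 y * ?R y"
  let ?B = "\<lambda>y. \<Sum>i\<in>UNIV. b i y / norm (r i y)"
  show ?thesis
  proof (rule that[of ?P ?B])
    show "cpoly ?P" by (intro cpoly_mult r1(1) r2(1) R)
    show "\<exists>y. ?P y \<noteq> 0" using y4 by auto
    show "continuous_on {y. ?P y \<noteq> 0} ?B"
    proof (intro continuous_on_sum continuous_on_divide continuous_on_norm ballI)
      show "continuous_on {y. ?P y \<noteq> 0} (b i)" for i
        using r(3) by (rule continuous_on_subset) simp
      show "continuous_on {y. ?P y \<noteq> 0} (r i)" for i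
        using r(1) by (rule cpoly_continuous)
    qed auto
    show "g x \<noteq> 0 \<and> det (jac x) \<noteq> 0 \<and> norm x \<le> ?B (F x)" if nz: "?P (F x) \<noteq> 0" for x
    proof (intro conjI)
      show "g x \<noteq> 0" "det (jac x) \<noteq> 0" using nz r1(3) r2(3) by auto
      have "norm (x $ i) \<le> b i (F x) / norm (r i (F x))" for i
        using nz r(4)[of x i] by (simp add: pos_le_divide_eq)
      then have "(\<Sum>i\<in>UNIV. norm (x $ i)) \<le> ?B (F x)" by (intro sum_mono)
      then show "norm x \<le> ?B (F x)" using norm_le_l1_vec order_trans by blast
    qed
  qed
qed

theorem generic_fibre_pairs:
  fixes \<Sigma> :: "(complex ^ 'n \<Rightarrow> complex ^ 'n) set"
  assumes a: "det (jac a) \<noteq> 0" and a': "det (jac a') \<noteq> 0" and Faa': "F a = F a'"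
    and \<Sigma>: "finite \<Sigma>" "\<And>\<sigma>. \<sigma> \<in> \<Sigma> \<Longrightarrow> continuous_on UNIV \<sigma>"
      "\<And>\<sigma> x. \<sigma> \<in> \<Sigma> \<Longrightarrow> F (\<sigma> x) = F x"
    and aa': "\<And>\<sigma>. \<sigma> \<in> \<Sigma> \<Longrightarrow> \<sigma> a \<noteq> a'"
    and g: "cpoly g" "g b \<noteq> 0"
  obtains P where "cpoly P" "\<exists>y. P y \<noteq> 0"
    and "\<And>x. P (F x) \<noteq> 0 \<Longrightarrow> g x \<noteq> 0 \<and> det (jac x) \<noteq> 0"
    and "\<And>y. P y \<noteq> 0 \<Longrightarrow> \<exists>x x'. F x = y \<and> F x' = y \<and> (\<forall>\<sigma>\<in>\<Sigma>. \<sigma> x \<noteq> x')"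
proof -
  obtain P B where P: "cpoly P" "\<exists>y. P y \<noteq> 0" and B: "continuous_on {y. P y \<noteq> 0} (B :: _ \<Rightarrow> real)"
    and fib: "\<And>x. P (F x) \<noteq> 0 \<Longrightarrow> g x \<noteq> 0 \<and> det (jac x) \<noteq> 0 \<and> norm x \<le> B (F x)"
    by (rule generic_fibre_bounds[OF a g]) (rule that; assumption)
  define U where "U = {y. P y \<noteq> 0}"
  define W where "W = {(p, q). \<forall>\<sigma>\<in>\<Sigma>. \<sigma> p \<noteq> q}"
  have W: "open W" unfolding W_def by (intro open_separated_pairs \<Sigma>)
  define A where "A = {y\<in>U. \<exists>x x'. F x = y \<and> F x' = y \<and> (x, x') \<in> W}"
  have U: "open U"
    unfolding U_def by (intro open_Collect_neq cpoly_continuous P continuous_on_const)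
  \<comment> \<open>By the open mapping property both preimages follow every small change of the
    value, and the pair stays in the open set \<open>W\<close>.\<close>
  have spread: "\<exists>V. open V \<and> F x \<in> V \<and> V \<inter> U \<subseteq> A"
    if x: "det (jac x) \<noteq> 0" "det (jac x') \<noteq> 0" "F x = F x'" "(x, x') \<in> W" for x x'
  proof -
    obtain S S' where S: "open S" "open S'" "x \<in> S" "x' \<in> S'" "S \<times> S' \<subseteq> W"
      using W x(4) by (rule open_prod_elim) auto
    let ?V = "interior (F ` S) \<inter> interior (F ` S')"
    have "F x \<in> ?V"
      using open_map[OF x(1), of S] open_map[OF x(2), of S'] S x(3) by (simp add: interior_open)
    moreover have "?V \<inter> U \<subseteq> A"
    proof
      fix y assume y: "y \<in> ?V \<inter> U"
      then have "y \<in> F ` S" "y \<in> F ` S'" using interior_subset by auto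
      then obtain p q where "p \<in> S" "q \<in> S'" "F p = y" "F q = y" by auto
      with S y show "y \<in> A" unfolding A_def by blast
    qed
    ultimately show ?thesis by (intro exI[of _ ?V]) auto
  qed
  have "open A"
  proof (subst open_subopen, intro ballI)
    fix y assume "y \<in> A"
    then obtain x x' where x: "y \<in> U" "F x = y" "F x' = y" "(x, x') \<in> W"
      unfolding A_def by blast
    then have "det (jac x) \<noteq> 0" "det (jac x') \<noteq> 0" using fib by (auto simp: U_def)
    then obtain V where "open V" "y \<in> V" "V \<inter> U \<subseteq> A" using spread[of x x'] x by auto
    then show "\<exists>T. open T \<and> y \<in> T \<and> T \<subseteq> A"
      using U x(1) by (intro exI[of _ "V \<inter> U"]) auto
  qed
  \<comment> \<open>\<open>F a\<close> itself may be a zero of \<open>P\<close>; but the open set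
    \<open>V\<close> around it cannot lie inside the hypersurface.\<close>
  have "A \<noteq> {}"
  proof -
    obtain V where V: "open V" "F a \<in> V" "V \<inter> U \<subseteq> A"
      using spread[of a a'] a a' Faa' aa' by (auto simp: W_def)
    have "V \<inter> U \<noteq> {}"
      using cpoly_zero_on_open[OF P(1) V(1)] V(2) P(2) by (auto simp: U_def)
    with V(3) show ?thesis by blast
  qed
  have "y \<in> A" if y: "y \<in> U" "y \<in> closure A" for y
  proof -
    obtain s where s: "\<And>n. s n \<in> A" "s \<longlonglongrightarrow> y"
      using y(2) unfolding closure_sequential by blast
    have sU: "s n \<in> U" for n using s(1) unfolding A_def by blast
    have "\<forall>n. \<exists>z. F (fst z) = s n \<and> F (snd z) = s n \<and> z \<in> W"
      using s(1) unfolding A_def by fastforce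
    then obtain z where z: "\<And>n. F (fst (z n)) = s n" "\<And>n. F (snd (z n)) = s n" "\<And>n. z n \<in> W"
      by metis
    have "(\<lambda>n. B (s n)) \<longlonglongrightarrow> B y"
      using B y(1) s(2) sU unfolding U_def[symmetric]
      by (intro continuous_on_tendsto_compose[OF B[folded U_def] s(2) y(1)]) auto
    then have "Bseq (\<lambda>n. B (s n))" by (intro convergent_imp_Bseq convergentI)
    then obtain M where M: "\<And>n. norm (B (s n)) \<le> M" unfolding Bseq_def by blast
    have "norm (fst (z n)) \<le> M \<and> norm (snd (z n)) \<le> M" for n
      using fib[of "fst (z n)"] fib[of "snd (z n)"] z(1,2)[of n] sU[of n] M[of n]
      unfolding U_def by auto
    then have "z n \<in> cball 0 M \<times> cball 0 M" for n
      by (auto simp: mem_Times_iff)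
    moreover have "compact (cball (0 :: complex ^ 'n) M \<times> cball (0 :: complex ^ 'n) M)"
      by (intro compact_Times compact_cball)
    ultimately obtain l \<rho> where l: "strict_mono \<rho>" "(z \<circ> \<rho>) \<longlonglongrightarrow> l"
      unfolding compact_def by blast
    have lim: "(\<lambda>n. s (\<rho> n)) \<longlonglongrightarrow> y"
      using LIMSEQ_subseq_LIMSEQ[OF s(2) l(1)] by (simp add: o_def)
    have zl: "(\<lambda>n. fst (z (\<rho> n))) \<longlonglongrightarrow> fst l" "(\<lambda>n. snd (z (\<rho> n))) \<longlonglongrightarrow> snd l"
      using tendsto_fst[OF l(2)] tendsto_snd[OF l(2)] by (simp_all add: o_def)
    have "(\<lambda>n. F (fst (z (\<rho> n)))) \<longlonglongrightarrow> F (fst l)" "(\<lambda>n. F (snd (z (\<rho> n)))) \<longlonglongrightarrow> F (snd l)"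
      using zl by (auto intro!: continuous_on_tendsto_compose[OF continuous_F[of UNIV]])
    then have Fl: "F (fst l) = y" "F (snd l) = y"
      using lim LIMSEQ_unique unfolding z(1,2) by blast+
    \<comment> \<open>Were the limits equivalent, then \<open>\<sigma>\<close> of the first preimage
      and the second preimage would be distinct points with the same image, both converging to the
      regular point \<open>snd l\<close>, against local injectivity.\<close>
    have "\<sigma> (fst l) \<noteq> snd l" if \<sigma>: "\<sigma> \<in> \<Sigma>" for \<sigma>
    proof
      assume eq: "\<sigma> (fst l) = snd l"
      obtain r where r: "r > 0" "inj_on F (ball (snd l) r)"
        using locally_injective[of "snd l"] fib[of "snd l"] Fl(2) y(1) by (auto simp: U_def)
      have "(\<lambda>n. \<sigma> (fst (z (\<rho> n)))) \<longlonglongrightarrow> snd l"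
        using continuous_on_tendsto_compose[OF \<Sigma>(2)[OF \<sigma>] zl(1)] eq by simp
      then have "\<forall>\<^sub>F n in sequentially. \<sigma> (fst (z (\<rho> n))) \<in> ball (snd l) r"
        by (rule topological_tendstoD) (use r(1) in auto)
      moreover have "\<forall>\<^sub>F n in sequentially. snd (z (\<rho> n)) \<in> ball (snd l) r"
        using zl(2) by (rule topological_tendstoD) (use r(1) in auto)
      ultimately have "\<forall>\<^sub>F n in sequentially. False"
      proof eventually_elim
        case (elim n)
        have "F (\<sigma> (fst (z (\<rho> n)))) = F (snd (z (\<rho> n)))"
          using \<Sigma>(3)[OF \<sigma>] z by simp
        then have "\<sigma> (fst (z (\<rho> n))) = snd (z (\<rho> n))"
          using inj_onD[OF r(2)] elim by blast
        then show False using z(3)[of "\<rho> n"] \<sigma> by (auto simp: W_def)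
      qed
      then show False by simp
    qed
    then show ?thesis
      using y(1) Fl by (auto simp: A_def W_def)
  qed
  moreover have "A \<subseteq> U" by (auto simp: A_def)
  ultimately have "closedin (top_of_set U) A"
    unfolding closedin_closed using closure_subset[of A]
    by (intro exI[of _ "closure A"]) auto
  moreover have "openin (top_of_set U) A"
    using \<open>open A\<close> by (auto simp: A_def intro!: openin_open_eq[THEN iffD2, OF U])
  moreover have "connected U"
    unfolding U_def by (rule connected_cpoly_nonzero[OF P(1)])
  ultimately have "A = U"
    using \<open>A \<noteq> {}\<close> unfolding connected_clopen by blast
  show ?thesis
  proof (rule that[OF P])
    show "g x \<noteq> 0 \<and> det (jac x) \<noteq> 0" if "P (F x) \<noteq> 0" for x using fib[OF that] by blast
    show "\<exists>x x'. F x = y \<and> F x' = y \<and> (\<forall>\<sigma>\<in>\<Sigma>. \<sigma> x \<noteq> x')" if "P y \<noteq> 0" for y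
      using \<open>A = U\<close> that by (auto simp: A_def U_def W_def)
  qed
qed

end

section \<open>Bihomogeneous forms\<close>

inductive bih :: "nat \<Rightarrow> nat \<Rightarrow> (complex ^ 3 \<Rightarrow> complex ^ 3 \<Rightarrow> complex) \<Rightarrow> bool" where
  bih_zero: "bih d e (\<lambda>x u. 0)"
| bih_const: "bih 0 0 (\<lambda>x u. c)"
| bih_fst: "bih 1 0 (\<lambda>x u. x $ a)"
| bih_snd: "bih 0 1 (\<lambda>x u. u $ a)"
| bih_add: "bih d e X \<Longrightarrow> bih d e Y \<Longrightarrow> bih d e (\<lambda>x u. X x u + Y x u)"
| bih_mult: "bih d e X \<Longrightarrow> bih d' e' Y \<Longrightarrow> bih (d + d') (e + e') (\<lambda>x u. X x u * Y x u)"

lemma bih_scale: "bih d e X \<Longrightarrow> bih d e (\<lambda>x u. c * X x u)"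
  using bih_mult[OF bih_const[of c], of d e X] by simp

lemma bih_sum: "(\<And>i. i \<in> A \<Longrightarrow> bih d e (X i)) \<Longrightarrow> bih d e (\<lambda>x u. \<Sum>i\<in>A. X i x u)"
  by (induction A rule: infinite_finite_induct) (auto intro: bih_zero bih_add)

lemma bih_uminus: "bih d e X \<Longrightarrow> bih d e (\<lambda>x u. - X x u)"
  using bih_scale[of d e X "-1"] by simp

lemma bih_diff: "bih d e X \<Longrightarrow> bih d e Y \<Longrightarrow> bih d e (\<lambda>x u. X x u - Y x u)"
  using bih_add[OF _ bih_uminus, of d e X Y] by simp

lemma bih_mult': "bih d e X \<Longrightarrow> bih d' e' Y \<Longrightarrow> d + d' = m \<Longrightarrow> e + e' = n \<Longrightarrow>
    bih m n (\<lambda>x u. X x u * Y x u)"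
  using bih_mult by blast

lemma bih_homogeneous: "bih d e X \<Longrightarrow> X (s *s x) (t *s u) = s ^ d * t ^ e * X x u"
  by (induction rule: bih.induct) (simp_all add: algebra_simps power_add)

section \<open>Expansion of forms into monomials\<close>

definition bimonom :: "3 list \<Rightarrow> 3 list \<Rightarrow> complex ^ 3 \<Rightarrow> complex ^ 3 \<Rightarrow> complex" where
  "bimonom as ds x u = (\<Prod>a\<leftarrow>as. x $ a) * (\<Prod>a\<leftarrow>ds. u $ a)"

text \<open>An induction over \<open>bih\<close> passes through other bidegrees. Here the bidegree
  is fixed, which yields the induction rule \<open>bih31_induct\<close> over monomials.\<close>

inductive bimonom_span :: "nat \<Rightarrow> nat \<Rightarrow> (complex ^ 3 \<Rightarrow> complex ^ 3 \<Rightarrow> complex) \<Rightarrow> bool" for d e where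
  bimonom_span_zero: "bimonom_span d e (\<lambda>x u. 0)"
| bimonom_span_step: "bimonom_span d e X \<Longrightarrow> length as = d \<Longrightarrow> length ds = e \<Longrightarrow>
    bimonom_span d e (\<lambda>x u. X x u + c * bimonom as ds x u)"

lemma bimonom_span_add:
  assumes "bimonom_span d e Y" "bimonom_span d e X"
  shows "bimonom_span d e (\<lambda>x u. X x u + Y x u)"
  using assms
proof (induction rule: bimonom_span.induct)
  case (bimonom_span_step Y as ds c)
  then show ?case
    using bimonom_span.bimonom_span_step[of d e "\<lambda>x u. X x u + Y x u" as ds c] by (simp add: add.assoc)
qed simp

lemma bimonom_span_monom_mult:
  assumes "bimonom_span d e X" "length as = d'" "length ds = e'"
  shows "bimonom_span (d' + d) (e' + e) (\<lambda>x u. c * bimonom as ds x u * X x u)"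
  using assms
proof (induction rule: bimonom_span.induct)
  case bimonom_span_zero
  then show ?case by (simp add: bimonom_span.bimonom_span_zero)
next
  case (bimonom_span_step X bs es k)
  then show ?case
    using bimonom_span.bimonom_span_step[of "d' + d" "e' + e" "\<lambda>x u. c * bimonom as ds x u * X x u" "as @ bs" "ds @ es" "c * k"]
    by (simp add: bimonom_def algebra_simps)
qed

lemma bimonom_span_mult:
  assumes "bimonom_span d e X" "bimonom_span d' e' Y"
  shows "bimonom_span (d + d') (e + e') (\<lambda>x u. X x u * Y x u)"
  using assms
proof (induction rule: bimonom_span.induct)
  case bimonom_span_zero
  then show ?case by (simp add: bimonom_span.bimonom_span_zero)
next
  case (bimonom_span_step X as ds c)
  then show ?case
    using bimonom_span_add[OF bimonom_span_monom_mult[OF bimonom_span_step.prems], of as d ds e "\<lambda>x u. X x u * Y x u" c]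
    by (simp add: distrib_right)
qed

lemma bih_bimonom_span: "bih d e X \<Longrightarrow> bimonom_span d e X"
proof (induction rule: bih.induct)
  case (bih_const c)
  show ?case
    using bimonom_span_step[OF bimonom_span_zero, of "[]" 0 "[]" 0 c] by (simp add: bimonom_def)
next
  case (bih_fst a)
  show ?case
    using bimonom_span_step[OF bimonom_span_zero, of "[a]" 1 "[]" 0 1] by (simp add: bimonom_def)
next
  case (bih_snd a)
  show ?case
    using bimonom_span_step[OF bimonom_span_zero, of "[]" 0 "[a]" 1 1] by (simp add: bimonom_def)
qed (auto intro: bimonom_span_zero bimonom_span_add bimonom_span_mult)

lemma bih31_induct [consumes 1, case_names zero step]:
  assumes "bih 3 1 X" and zero: "P (\<lambda>x u. 0)"
    and step: "\<And>X a b c d k. P X \<Longrightarrow> P (\<lambda>x u. X x u + k * (x $ a * x $ b * x $ c * u $ d))"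
  shows "P X"
  using bih_bimonom_span[OF assms(1)]
proof (induction rule: bimonom_span.induct)
  case (bimonom_span_step X as ds k)
  then obtain a b c d where "as = [a, b, c]" "ds = [d]"
    by (auto simp: length_Suc_conv eval_nat_numeral)
  then show ?case
    using step[OF bimonom_span_step.IH, of k a b c d] by (simp add: bimonom_def mult_ac)
qed (rule zero)

text \<open>Not assumed symmetric: only the diagonal \<open>tri C x x x u\<close> matters, and \<open>C\<close> is not unique.\<close>

definition tri :: "(3 \<Rightarrow> 3 \<Rightarrow> 3 \<Rightarrow> 3 \<Rightarrow> complex) \<Rightarrow>
    complex ^ 3 \<Rightarrow> complex ^ 3 \<Rightarrow> complex ^ 3 \<Rightarrow> complex ^ 3 \<Rightarrow> complex" where
  "tri C x y z u = (\<Sum>a\<in>UNIV. \<Sum>b\<in>UNIV. \<Sum>c\<in>UNIV. \<Sum>d\<in>UNIV. C a b c d * (x $ a * y $ b * z $ c * u $ d))"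

lemma tri_add:
  "tri C (x + x') y z u = tri C x y z u + tri C x' y z u"
  "tri C x (y + y') z u = tri C x y z u + tri C x y' z u"
  "tri C x y (z + z') u = tri C x y z u + tri C x y z' u"
  "tri C x y z (u + u') = tri C x y z u + tri C x y z u'"
  by (simp_all add: tri_def algebra_simps sum.distrib)

lemma tri_scale:
  "tri C (k *s x) y z u = k * tri C x y z u"
  "tri C x (k *s y) z u = k * tri C x y z u"
  "tri C x y (k *s z) u = k * tri C x y z u"
  "tri C x y z (k *s u) = k * tri C x y z u"
  by (simp_all add: tri_def sum_distrib_left mult_ac)

lemma bih_tri:
  assumes "\<And>a. bih d1 0 (\<lambda>x u. f x $ a)" "\<And>a. bih d2 0 (\<lambda>x u. g x $ a)"
    "\<And>a. bih d3 0 (\<lambda>x u. h x $ a)" "\<And>a. bih 0 e (\<lambda>x u. k u $ a)" "d1 + d2 + d3 = m"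
  shows "bih m e (\<lambda>x u. tri C (f x) (g x) (h x) (k u))"
  unfolding tri_def
  by (intro bih_sum bih_scale bih_mult'[OF bih_mult'[OF bih_mult'[OF assms(1,2)] assms(3)] assms(4)])
    (use assms(5) in auto)

lemma bih31_tri:
  assumes "bih 3 1 X"
  obtains C where "X = (\<lambda>x u. tri C x x x u)"
proof -
  have "\<exists>C. X = (\<lambda>x u. tri C x x x u)"
    using assms
  proof (induction rule: bih31_induct)
    case zero
    show ?case by (intro exI[of _ "\<lambda>a b c d. 0"]) (simp add: tri_def)
  next
    case (step X a b c d k)
    then obtain C where C: "X = (\<lambda>x u. tri C x x x u)" by blast
    let ?\<delta> = "\<lambda>a' b' c' d'. if d' = d then if c' = c then if b' = b then if a' = a then k else 0 else 0 else 0 else 0"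
    have "tri (\<lambda>a b c d. C a b c d + ?\<delta> a b c d) x x x u = tri C x x x u + tri ?\<delta> x x x u" for x u
      by (simp add: tri_def distrib_right sum.distrib)
    moreover have "tri ?\<delta> x x x u = k * (x $ a * x $ b * x $ c * u $ d)" for x u
      by (simp add: tri_def if_distrib[of "\<lambda>c. c * _"] cong: if_cong)
    ultimately show ?case
      unfolding C by (intro exI[of _ "\<lambda>a b c d. C a b c d + ?\<delta> a b c d"]) auto
  qed
  with that show ?thesis by blast
qed

lemma bih11_coeffs:
  assumes "bih 1 1 X"
  obtains C where "\<And>x u. X x u = (\<Sum>(a, d)\<in>UNIV. C (a, d) * (x $ a * u $ d))"
proof -
  have "\<exists>C. \<forall>x u. X x u = (\<Sum>(a, d)\<in>UNIV. C (a, d) * (x $ a * u $ d))"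
    using bih_bimonom_span[OF assms]
  proof (induction rule: bimonom_span.induct)
    case bimonom_span_zero
    show ?case by (intro exI[of _ "\<lambda>_. 0"]) simp
  next
    case (bimonom_span_step X as ds k)
    then obtain C where C: "\<And>x u. X x u = (\<Sum>(a, d)\<in>UNIV. C (a, d) * (x $ a * u $ d))" by blast
    from bimonom_span_step obtain a d where ad: "as = [a]" "ds = [d]"
      by (auto simp: length_Suc_conv)
    have "(\<Sum>p\<in>UNIV. (if p = (a, d) then k else 0) * (x $ fst p * u $ snd p)) = k * (x $ a * u $ d)"
      for x u :: "complex ^ 3"
      by (simp add: if_distrib[of "\<lambda>c. c * _"] cong: if_cong)
    then show ?case
      by (intro exI[of _ "\<lambda>p. C p + (if p = (a, d) then k else 0)"])
        (simp add: C ad bimonom_def distrib_right sum.distrib case_prod_unfold prod_eq_iff)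
  qed
  with that show ?thesis by blast
qed

section \<open>Linear forms and directional derivatives\<close>

definition lin :: "(complex ^ 3 \<Rightarrow> complex) \<Rightarrow> bool" where
  "lin f \<longleftrightarrow> (\<exists>c. \<forall>x. f x = (\<Sum>a\<in>UNIV. c a * x $ a))"

lemma lin_add: "lin f \<Longrightarrow> f (x + y) = f x + f y"
  by (auto simp: lin_def algebra_simps sum.distrib)

lemma lin_scale: "lin f \<Longrightarrow> f (k *s x) = k * f x"
  by (auto simp: lin_def sum_distrib_left mult_ac)

lemma lin_zero: "lin f \<Longrightarrow> f 0 = 0"
  using lin_scale[of f 0 0] by simp

lemma lin_bih:
  assumes "lin f"
  shows "bih 1 0 (\<lambda>x u. f x)" "bih 0 1 (\<lambda>x u. f u)"
proof -
  obtain c where "f = (\<lambda>x. \<Sum>a\<in>UNIV. c a * x $ a)"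
    using assms by (auto simp: lin_def fun_eq_iff)
  then show "bih 1 0 (\<lambda>x u. f x)" "bih 0 1 (\<lambda>x u. f u)"
    using bih_sum[OF bih_scale[OF bih_fst]] bih_sum[OF bih_scale[OF bih_snd]] by simp_all
qed

text \<open>The derivative of \<open>X\<close> at \<open>(x, u)\<close> in the direction \<open>(h, k)\<close>.\<close>

definition DD :: "(complex ^ 3 \<Rightarrow> complex ^ 3 \<Rightarrow> complex) \<Rightarrow>
    complex ^ 3 \<Rightarrow> complex ^ 3 \<Rightarrow> complex ^ 3 \<Rightarrow> complex ^ 3 \<Rightarrow> complex" where
  "DD X x u h k = deriv (\<lambda>\<epsilon>. X (x + \<epsilon> *s h) (u + \<epsilon> *s k)) 0"

text \<open>\<open>DD\<close> is defined one line at a time; the existence of a gradient is what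
  makes it linear in the direction.\<close>

lemma bih_gradient:
  assumes "bih d e X"
  obtains p q where "\<And>x u h k. ((\<lambda>\<epsilon>. X (x + \<epsilon> *s h) (u + \<epsilon> *s k)) has_field_derivative
    ((\<Sum>a\<in>UNIV. p x u a * h $ a) + (\<Sum>a\<in>UNIV. q x u a * k $ a))) (at 0)"
proof -
  have "\<exists>p q. \<forall>x u h k. ((\<lambda>\<epsilon>. X (x + \<epsilon> *s h) (u + \<epsilon> *s k)) has_field_derivative
    ((\<Sum>a\<in>UNIV. p x u a * h $ a) + (\<Sum>a\<in>UNIV. q x u a * k $ a))) (at 0)"
    (is "\<exists>p q. ?P X p q")
    using assms
  proof (induction rule: bih.induct)
    case (bih_zero d e)
    show ?case by (intro exI[of _ "\<lambda>_ _ _. 0"]) simp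
  next
    case (bih_const c)
    show ?case by (intro exI[of _ "\<lambda>_ _ _. 0"]) simp
  next
    case (bih_fst a)
    have "(\<Sum>b\<in>UNIV. (if b = a then 1 else 0) * h $ b) = h $ a" for h :: "complex ^ 3"
      by (simp add: if_distrib[of "\<lambda>c. c * _"] cong: if_cong)
    then show ?case
      by (intro exI[of _ "\<lambda>_ _ b. if b = a then 1 else 0"] exI[of _ "\<lambda>_ _ _. 0"])
        (auto intro!: derivative_eq_intros)
  next
    case (bih_snd a)
    have "(\<Sum>b\<in>UNIV. (if b = a then 1 else 0) * h $ b) = h $ a" for h :: "complex ^ 3"
      by (simp add: if_distrib[of "\<lambda>c. c * _"] cong: if_cong)
    then show ?case
      by (intro exI[of _ "\<lambda>_ _ _. 0"] exI[of _ "\<lambda>_ _ b. if b = a then 1 else 0"])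
        (auto intro!: derivative_eq_intros)
  next
    case (bih_add d e X Y)
    then obtain p q p' q' where "?P X p q" "?P Y p' q'" by (elim exE)
    then have "?P (\<lambda>x u. X x u + Y x u) (\<lambda>x u a. p x u a + p' x u a) (\<lambda>x u a. q x u a + q' x u a)"
      by (auto intro!: derivative_eq_intros simp: algebra_simps sum.distrib)
    then show ?case by (intro exI)
  next
    case (bih_mult d e X d' e' Y)
    then obtain p q p' q' where *: "?P X p q" "?P Y p' q'" by (elim exE)
    have "?P (\<lambda>x u. X x u * Y x u) (\<lambda>x u a. p x u a * Y x u + X x u * p' x u a)
        (\<lambda>x u a. q x u a * Y x u + X x u * q' x u a)"
    proof (intro allI)
      fix x u h k
      show "((\<lambda>\<epsilon>. X (x + \<epsilon> *s h) (u + \<epsilon> *s k) * Y (x + \<epsilon> *s h) (u + \<epsilon> *s k)) has_field_derivative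
        (\<Sum>a\<in>UNIV. (p x u a * Y x u + X x u * p' x u a) * h $ a) +
        (\<Sum>a\<in>UNIV. (q x u a * Y x u + X x u * q' x u a) * k $ a)) (at 0)"
        using DERIV_mult[OF *(1)[rule_format, of x h u k] *(2)[rule_format, of x h u k]]
        by (rule DERIV_cong) (simp add: algebra_simps sum.distrib sum_distrib_left sum_distrib_right)
    qed
    then show ?case by (intro exI)
  qed
  then obtain p q where "?P X p q" by (elim exE)
  then show ?thesis using that[of p q] by blast
qed

lemma DD_has_derivative:
  assumes "bih d e X"
  shows "((\<lambda>\<epsilon>. X (x + \<epsilon> *s h) (u + \<epsilon> *s k)) has_field_derivative DD X x u h k) (at 0)"
proof -
  obtain p q where *: "\<And>x u h k. ((\<lambda>\<epsilon>. X (x + \<epsilon> *s h) (u + \<epsilon> *s k)) has_field_derivative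
    ((\<Sum>a\<in>UNIV. p x u a * h $ a) + (\<Sum>a\<in>UNIV. q x u a * k $ a))) (at 0)"
    by (rule bih_gradient[OF assms]) (rule that; assumption)
  show ?thesis
    using *[of x h u k] DERIV_imp_deriv[OF *[of x h u k]] unfolding DD_def by simp
qed

lemma DD_linear:
  assumes "bih d e X"
  shows "DD X x u (h + h') (k + k') = DD X x u h k + DD X x u h' k'"
    and "DD X x u (c *s h) (c *s k) = c * DD X x u h k"
proof -
  obtain p q where "\<And>x u h k. ((\<lambda>\<epsilon>. X (x + \<epsilon> *s h) (u + \<epsilon> *s k)) has_field_derivative
    ((\<Sum>a\<in>UNIV. p x u a * h $ a) + (\<Sum>a\<in>UNIV. q x u a * k $ a))) (at 0)"
    by (rule bih_gradient[OF assms]) (rule that; assumption)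
  then have *: "DD X x u h k = (\<Sum>a\<in>UNIV. p x u a * h $ a) + (\<Sum>a\<in>UNIV. q x u a * k $ a)" for x u h k
    unfolding DD_def by (rule DERIV_imp_deriv)
  show "DD X x u (h + h') (k + k') = DD X x u h k + DD X x u h' k'"
    and "DD X x u (c *s h) (c *s k) = c * DD X x u h k"
    unfolding * by (simp_all add: algebra_simps sum.distrib sum_distrib_left)
qed

lemma DD_add:
  assumes "bih d e X" "bih d' e' Y"
  shows "DD (\<lambda>x u. X x u + Y x u) x u h k = DD X x u h k + DD Y x u h k"
  unfolding DD_def[of "\<lambda>x u. X x u + Y x u"]
  by (intro DERIV_imp_deriv DERIV_add DD_has_derivative[OF assms(1)] DD_has_derivative[OF assms(2)])

lemma DD_mult:
  assumes "bih d e X" "bih d' e' Y"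
  shows "DD (\<lambda>x u. X x u * Y x u) x u h k = X x u * DD Y x u h k + Y x u * DD X x u h k"
  unfolding DD_def[of "\<lambda>x u. X x u * Y x u"]
  by (rule DERIV_imp_deriv, rule DERIV_cong,
      rule DERIV_mult[OF DD_has_derivative[OF assms(1)] DD_has_derivative[OF assms(2)]])
    (simp add: algebra_simps)

lemma DD_scale:
  assumes "bih d e X"
  shows "DD (\<lambda>x u. c * X x u) x u h k = c * DD X x u h k"
  unfolding DD_def[of "\<lambda>x u. c * X x u"]
  by (intro DERIV_imp_deriv DERIV_cmult DD_has_derivative[OF assms])

lemma DD_diff:
  assumes "bih d e X" "bih d' e' Y"
  shows "DD (\<lambda>x u. X x u - Y x u) x u h k = DD X x u h k - DD Y x u h k"
  unfolding DD_def[of "\<lambda>x u. X x u - Y x u"]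
  by (intro DERIV_imp_deriv DERIV_diff DD_has_derivative[OF assms(1)] DD_has_derivative[OF assms(2)])

lemma DD_sum:
  assumes "finite A" "\<And>i. i \<in> A \<Longrightarrow> bih d e (X i)"
  shows "DD (\<lambda>x u. \<Sum>i\<in>A. X i x u) x u h k = (\<Sum>i\<in>A. DD (X i) x u h k)"
  unfolding DD_def[of "\<lambda>x u. \<Sum>i\<in>A. X i x u"]
  by (intro DERIV_imp_deriv DERIV_sum DD_has_derivative[OF assms(2)])

lemma DD_lin:
  assumes "lin f"
  shows "DD (\<lambda>x u. f x) x u h k = f h" "DD (\<lambda>x u. f u) x u h k = f k"
  unfolding DD_def lin_add[OF assms] lin_scale[OF assms]
  by (rule DERIV_imp_deriv; auto intro!: derivative_eq_intros)+

text \<open>Euler's identities. For bidegree (3,1) both degrees are positive, so vanishing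
  derivatives at a point force a vanishing value there.\<close>

lemma DD_euler:
  assumes "bih d e X"
  shows "DD X x u x 0 = of_nat d * X x u" "DD X x u 0 u = of_nat e * X x u"
proof -
  have *: "x + \<epsilon> *s x = (1 + \<epsilon>) *s x" for x :: "complex ^ 3" and \<epsilon>
    by (simp add: vec_eq_iff algebra_simps)
  have "X (x + \<epsilon> *s x) (u + \<epsilon> *s 0) = (1 + \<epsilon>) ^ d * X x u" for \<epsilon>
    unfolding * using bih_homogeneous[OF assms, of "1 + \<epsilon>" x 1 u] by simp
  then show "DD X x u x 0 = of_nat d * X x u"
    unfolding DD_def by (intro DERIV_imp_deriv) (auto intro!: derivative_eq_intros)
  have "X (x + \<epsilon> *s 0) (u + \<epsilon> *s u) = (1 + \<epsilon>) ^ e * X x u" for \<epsilon>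
    unfolding * using bih_homogeneous[OF assms, of 1 x "1 + \<epsilon>" u] by simp
  then show "DD X x u 0 u = of_nat e * X x u"
    unfolding DD_def by (intro DERIV_imp_deriv) (auto intro!: derivative_eq_intros)
qed

section \<open>Uniqueness of the second decomposition\<close>

text \<open>Coordinates adapted to the chord through the points \<open>i\<close> and \<open>k\<close> of the curve: \<open>r = 0\<close> is the line
  through \<open>l i\<close> and \<open>l k\<close>, its third intersection with the curve is the zero of \<open>m1 * s + m2 * t\<close>, and the
  second components of the three intersection points are \<open>v i\<close>, \<open>v k\<close>, \<open>w\<close>.  The last three conditions say
  that the restrictions of the net of bilinear forms to this line are diagonal.\<close>

definition chord_coords ::
    "('p \<Rightarrow> complex ^ 3) \<Rightarrow> ('p \<Rightarrow> complex ^ 3) \<Rightarrow> 'p \<Rightarrow> 'p \<Rightarrow> complex ^ 3 \<Rightarrow> complex ^ 3 \<Rightarrow>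
     (complex ^ 3 \<Rightarrow> complex) \<Rightarrow> (complex ^ 3 \<Rightarrow> complex) \<Rightarrow> (complex ^ 3 \<Rightarrow> complex) \<Rightarrow>
     (complex ^ 3 \<Rightarrow> complex) \<Rightarrow> (complex ^ 3 \<Rightarrow> complex) \<Rightarrow> (complex ^ 3 \<Rightarrow> complex) \<Rightarrow>
     (complex ^ 3 \<Rightarrow> complex) \<Rightarrow> (complex ^ 3 \<Rightarrow> complex) \<Rightarrow> (complex ^ 3 \<Rightarrow> complex) \<Rightarrow>
     complex \<Rightarrow> complex \<Rightarrow> bool" where
  "chord_coords l v i k e w s t r u1 u2 u3 b1 b2 b3 m1 m2 \<longleftrightarrow>
     (lin s \<and> lin t \<and> lin r \<and> lin u1 \<and> lin u2 \<and> lin u3 \<and> lin b1 \<and> lin b2 \<and> lin b3) \<and>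
     (\<forall>x. x = s x *s l i + t x *s l k + r x *s e) \<and>
     (\<forall>u. u = u1 u *s v i + u2 u *s v k + u3 u *s w) \<and>
     (s (l i) = 1 \<and> t (l i) = 0 \<and> r (l i) = 0) \<and> (s (l k) = 0 \<and> t (l k) = 1 \<and> r (l k) = 0) \<and>
     (s e = 0 \<and> t e = 0 \<and> r e = 1) \<and>
     (u1 (v i) = 1 \<and> u2 (v i) = 0 \<and> u3 (v i) = 0) \<and> (u1 (v k) = 0 \<and> u2 (v k) = 1 \<and> u3 (v k) = 0) \<and>
     (u1 w = 0 \<and> u2 w = 0 \<and> u3 w = 1) \<and>
     m1 \<noteq> 0 \<and> m2 \<noteq> 0 \<and>
     (\<forall>j. t (l j) * u1 (v j) + r (l j) * b1 (v j) = 0) \<and>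
     (\<forall>j. s (l j) * u2 (v j) + r (l j) * b2 (v j) = 0) \<and>
     (\<forall>j. (m1 * s (l j) + m2 * t (l j)) * u3 (v j) + r (l j) * b3 (v j) = 0)"

text \<open>The assumptions \<open>jet_inj\<close> and \<open>jet_surj\<close> are what the nonvanishing of the Jacobian determinant of the
  map from sextuples to their sums amounts to.\<close>

locale sextuple =
  fixes l v :: "'p::finite \<Rightarrow> complex ^ 3"
  assumes card_p: "CARD('p) = 6"
    and jet_inj: "\<And>X x u. bih 3 1 X \<Longrightarrow> (\<And>j h k. DD X (l j) (v j) h k = 0) \<Longrightarrow> X x u = 0"
    and jet_surj: "\<And>f i. lin f \<Longrightarrow> f (l i) = 0 \<Longrightarrow>
      \<exists>X. bih 3 1 X \<and> (\<forall>j h k. DD X (l j) (v j) h k = (if j = i then f h else 0))"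
    and chord: "\<And>i k. i \<noteq> k \<Longrightarrow>
      \<exists>e w s t r u1 u2 u3 b1 b2 b3 m1 m2. chord_coords l v i k e w s t r u1 u2 u3 b1 b2 b3 m1 m2"
    and bilinear_dual: "\<And>i. \<exists>B. bih 1 1 B \<and> (\<forall>j. B (l j) (v j) = (if j = i then 1 else 0))"
begin

definition K :: "(complex ^ 3 \<Rightarrow> complex ^ 3 \<Rightarrow> complex) set" where
  "K = {B. bih 1 1 B \<and> (\<forall>j. B (l j) (v j) = 0)}"

definition on_curve :: "complex ^ 3 \<Rightarrow> complex ^ 3 \<Rightarrow> bool" where
  "on_curve x u \<longleftrightarrow> (\<forall>B\<in>K. B x u = 0)"

definition prop_to :: "'p \<Rightarrow> complex ^ 3 \<Rightarrow> complex ^ 3 \<Rightarrow> bool" where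
  "prop_to i x u \<longleftrightarrow> (\<exists>\<alpha> \<beta>. x = \<alpha> *s l i \<and> u = \<beta> *s v i)"

text \<open>The tangent space of the bicone over the curve. It contains the scaling directions
  \<open>(l i, 0)\<close> and \<open>(0, v i)\<close>, so a genuine tangent direction of the curve
  is recognised below by a linear form \<open>f\<close> with \<open>f (l i) = 0\<close> and
  \<open>f h = 1\<close>.\<close>

definition tangent :: "'p \<Rightarrow> complex ^ 3 \<Rightarrow> complex ^ 3 \<Rightarrow> bool" where
  "tangent i h k \<longleftrightarrow> (\<forall>B\<in>K. DD B (l i) (v i) h k = 0)"

lemma K_scale: "B \<in> K \<Longrightarrow> (\<lambda>x u. c * B x u) \<in> K"
  by (auto simp: K_def intro: bih_scale)

lemma K_add: "B \<in> K \<Longrightarrow> B' \<in> K \<Longrightarrow> (\<lambda>x u. B x u + B' x u) \<in> K"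
  by (auto simp: K_def intro: bih_add)

lemma K_bih: "B \<in> K \<Longrightarrow> bih 1 1 B"
  by (simp add: K_def)

lemma other_index: obtains k :: 'p where "k \<noteq> i"
proof -
  have "UNIV \<noteq> {i}" using card_p by (metis card.empty card.insert empty_iff finite.emptyI numeral_eq_one_iff One_nat_def semiring_norm(85))
  then show ?thesis using that by blast
qed

end

section \<open>The net of bilinear forms along a chord\<close>

locale sextuple_chord = sextuple l v for l v :: "'p::finite \<Rightarrow> complex ^ 3" +
  fixes i k e w s t r u1 u2 u3 b1 b2 b3 m1 m2
  assumes cc: "chord_coords l v i k e w s t r u1 u2 u3 b1 b2 b3 m1 m2"
begin

lemma lins: "lin s" "lin t" "lin r" "lin u1" "lin u2" "lin u3" "lin b1" "lin b2" "lin b3"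
  using cc by (simp_all add: chord_coords_def)

lemma expand_fst: "x = s x *s l i + t x *s l k + r x *s e"
  using cc unfolding chord_coords_def by blast

lemma expand_snd: "u = u1 u *s v i + u2 u *s v k + u3 u *s w"
  using cc unfolding chord_coords_def by blast

lemma chord_values:
  "s (l i) = 1" "t (l i) = 0" "r (l i) = 0" "s (l k) = 0" "t (l k) = 1" "r (l k) = 0"
  "s e = 0" "t e = 0" "r e = 1"
  "u1 (v i) = 1" "u2 (v i) = 0" "u3 (v i) = 0" "u1 (v k) = 0" "u2 (v k) = 1" "u3 (v k) = 0"
  "u1 w = 0" "u2 w = 0" "u3 w = 1" "m1 \<noteq> 0" "m2 \<noteq> 0"
  using cc by (simp_all add: chord_coords_def)

definition \<mu> :: "complex ^ 3 \<Rightarrow> complex" where "\<mu> x = m1 * s x + m2 * t x"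
definition B1 :: "complex ^ 3 \<Rightarrow> complex ^ 3 \<Rightarrow> complex" where "B1 x u = t x * u1 u + r x * b1 u"
definition B2 :: "complex ^ 3 \<Rightarrow> complex ^ 3 \<Rightarrow> complex" where "B2 x u = s x * u2 u + r x * b2 u"
definition B3 :: "complex ^ 3 \<Rightarrow> complex ^ 3 \<Rightarrow> complex" where "B3 x u = \<mu> x * u3 u + r x * b3 u"

lemma lin_\<mu>: "lin \<mu>"
proof -
  obtain c d where "\<And>x. s x = (\<Sum>a\<in>UNIV. c a * x $ a)" "\<And>x. t x = (\<Sum>a\<in>UNIV. d a * x $ a)"
    using lins(1,2) by (auto simp: lin_def)
  then show ?thesis
    unfolding lin_def \<mu>_def
    by (intro exI[of _ "\<lambda>a. m1 * c a + m2 * d a"])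
      (simp add: distrib_right sum.distrib sum_distrib_left mult.assoc)
qed

lemma bih_product:
  assumes "lin f" "lin g"
  shows "bih 1 1 (\<lambda>x u. f x * g u)"
  by (rule bih_mult'[OF lin_bih(1)[OF assms(1)] lin_bih(2)[OF assms(2)]]) auto

lemma B_in_K: "B1 \<in> K" "B2 \<in> K" "B3 \<in> K"
proof -
  have "bih 1 1 B1" "bih 1 1 B2" "bih 1 1 B3"
    unfolding B1_def[abs_def] B2_def[abs_def] B3_def[abs_def]
    by (intro bih_add bih_product lins lin_\<mu>)+
  then show "B1 \<in> K" "B2 \<in> K" "B3 \<in> K"
    using cc by (auto simp: K_def chord_coords_def B1_def B2_def B3_def \<mu>_def)
qed

lemma DD_product:
  assumes "lin f" "lin g"
  shows "DD (\<lambda>x u. f x * g u) x u h k' = f x * g k' + g u * f h"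
  using DD_mult[OF lin_bih(1)[OF assms(1)] lin_bih(2)[OF assms(2)]]
  by (simp add: DD_lin[OF assms(1)] DD_lin[OF assms(2)])

lemma DD_B:
  "DD B1 x u h k' = t x * u1 k' + u1 u * t h + (r x * b1 k' + b1 u * r h)"
  "DD B2 x u h k' = s x * u2 k' + u2 u * s h + (r x * b2 k' + b2 u * r h)"
  "DD B3 x u h k' = \<mu> x * u3 k' + u3 u * \<mu> h + (r x * b3 k' + b3 u * r h)"
  unfolding B1_def[abs_def] B2_def[abs_def] B3_def[abs_def]
  by (simp_all add: DD_add[OF bih_product bih_product] DD_product lins lin_\<mu>)

text \<open>The dual bilinear forms show that \<open>K\<close> has dimension at most \<open>9 - 6 = 3\<close>.\<close>

lemma K_span:
  assumes "B \<in> K"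
  obtains \<alpha>1 \<alpha>2 \<alpha>3 where "B = (\<lambda>x u. \<alpha>1 * B1 x u + \<alpha>2 * B2 x u + \<alpha>3 * B3 x u)"
proof -
  obtain E where E: "\<And>j. bih 1 1 (E j)" "\<And>j n. E j (l n) (v n) = (if n = j then 1 else 0)"
    using bilinear_dual by metis
  define fam where "fam = (\<lambda>z::'p + nat. case z of Inl j \<Rightarrow> E j
    | Inr n \<Rightarrow> if n = 0 then B1 else if n = 1 then B2 else if n = 2 then B3 else B)"
  define A where "A = (UNIV :: 'p set) <+> {..<4::nat}"
  have fam: "bih 1 1 (fam z)" for z
    using E(1) B_in_K assms by (auto simp: fam_def K_def split: sum.split)
  have "\<exists>C. \<forall>x u. fam z x u = (\<Sum>(a, d)\<in>UNIV. C (a, d) * (x $ a * u $ d))" for z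
    by (rule bih11_coeffs[OF fam[of z]]) blast
  then have "\<exists>C. \<forall>z. \<forall>x u. fam z x u = (\<Sum>(a, d)\<in>UNIV. C z (a, d) * (x $ a * u $ d))"
    by (intro choice allI)
  then obtain C where C: "\<And>z x u. fam z x u = (\<Sum>(a, d)\<in>UNIV. C z (a, d) * (x $ a * u $ d))"
    by blast
  \<comment> \<open>Nine monomials of bidegree (1,1) against ten forms: six duals,
    \<open>B1\<close>, \<open>B2\<close>, \<open>B3\<close> and \<open>B\<close>.\<close>
  have "card (UNIV :: (3 \<times> 3) set) < card A"
    by (simp add: A_def card_Plus card_p UNIV_Times_UNIV[symmetric] card_cartesian_product del: UNIV_Times_UNIV)
  then obtain c where c: "\<exists>z\<in>A. c z \<noteq> 0" "\<And>p. (\<Sum>z\<in>A. c z * C z p) = 0"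
    using homogeneous_system[of "UNIV :: (3 \<times> 3) set" A C] by (auto simp: A_def)
  have zero: "(\<Sum>z\<in>A. c z * fam z x u) = 0" for x u
  proof -
    have "(\<Sum>z\<in>A. c z * fam z x u) = (\<Sum>p\<in>UNIV. (\<Sum>z\<in>A. c z * C z p) * (x $ fst p * u $ snd p))"
      unfolding C sum_distrib_left sum_distrib_right
      by (subst sum.swap) (simp add: case_prod_unfold mult.assoc)
    then show ?thesis by (simp add: c(2))
  qed
  have split: "(\<Sum>j\<in>UNIV. c (Inl j) * E j x u) + (c (Inr 0) * B1 x u + c (Inr 1) * B2 x u +
      c (Inr 2) * B3 x u + c (Inr 3) * B x u) = 0" for x u
    using zero[of x u]
    by (simp add: A_def sum.Plus fam_def eval_nat_numeral lessThan_Suc algebra_simps)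
  have cE: "c (Inl n) = 0" for n
    using split[of "l n" "v n"] B_in_K assms
    by (simp add: E(2) K_def if_distrib[of "\<lambda>x. _ * x"] cong: if_cong)
  have comb: "c (Inr 0) * B1 x u + c (Inr 1) * B2 x u + c (Inr 2) * B3 x u + c (Inr 3) * B x u = 0" for x u
    using split[of x u] by (simp add: cE)
  have "c (Inr 3) \<noteq> 0"
  proof
    assume c3: "c (Inr 3) = 0"
    \<comment> \<open>Each of the pairs \<open>(l k, v i)\<close>, \<open>(l i, v k)\<close>,
      \<open>(l i, w)\<close> is a zero of all but one of \<open>B1\<close>, \<open>B2\<close>,
      \<open>B3\<close>.\<close>
    have "c (Inr 0) = 0" using comb[of "l k" "v i"] by (simp add: c3 B1_def B2_def B3_def chord_values)
    moreover have "c (Inr 1) = 0" using comb[of "l i" "v k"] by (simp add: c3 B1_def B2_def B3_def chord_values)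
    moreover have "c (Inr 2) = 0" using comb[of "l i" w] by (simp add: c3 B1_def B2_def B3_def chord_values \<mu>_def)
    ultimately have "c z = 0" if "z \<in> A" for z
      using that cE c3 by (auto simp: A_def eval_nat_numeral less_Suc_eq)
    with c(1) show False by blast
  qed
  moreover have "c (Inr 3) * B x u = - (c (Inr 0) * B1 x u + c (Inr 1) * B2 x u + c (Inr 2) * B3 x u)" for x u
    using comb[of x u] by (simp only: eq_neg_iff_add_eq_0 add.commute)
  ultimately have "B x u = - (c (Inr 0) * B1 x u + c (Inr 1) * B2 x u + c (Inr 2) * B3 x u) / c (Inr 3)" for x u
    by (metis nonzero_mult_div_cancel_left)
  then have "B x u = - c (Inr 0) / c (Inr 3) * B1 x u + - c (Inr 1) / c (Inr 3) * B2 x u +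
      - c (Inr 2) / c (Inr 3) * B3 x u" for x u
    by (simp add: add_divide_distrib diff_divide_distrib)
  then show ?thesis
    by (intro that[of "- c (Inr 0) / c (Inr 3)" "- c (Inr 1) / c (Inr 3)" "- c (Inr 2) / c (Inr 3)"] ext)
qed

lemma DD_comb:
  "DD (\<lambda>x u. \<alpha>1 * B1 x u + \<alpha>2 * B2 x u + \<alpha>3 * B3 x u) x u h k' =
      \<alpha>1 * DD B1 x u h k' + \<alpha>2 * DD B2 x u h k' + \<alpha>3 * DD B3 x u h k'"
proof -
  note b = B_in_K[THEN K_bih]
  note sb = bih_scale[OF b(1)] bih_scale[OF b(2)] bih_scale[OF b(3)]
  show ?thesis
    by (simp only: DD_add[OF bih_add[OF sb(1) sb(2)] sb(3)] DD_add[OF sb(1) sb(2)]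
        DD_scale[OF b(1)] DD_scale[OF b(2)] DD_scale[OF b(3)])
qed

text \<open>At \<open>(l i, v i)\<close> the derivatives of \<open>B1\<close>, \<open>B2\<close>,
  \<open>B3\<close> involve, besides \<open>r h\<close>, only \<open>t h\<close>,
  \<open>u2 k'\<close> and \<open>m1 * u3 k'\<close> respectively. The tangency conditions can
  therefore be solved with \<open>r h = 1\<close>: the tangent direction leaves the chord.\<close>

lemma tangent_vector:
  defines "h \<equiv> e + (- b1 (v i)) *s l k" and "k' \<equiv> (- b2 (v i)) *s v k + (- b3 (v i) / m1) *s w"
  shows "tangent i h k'" "r h = 1"
proof -
  have h: "t h = - b1 (v i)" "s h = 0" "r h = 1" "u2 k' = - b2 (v i)" "u3 k' = - b3 (v i) / m1"
    unfolding h_def k'_def lin_add[OF lins(1)] lin_add[OF lins(2)] lin_add[OF lins(3)]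
      lin_add[OF lins(5)] lin_add[OF lins(6)] lin_scale[OF lins(1)] lin_scale[OF lins(2)]
      lin_scale[OF lins(3)] lin_scale[OF lins(5)] lin_scale[OF lins(6)]
    by (simp_all add: chord_values)
  show "r h = 1" by (rule h)
  have "DD B1 (l i) (v i) h k' = 0" "DD B2 (l i) (v i) h k' = 0" "DD B3 (l i) (v i) h k' = 0"
    unfolding DD_B by (simp_all add: h chord_values \<mu>_def)
  then show "tangent i h k'"
    unfolding tangent_def
  proof (intro ballI)
    fix B assume "B \<in> K"
    then obtain \<alpha>1 \<alpha>2 \<alpha>3 where B: "B = (\<lambda>x u. \<alpha>1 * B1 x u + \<alpha>2 * B2 x u + \<alpha>3 * B3 x u)"
      by (rule K_span)
    show "DD B (l i) (v i) h k' = 0"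
      unfolding B DD_comb by (simp add: \<open>DD B1 (l i) (v i) h k' = 0\<close>
        \<open>DD B2 (l i) (v i) h k' = 0\<close> \<open>DD B3 (l i) (v i) h k' = 0\<close>)
  qed
qed

text \<open>Division by \<open>r\<close> modulo the net. Replacing \<open>x\<close> by its component
  \<open>y x\<close> along the chord changes \<open>X\<close> by a multiple of \<open>r\<close>.
  What remains are binary cubics, one for each of \<open>v i\<close>, \<open>v k\<close>,
  \<open>w\<close>, namely \<open>t * g1\<close>, \<open>s * g2\<close> and \<open>g3\<close>; the
  factors \<open>t\<close> and \<open>s\<close> are forced by the zeros of \<open>X\<close> at the
  two points. After multiplication by \<open>\<mu>\<close> the three parts are multiples of
  \<open>t * u1\<close>, \<open>s * u2\<close> and \<open>\<mu> * u3\<close>, that is, of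
  \<open>B1\<close>, \<open>B2\<close> and \<open>B3\<close> up to multiples of \<open>r\<close>,
  and \<open>r * H\<close> collects all multiples of \<open>r\<close>.\<close>

lemma chord_form:
  assumes X: "bih 3 1 X" "X (l i) (v i) = 0" "X (l k) (v k) = 0"
  obtains H B B' where "bih 3 1 H" "B \<in> K" "B' \<in> K"
    and "\<And>h k'. m1 * DD X (l i) (v i) h k' = DD B (l i) (v i) h k' + H (l i) (v i) * r h"
    and "\<And>h k'. m2 * DD X (l k) (v k) h k' = DD B' (l k) (v k) h k' + H (l k) (v k) * r h"
    and "\<And>x u. on_curve x u \<Longrightarrow> X x u = 0 \<Longrightarrow> x \<noteq> 0 \<Longrightarrow> u \<noteq> 0 \<Longrightarrow>
      \<not> prop_to i x u \<Longrightarrow> \<not> prop_to k x u \<Longrightarrow> H x u = 0"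
proof -
  obtain C where C: "X = (\<lambda>x u. tri C x x x u)" using bih31_tri[OF X(1)] by blast
  define y where "y = (\<lambda>x. s x *s l i + t x *s l k)"
  have x_y: "x = y x + r x *s e" for x using expand_fst[of x] by (simp add: y_def)
  define P where "P = (\<lambda>x u. tri C e x x u + tri C (y x) e x u + tri C (y x) (y x) e u)"
  define g1 where "g1 = (\<lambda>x. tri C (l k) (y x) (y x) (v i) + s x * tri C (l i) (l k) (y x) (v i)
    + s x * s x * tri C (l i) (l i) (l k) (v i))"
  define g2 where "g2 = (\<lambda>x. tri C (l i) (y x) (y x) (v k) + t x * tri C (l k) (l i) (y x) (v k)
    + t x * t x * tri C (l k) (l k) (l i) (v k))"
  define g3 where "g3 = (\<lambda>x. tri C (y x) (y x) (y x) w)"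
  define H where "H = (\<lambda>x u. \<mu> x * P x u - \<mu> x * g1 x * b1 u - \<mu> x * g2 x * b2 u - g3 x * b3 u)"
  have tri_y: "tri C x x x u = tri C (y x) (y x) (y x) u + r x * P x u" for x u
  proof -
    have "tri C x x x u = tri C (y x) x x u + r x * tri C e x x u"
      by (subst (1) x_y) (simp add: tri_add tri_scale)
    also have "tri C (y x) x x u = tri C (y x) (y x) x u + r x * tri C (y x) e x u"
      by (subst (2) x_y) (simp add: tri_add tri_scale)
    also have "tri C (y x) (y x) x u = tri C (y x) (y x) (y x) u + r x * tri C (y x) (y x) e u"
      by (subst (3) x_y) (simp add: tri_add tri_scale)
    finally show ?thesis by (simp add: P_def algebra_simps)
  qed
  have X0: "tri C (l i) (l i) (l i) (v i) = 0" "tri C (l k) (l k) (l k) (v k) = 0"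
    using X(2,3) by (simp_all add: C)
  have g1: "tri C (y x) (y x) (y x) (v i) = t x * g1 x" for x
  proof -
    let ?y = "y x"
    have "tri C ?y ?y ?y (v i) = s x * tri C (l i) ?y ?y (v i) + t x * tri C (l k) ?y ?y (v i)"
      by (subst (1) y_def) (simp add: tri_add tri_scale)
    also have "tri C (l i) ?y ?y (v i) = s x * tri C (l i) (l i) ?y (v i) + t x * tri C (l i) (l k) ?y (v i)"
      by (subst (1) y_def) (simp add: tri_add tri_scale)
    also have "tri C (l i) (l i) ?y (v i) = t x * tri C (l i) (l i) (l k) (v i)"
      by (subst (1) y_def) (simp add: tri_add tri_scale X0)
    finally show ?thesis by (simp add: g1_def algebra_simps)
  qed
  have g2: "tri C (y x) (y x) (y x) (v k) = s x * g2 x" for x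
  proof -
    let ?y = "y x"
    have "tri C ?y ?y ?y (v k) = s x * tri C (l i) ?y ?y (v k) + t x * tri C (l k) ?y ?y (v k)"
      by (subst (1) y_def) (simp add: tri_add tri_scale)
    also have "tri C (l k) ?y ?y (v k) = s x * tri C (l k) (l i) ?y (v k) + t x * tri C (l k) (l k) ?y (v k)"
      by (subst (1) y_def) (simp add: tri_add tri_scale)
    also have "tri C (l k) (l k) ?y (v k) = s x * tri C (l k) (l k) (l i) (v k)"
      by (subst (1) y_def) (simp add: tri_add tri_scale X0)
    finally show ?thesis by (simp add: g2_def algebra_simps)
  qed
  have X_eq: "X x u = u1 u * (t x * g1 x) + u2 u * (s x * g2 x) + u3 u * g3 x + r x * P x u" for x u
  proof -
    have "X x u = tri C (y x) (y x) (y x) u + r x * P x u" unfolding C by (rule tri_y)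
    also have "tri C (y x) (y x) (y x) u = u1 u * tri C (y x) (y x) (y x) (v i) +
        u2 u * tri C (y x) (y x) (y x) (v k) + u3 u * tri C (y x) (y x) (y x) w"
      by (subst (1) expand_snd[of u]) (simp add: tri_add tri_scale)
    finally show ?thesis by (simp add: g1 g2 g3_def)
  qed
  have key: "\<mu> x * X x u = \<mu> x * g1 x * B1 x u + \<mu> x * g2 x * B2 x u + g3 x * B3 x u + r x * H x u" for x u
    unfolding X_eq H_def B1_def B2_def B3_def by (simp add: algebra_simps)
  have const0: "bih 0 0 (\<lambda>x u. c)" for c by (rule bih_const)
  have y_bih: "bih 1 0 (\<lambda>x u. y x $ a)" for a
    unfolding y_def vector_add_component vector_smult_component mult.commute[of _ "l _ $ a"]
    by (intro bih_add bih_scale lin_bih lins)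
  note st = lin_bih(1)[OF lins(1)] lin_bih(1)[OF lins(2)] lin_bih(1)[OF lin_\<mu>]
  have tri20: "bih 2 0 (\<lambda>x u. tri C c (y x) (y x) d)" for c d
    by (rule bih_tri[OF const0 y_bih y_bih const0]) simp
  have tri10: "bih 1 0 (\<lambda>x u. tri C c c' (y x) d)" for c c' d
    by (rule bih_tri[OF const0 const0 y_bih const0]) simp
  have g_bih: "bih 2 0 (\<lambda>x u. g1 x)" "bih 2 0 (\<lambda>x u. g2 x)" "bih 3 0 (\<lambda>x u. g3 x)"
    unfolding g1_def g2_def g3_def
    by (intro bih_add tri20 bih_mult'[OF st(1) tri10] bih_mult'[OF st(2) tri10]
        bih_mult'[OF bih_mult'[OF st(1) st(1)] bih_const] bih_mult'[OF bih_mult'[OF st(2) st(2)] bih_const]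
        bih_tri[OF y_bih y_bih y_bih const0]; simp)+
  have P_bih: "bih 2 1 P"
    unfolding P_def
    by (intro bih_add bih_tri[OF const0 bih_fst bih_fst bih_snd] bih_tri[OF y_bih const0 bih_fst bih_snd]
        bih_tri[OF y_bih y_bih const0 bih_snd]; simp)
  have mg_bih: "bih 3 0 (\<lambda>x u. \<mu> x * g1 x)" "bih 3 0 (\<lambda>x u. \<mu> x * g2 x)"
    by (rule bih_mult'[OF st(3) g_bih(1)], simp, simp) (rule bih_mult'[OF st(3) g_bih(2)], simp, simp)
  have H_bih: "bih 3 1 H"
    unfolding H_def
    by (intro bih_diff bih_mult'[OF st(3) P_bih] bih_mult'[OF mg_bih(1) lin_bih(2)[OF lins(7)]]
        bih_mult'[OF mg_bih(2) lin_bih(2)[OF lins(8)]] bih_mult'[OF g_bih(3) lin_bih(2)[OF lins(9)]]; simp)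
  \<comment> \<open>Differentiating \<open>key\<close> at a point where \<open>X\<close>, the net
    and \<open>r\<close> vanish leaves only the terms in which these very factors are
    differentiated.\<close>
  have diff: "\<mu> x * DD X x u h k' = \<mu> x * g1 x * DD B1 x u h k' + \<mu> x * g2 x * DD B2 x u h k' +
      g3 x * DD B3 x u h k' + H x u * r h"
    if "X x u = 0" "B1 x u = 0" "B2 x u = 0" "B3 x u = 0" "r x = 0" for x u h k'
  proof -
    note Bb = B_in_K[THEN K_bih]
    have "DD (\<lambda>x u. \<mu> x * X x u) x u h k' =
        DD (\<lambda>x u. \<mu> x * g1 x * B1 x u + \<mu> x * g2 x * B2 x u + g3 x * B3 x u + r x * H x u) x u h k'"
      by (simp only: key)
    moreover have t: "bih 4 1 (\<lambda>x u. \<mu> x * g1 x * B1 x u)" "bih 4 1 (\<lambda>x u. \<mu> x * g2 x * B2 x u)"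
        "bih 4 1 (\<lambda>x u. g3 x * B3 x u)" "bih 4 1 (\<lambda>x u. r x * H x u)"
      using bih_mult[OF mg_bih(1) Bb(1)] bih_mult[OF mg_bih(2) Bb(2)] bih_mult[OF g_bih(3) Bb(3)]
        bih_mult[OF lin_bih(1)[OF lins(3)] H_bih] by simp_all
    ultimately show ?thesis
      using that
      by (simp add: DD_add[OF bih_add[OF bih_add[OF t(1) t(2)] t(3)] t(4)]
          DD_add[OF bih_add[OF t(1) t(2)] t(3)] DD_add[OF t(1) t(2)] DD_mult[OF st(3) X(1)]
          DD_mult[OF mg_bih(1) Bb(1)] DD_mult[OF mg_bih(2) Bb(2)] DD_mult[OF g_bih(3) Bb(3)]
          DD_mult[OF lin_bih(1)[OF lins(3)] H_bih] DD_lin[OF lins(3)])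
  qed
  have comb: "(\<lambda>x u. \<alpha>1 * B1 x u + \<alpha>2 * B2 x u + \<alpha>3 * B3 x u) \<in> K" for \<alpha>1 \<alpha>2 \<alpha>3
    by (intro K_add K_scale B_in_K)
  show ?thesis
  proof (rule that[OF H_bih comb comb])
    fix h k'
    show "m1 * DD X (l i) (v i) h k' = DD (\<lambda>x u. \<mu> (l i) * g1 (l i) * B1 x u + \<mu> (l i) * g2 (l i) * B2 x u +
        g3 (l i) * B3 x u) (l i) (v i) h k' + H (l i) (v i) * r h"
      using diff[of "l i" "v i" h k'] X B_in_K by (simp add: DD_comb K_def chord_values \<mu>_def)
    show "m2 * DD X (l k) (v k) h k' = DD (\<lambda>x u. \<mu> (l k) * g1 (l k) * B1 x u + \<mu> (l k) * g2 (l k) * B2 x u +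
        g3 (l k) * B3 x u) (l k) (v k) h k' + H (l k) (v k) * r h"
      using diff[of "l k" "v k" h k'] X B_in_K by (simp add: DD_comb K_def chord_values \<mu>_def)
  next
    fix x u
    assume oc: "on_curve x u" and Xz: "X x u = 0" and nz: "x \<noteq> 0" "u \<noteq> 0"
      and np: "\<not> prop_to i x u" "\<not> prop_to k x u"
    have Bz: "B1 x u = 0" "B2 x u = 0" "B3 x u = 0"
      using oc B_in_K by (auto simp: on_curve_def)
    show "H x u = 0"
    proof (cases "r x = 0")
      case False
      then show ?thesis using key[of x u] by (simp add: Xz Bz)
    next
      case True
      have x: "x = s x *s l i + t x *s l k" using expand_fst[of x] True by simp
      have Bz': "t x * u1 u = 0" "s x * u2 u = 0" "\<mu> x * u3 u = 0"
        using Bz by (simp_all add: B1_def B2_def B3_def True)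
      \<comment> \<open>Over the chord the curve has three points: the \<open>i\<close>-th, the
        \<open>k\<close>-th, and one with \<open>\<mu> x = 0\<close> and \<open>u\<close> along
        \<open>w\<close>, where \<open>X x u = 0\<close> gives \<open>g3 x = 0\<close>.\<close>
      consider "t x = 0" | "s x = 0" | "t x \<noteq> 0" "s x \<noteq> 0" by blast
      then show ?thesis
      proof cases
        case 1
        then have "x = s x *s l i" using x by simp
        moreover from this have "s x \<noteq> 0" using nz by auto
        then have "u2 u = 0" "u3 u = 0" using Bz' 1 chord_values by (auto simp: \<mu>_def)
        then have "u = u1 u *s v i" using expand_snd[of u] by simp
        ultimately have "prop_to i x u" unfolding prop_to_def by blast
        with np show ?thesis by blast
      next
        case 2
        then have "x = t x *s l k" using x by simp
        moreover from this have "t x \<noteq> 0" using nz by auto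
        then have "u1 u = 0" "u3 u = 0" using Bz' 2 chord_values by (auto simp: \<mu>_def)
        then have "u = u2 u *s v k" using expand_snd[of u] by simp
        ultimately have "prop_to k x u" unfolding prop_to_def by blast
        with np show ?thesis by blast
      next
        case 3
        then have u12: "u1 u = 0" "u2 u = 0" using Bz' by auto
        then have "u3 u \<noteq> 0" using expand_snd[of u] nz by auto
        then have "\<mu> x = 0" "g3 x = 0"
          using Bz' Xz X_eq[of x u] u12 True by auto
        then show ?thesis by (simp add: H_def)
      qed
    qed
  qed
qed

end

lemma bih_cpoly: "bih d e X \<Longrightarrow> cpoly (\<lambda>x. X x u)"
  by (induction rule: bih.induct) (auto intro: cpoly.intros)

section \<open>Forms dual to the six points and to their tangent directions\<close>

context sextuple
begin

definition vanishing_off :: "'p \<Rightarrow> 'p \<Rightarrow> (complex ^ 3 \<Rightarrow> complex ^ 3 \<Rightarrow> complex) \<Rightarrow>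
    (complex ^ 3 \<Rightarrow> complex ^ 3 \<Rightarrow> complex) \<Rightarrow> bool" where
  "vanishing_off i k X H \<longleftrightarrow> (\<forall>x u. on_curve x u \<longrightarrow> X x u = 0 \<longrightarrow> x \<noteq> 0 \<longrightarrow> u \<noteq> 0 \<longrightarrow>
     \<not> prop_to i x u \<longrightarrow> \<not> prop_to k x u \<longrightarrow> H x u = 0)"

text \<open>The identity \<open>\<mu> * X = (element of the ideal of K) + r * H\<close> of \<open>chord_form\<close>, recorded through
  its first-order consequences at the two points on the chord.\<close>

definition chord_split :: "'p \<Rightarrow> 'p \<Rightarrow> (complex ^ 3 \<Rightarrow> complex) \<Rightarrow> complex \<Rightarrow> complex \<Rightarrow>
    (complex ^ 3 \<Rightarrow> complex ^ 3 \<Rightarrow> complex) \<Rightarrow> (complex ^ 3 \<Rightarrow> complex ^ 3 \<Rightarrow> complex) \<Rightarrow> bool" where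
  "chord_split i k r m1 m2 X H \<longleftrightarrow> bih 3 1 H \<and>
     (\<exists>B\<in>K. \<forall>h k'. m1 * DD X (l i) (v i) h k' = DD B (l i) (v i) h k' + H (l i) (v i) * r h) \<and>
     (\<exists>B\<in>K. \<forall>h k'. m2 * DD X (l k) (v k) h k' = DD B (l k) (v k) h k' + H (l k) (v k) * r h) \<and>
     vanishing_off i k X H"

lemma chord_split_ex:
  assumes "i \<noteq> k"
  obtains r m1 m2 where "m1 \<noteq> 0" "m2 \<noteq> 0"
    and "\<And>X. bih 3 1 X \<Longrightarrow> X (l i) (v i) = 0 \<Longrightarrow> X (l k) (v k) = 0 \<Longrightarrow> \<exists>H. chord_split i k r m1 m2 X H"
proof -
  obtain e w s t r u1 u2 u3 b1 b2 b3 m1 m2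
    where "chord_coords l v i k e w s t r u1 u2 u3 b1 b2 b3 m1 m2"
    using chord[OF assms] by blast
  then interpret sextuple_chord l v i k e w s t r u1 u2 u3 b1 b2 b3 m1 m2
    by unfold_locales
  show ?thesis
  proof (rule that[OF chord_values(19,20)])
    fix X assume X: "bih 3 1 X" "X (l i) (v i) = 0" "X (l k) (v k) = 0"
    show "\<exists>H. chord_split i k r m1 m2 X H"
      unfolding chord_split_def vanishing_off_def
      by (rule chord_form[OF X]) meson
  qed
qed

lemma chord_split_tangent:
  assumes "chord_split i k r m1 m2 X H" "tangent i h k'" "tangent k g g'"
  shows "m1 * DD X (l i) (v i) h k' = H (l i) (v i) * r h" "m2 * DD X (l k) (v k) g g' = H (l k) (v k) * r g"
  using assms unfolding chord_split_def tangent_def by auto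

lemma nonzero_K_ex:
  obtains B x u where "B \<in> K" "B x u \<noteq> 0"
proof -
  fix i :: 'p
  obtain k where ik: "i \<noteq> k" using other_index by metis
  obtain e w s t r u1 u2 u3 b1 b2 b3 m1 m2
    where "chord_coords l v i k e w s t r u1 u2 u3 b1 b2 b3 m1 m2"
    using chord[OF ik] by blast
  then interpret sextuple_chord l v i k e w s t r u1 u2 u3 b1 b2 b3 m1 m2
    by unfold_locales
  have "B1 (l k) (v i) \<noteq> 0" by (simp add: B1_def chord_values)
  with that B_in_K show ?thesis by blast
qed

lemma tangent_ex:
  obtains h k f where "tangent i h k" "lin f" "f (l i) = 0" "f h = 1"
proof -
  obtain k where ik: "i \<noteq> k" using other_index by metis
  obtain e w s t r u1 u2 u3 b1 b2 b3 m1 m2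
    where "chord_coords l v i k e w s t r u1 u2 u3 b1 b2 b3 m1 m2"
    using chord[OF ik] by blast
  then interpret sextuple_chord l v i k e w s t r u1 u2 u3 b1 b2 b3 m1 m2
    by unfold_locales
  show ?thesis using that[OF tangent_vector(1) lins(3) chord_values(3) tangent_vector(2)] .
qed

text \<open>Six coefficients allow a conic through the other five points. If it also contained
  \<open>l i\<close>, its product with a nonzero member of \<open>K\<close> would be a nonzero form
  that is singular at all six points, against \<open>jet_inj\<close>.\<close>

lemma conic_dual:
  obtains q where "bih 2 0 (\<lambda>x u. q x)" "\<And>j. q (l j) = (if j = i then 1 else 0)"
proof -
  define M :: "nat \<Rightarrow> complex ^ 3 \<Rightarrow> complex" where
    "M = (\<lambda>n x. [x $ 1 * x $ 1, x $ 2 * x $ 2, x $ 3 * x $ 3, x $ 1 * x $ 2, x $ 1 * x $ 3, x $ 2 * x $ 3] ! n)"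
  have "card (UNIV - {i}) < card {..<6::nat}" using card_p by simp
  then obtain c where c: "\<exists>n\<in>{..<6}. c n \<noteq> 0"
      "\<And>j. j \<in> UNIV - {i} \<Longrightarrow> (\<Sum>n<6. c n * M n (l j)) = 0"
    using homogeneous_system[of "UNIV - {i}" "{..<6::nat}" "\<lambda>n j. M n (l j)"] by auto
  define q where "q = (\<lambda>x. \<Sum>n<6. c n * M n x)"
  have q_eq: "q x = c 0 * (x $ 1 * x $ 1) + c 1 * (x $ 2 * x $ 2) + c 2 * (x $ 3 * x $ 3) +
      c 3 * (x $ 1 * x $ 2) + c 4 * (x $ 1 * x $ 3) + c 5 * (x $ 2 * x $ 3)" for x
    by (simp add: q_def M_def eval_nat_numeral lessThan_Suc add_ac)
  have bih_xx: "bih 2 0 (\<lambda>x u. x $ a * x $ b)" for a b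
    using bih_mult[OF bih_fst[of a] bih_fst[of b]] by (simp add: numeral_2_eq_2)
  have q_bih: "bih 2 0 (\<lambda>x u. q x)"
    unfolding q_eq by (intro bih_add bih_scale bih_xx)
  have "q (l i) \<noteq> 0"
  proof
    assume "q (l i) = 0"
    then have q0: "q (l j) = 0" for j using c(2)[of j] by (cases "j = i") (auto simp: q_def)
    obtain B x0 u0 where B: "B \<in> K" "B x0 u0 \<noteq> 0" by (rule nonzero_K_ex)
    have qB: "bih 3 1 (\<lambda>x u. q x * B x u)"
      using bih_mult[OF q_bih K_bih[OF B(1)]] by simp
    have "DD (\<lambda>x u. q x * B x u) (l j) (v j) h k = 0" for j h k
      using B(1) by (simp add: DD_mult[OF q_bih K_bih[OF B(1)]] q0 K_def)
    then have "q x * B x u = 0" for x u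
      using jet_inj[OF qB] by blast
    then have qz: "q x = 0" for x
      using cpoly_mult_nonzero[OF bih_cpoly[OF q_bih] bih_cpoly[OF K_bih[OF B(1)]] _ B(2), of x]
      by (metis mult_eq_0_iff)
    have "c 0 = 0" "c 1 = 0" "c 2 = 0"
      using qz[of "vector [1, 0, 0]"] qz[of "vector [0, 1, 0]"] qz[of "vector [0, 0, 1]"]
      by (simp_all add: q_eq)
    moreover from this have "c 3 = 0" "c 4 = 0" "c 5 = 0"
      using qz[of "vector [1, 1, 0]"] qz[of "vector [1, 0, 1]"] qz[of "vector [0, 1, 1]"]
      by (simp_all add: q_eq)
    ultimately have "c n = 0" if "n < 6" for n
      using that by (auto simp: eval_nat_numeral less_Suc_eq)
    with c(1) show False by auto
  qed
  moreover have "q (l j) = 0" if "j \<noteq> i" for j using c(2)[of j] that by (simp add: q_def)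
  ultimately show ?thesis
    using that[of "\<lambda>x. inverse (q (l i)) * q x"] bih_scale[OF q_bih] by auto
qed

lemma point_on_curve: "on_curve (l i) (v i)"
  by (simp add: on_curve_def K_def)

lemma bih11_zero: "bih 1 1 B \<Longrightarrow> B 0 u = 0" "bih 1 1 B \<Longrightarrow> B x 0 = 0"
  using bih_homogeneous[of 1 1 B 0 0 1 u] bih_homogeneous[of 1 1 B 1 x 0 0] by simp_all

lemma point_nonzero: "l i \<noteq> 0" "v i \<noteq> 0"
proof -
  obtain B where B: "bih 1 1 B" "B (l i) (v i) = 1"
    using bilinear_dual[of i] by auto
  then show "l i \<noteq> 0" "v i \<noteq> 0" using bih11_zero[OF B(1)] by auto
qed

lemma prop_to_unique:
  assumes "prop_to i x u" "prop_to j x u" "x \<noteq> 0" "u \<noteq> 0"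
  shows "i = j"
proof (rule ccontr)
  assume "i \<noteq> j"
  obtain B where B: "bih 1 1 B" "\<And>n. B (l n) (v n) = (if n = i then 1 else 0)"
    using bilinear_dual by blast
  obtain \<alpha> \<beta> \<alpha>' \<beta>' where p: "x = \<alpha> *s l i" "u = \<beta> *s v i" "x = \<alpha>' *s l j" "u = \<beta>' *s v j"
    using assms(1,2) unfolding prop_to_def by blast
  have "B x u = \<alpha> * \<beta>" using bih_homogeneous[OF B(1), of \<alpha> "l i" \<beta> "v i"] p(1,2) B(2) by simp
  moreover have "B x u = 0"
    using bih_homogeneous[OF B(1), of \<alpha>' "l j" \<beta>' "v j"] p(3,4) B(2) \<open>i \<noteq> j\<close> by simp
  ultimately show False using p(1,2) assms(3,4) by auto
qed

text \<open>The \<open>G i\<close> are dual to tangent vectors at the six points. Modulo forms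
  vanishing on the curve they span the (3,1)-forms that vanish at these points, which is how
  \<open>vanishes_on_curve\<close> is applied later.\<close>

lemma tangent_frame:
  obtains hh kk G where "\<And>i. tangent i (hh i) (kk i)" "\<And>i. bih 3 1 (G i)"
    "\<And>i j. G i (l j) (v j) = 0"
    "\<And>i j. DD (G i) (l j) (v j) (hh j) (kk j) = (if j = i then 1 else 0)"
proof -
  have "\<exists>h k f. tangent i h k \<and> lin f \<and> f (l i) = 0 \<and> f h = 1" for i
    by (rule tangent_ex) blast
  then obtain hh kk f where f: "\<And>i. tangent i (hh i) (kk i)" "\<And>i. lin (f i)"
      "\<And>i. f i (l i) = 0" "\<And>i. f i (hh i) = 1"
    by metis
  have "\<forall>i. \<exists>X. bih 3 1 X \<and> (\<forall>j h k. DD X (l j) (v j) h k = (if j = i then f i h else 0))"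
    using jet_surj[OF f(2,3)] by blast
  from choice[OF this] obtain G where G: "\<And>i. bih 3 1 (G i)"
      "\<And>i j h k. DD (G i) (l j) (v j) h k = (if j = i then f i h else 0)"
    by blast
  have "G i (l j) (v j) = 0" for i j
    using DD_euler(2)[OF G(1), of i "l j" "v j"] lin_zero[OF f(2), of i]
    by (simp add: G(2) split: if_splits)
  moreover have "DD (G i) (l j) (v j) (hh j) (kk j) = (if j = i then 1 else 0)" for i j
    by (simp add: G(2) f(4))
  ultimately show ?thesis
    using f(1) G(1) by (intro that[of hh kk G])
qed

end

text \<open>The functional \<open>ev x u\<close> on (3,1)-forms stands for the vector summand \<open>x^3 \<otimes> u\<close>.\<close>

definition ev :: "complex ^ 3 \<Rightarrow> complex ^ 3 \<Rightarrow> (complex ^ 3 \<Rightarrow> complex ^ 3 \<Rightarrow> complex) \<Rightarrow> complex" where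
  "ev x u X = (if bih 3 1 X then X x u else 0)"

lemma ev_eqI: "(\<And>X. bih 3 1 X \<Longrightarrow> X x u = X x' u') \<Longrightarrow> ev x u = ev x' u'"
  by (auto simp: ev_def)

text \<open>The forms \<open>E'\<close> show that the primed points are independent, so no two of
  them are proportional to the same unprimed point; testing the equal sums with \<open>E\<close>
  then shows that the factors of proportionality are 1.\<close>

lemma same_points:
  fixes m y m' y' :: "'p::finite \<Rightarrow> complex ^ 3"
  assumes sum_eq: "\<And>X. bih 3 1 X \<Longrightarrow> (\<Sum>j\<in>UNIV. X (m j) (y j)) = (\<Sum>j\<in>UNIV. X (m' j) (y' j))"
    and E: "\<And>j. bih 3 1 (E j)" "\<And>j k. E j (m k) (y k) = (if k = j then 1 else 0)"
    and E': "\<And>j. bih 3 1 (E' j)" "\<And>j k. E' j (m' k) (y' k) = (if k = j then 1 else 0)"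
    and prp: "\<And>k. \<exists>j c. \<forall>X. bih 3 1 X \<longrightarrow> X (m' k) (y' k) = c * X (m j) (y j)"
  shows "(\<lambda>j. ev (m j) (y j)) ` UNIV = (\<lambda>j. ev (m' j) (y' j)) ` UNIV"
proof -
  obtain f c where f: "\<And>k X. bih 3 1 X \<Longrightarrow> X (m' k) (y' k) = c k * X (m (f k)) (y (f k))"
    using prp by metis
  have "inj f"
  proof (rule injI, rule ccontr)
    fix k k' assume k: "f k = f k'" "k \<noteq> k'"
    have "c k * E' k (m (f k)) (y (f k)) = 1" "c k' * E' k (m (f k)) (y (f k)) = 0"
      "c k' * E' k' (m (f k)) (y (f k)) = 1"
      using f[OF E'(1), of k k] f[OF E'(1), of k k'] f[OF E'(1), of k' k'] k by (simp_all add: E'(2))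
    then show False by auto
  qed
  then have "surj f" by (rule finite_UNIV_inj_surj[OF finite_class.finite_UNIV])
  have "c k = 1" for k
  proof -
    have "1 = (\<Sum>j\<in>UNIV. E (f k) (m j) (y j))" by (simp add: E(2))
    also have "\<dots> = (\<Sum>j\<in>UNIV. c j * E (f k) (m (f j)) (y (f j)))"
      unfolding sum_eq[OF E(1)] by (simp add: f[OF E(1)])
    also have "\<dots> = (\<Sum>j\<in>UNIV. if j = k then c j else 0)"
      using \<open>inj f\<close> by (intro sum.cong) (auto simp: E(2) inj_eq)
    finally show ?thesis by simp
  qed
  then have "ev (m' k) (y' k) = ev (m (f k)) (y (f k))" for k
    using f by (intro ev_eqI) simp
  then have "(\<lambda>j. ev (m' j) (y' j)) ` UNIV = (\<lambda>j. ev (m j) (y j)) ` range f"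
    by (simp add: image_image)
  then show ?thesis using \<open>surj f\<close> by simp
qed

section \<open>Properties of an arbitrary second decomposition\<close>

context sextuple
begin

lemma same_count_system:
  fixes M :: "'p \<Rightarrow> 'p \<Rightarrow> complex"
  obtains \<theta> where "\<exists>i. \<theta> i \<noteq> 0" "\<And>b. b \<noteq> j0 \<Longrightarrow> (\<Sum>i\<in>UNIV. \<theta> i * M i b) = 0"
proof -
  have "card (UNIV - {j0}) < card (UNIV :: 'p set)"
    by (simp add: card_p)
  then obtain c where "\<exists>a\<in>UNIV. c a \<noteq> 0" "\<And>b. b \<in> UNIV - {j0} \<Longrightarrow> (\<Sum>a\<in>UNIV. c a * M a b) = 0"
    using homogeneous_system[of "UNIV - {j0}" UNIV M] by auto
  with that show ?thesis by blast
qed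

lemma bilinear_duals:
  obtains B where "\<And>i. bih 1 1 (B i)" "\<And>i j. B i (l j) (v j) = (if j = i then 1 else 0)"
proof -
  have "\<forall>i. \<exists>B. bih 1 1 B \<and> (\<forall>j. B (l j) (v j) = (if j = i then 1 else 0))"
    using bilinear_dual by blast
  from choice[OF this] that show ?thesis by blast
qed

lemma conic_duals:
  obtains q where "\<And>i. bih 2 0 (\<lambda>x u. q i x)" "\<And>i j. q i (l j) = (if j = i then 1 else 0)"
proof -
  have "\<forall>i. \<exists>q. bih 2 0 (\<lambda>x u. q x) \<and> (\<forall>j. q (l j) = (if j = i then 1 else 0))"
    by (intro allI, rule conic_dual) blast
  from choice[OF this] that show ?thesis by blast
qed

definition decomposes :: "('p \<Rightarrow> complex ^ 3) \<Rightarrow> ('p \<Rightarrow> complex ^ 3) \<Rightarrow> bool" where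
  "decomposes m y \<longleftrightarrow> (\<forall>X. bih 3 1 X \<longrightarrow> (\<Sum>j\<in>UNIV. X (m j) (y j)) = (\<Sum>j\<in>UNIV. X (l j) (v j)))"

lemma decomposes_sum:
  "decomposes m y \<Longrightarrow> bih 3 1 X \<Longrightarrow> (\<Sum>j\<in>UNIV. X (m j) (y j)) = (\<Sum>j\<in>UNIV. X (l j) (v j))"
  by (simp add: decomposes_def)

lemma bih_quad_bil: "bih 2 0 (\<lambda>x u. q x) \<Longrightarrow> bih 1 1 B \<Longrightarrow> bih 3 1 (\<lambda>x u. q x * B x u)"
  using bih_mult[of 2 0 "\<lambda>x u. q x" 1 1 B] by simp

text \<open>\<open>P ** Q\<close> consists of the sums over \<open>(m, y)\<close> of products of a
  conic and a bilinear form that are dual to the first decomposition. These sums may be computed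
  over the first decomposition instead, so \<open>P ** Q\<close> is the identity. Hence so is
  \<open>Q ** P\<close>, and its entries exhibit combinations of the given forms that are dual to
  the points \<open>(m, y)\<close>.\<close>

lemma decomposes_duals:
  assumes dec: "decomposes m y"
  obtains q B where "\<And>j. bih 2 0 (\<lambda>x u. q j x)" "\<And>j k. q j (m k) = (if k = j then 1 else 0)"
    and "\<And>j. bih 1 1 (B j)" "\<And>j k. B j (m k) (y k) = (if k = j then 1 else 0)"
proof -
  obtain q where q: "\<And>i. bih 2 0 (\<lambda>x u. q i x)" "\<And>i j. q i (l j) = (if j = i then 1 else 0)"
    by (rule conic_duals) (rule that; assumption)
  obtain B where B: "\<And>i. bih 1 1 (B i)" "\<And>i j. B i (l j) (v j) = (if j = i then 1 else 0)"
    by (rule bilinear_duals) (rule that; assumption)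
  define P :: "complex ^ 'p ^ 'p" where "P = (\<chi> i j. B i (m j) (y j))"
  define Q :: "complex ^ 'p ^ 'p" where "Q = (\<chi> j n. q n (m j))"
  have "(\<Sum>j\<in>UNIV. q n (m j) * B i (m j) (y j)) = (if i = n then 1 else 0)" for i n
    using decomposes_sum[OF dec bih_quad_bil[OF q(1) B(1)], of n i]
    by (simp add: q(2) B(2) if_distrib[of "\<lambda>x. x * _"] cong: if_cong)
  then have "P ** Q = mat 1"
    by (simp add: P_def Q_def matrix_matrix_mult_def mat_def vec_eq_iff mult.commute)
  then have "Q ** P = mat 1" by (simp add: matrix_left_right_inverse)
  then have QP: "(\<Sum>n\<in>UNIV. q n (m j) * B n (m k) (y k)) = (if j = k then 1 else 0)" for j k
    by (simp add: P_def Q_def matrix_matrix_mult_def mat_def vec_eq_iff)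
  show ?thesis
  proof (rule that[of "\<lambda>k x. \<Sum>n\<in>UNIV. B n (m k) (y k) * q n x" "\<lambda>j x u. \<Sum>n\<in>UNIV. q n (m j) * B n x u"])
    show "bih 2 0 (\<lambda>x u. \<Sum>n\<in>UNIV. B n (m k) (y k) * q n x)" for k
      by (intro bih_sum bih_scale q)
    show "bih 1 1 (\<lambda>x u. \<Sum>n\<in>UNIV. q n (m j) * B n x u)" for j
      by (intro bih_sum bih_scale B)
    show "(\<Sum>n\<in>UNIV. B n (m j) (y j) * q n (m k)) = (if k = j then 1 else 0)" for j k
      using QP[of k j] by (simp add: mult.commute)
    show "(\<Sum>n\<in>UNIV. q n (m j) * B n (m k) (y k)) = (if k = j then 1 else 0)" for j k
      using QP[of j k] by auto
  qed
qed

text \<open>A conic that is 1 at \<open>m j\<close> and 0 at the other points isolates the value of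
  \<open>C\<close> at \<open>(m j, y j)\<close> in a sum that is zero over the first
  decomposition.\<close>

lemma decomposes_on_curve:
  assumes dec: "decomposes m y"
  shows "on_curve (m j) (y j)"
  unfolding on_curve_def
proof
  fix C assume C: "C \<in> K"
  obtain q B where q: "\<And>j. bih 2 0 (\<lambda>x u. q j x)" "\<And>j k. q j (m k) = (if k = j then 1 else 0)"
    by (rule decomposes_duals[OF dec]) (rule that; assumption)
  have "(\<Sum>k\<in>UNIV. q j (m k) * C (m k) (y k)) = 0"
    using decomposes_sum[OF dec bih_quad_bil[OF q(1) K_bih[OF C]], of j] C by (simp add: K_def)
  then show "C (m j) (y j) = 0"
    by (simp add: q(2) if_distrib[of "\<lambda>x. x * _"] cong: if_cong)
qed

lemma decomposes_nonzero:
  assumes dec: "decomposes m y"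
  shows "m j \<noteq> 0" "y j \<noteq> 0"
proof -
  obtain q B where B: "\<And>j. bih 1 1 (B j)" "\<And>j k. B j (m k) (y k) = (if k = j then 1 else 0)"
    by (rule decomposes_duals[OF dec]) (rule that; assumption)
  show "m j \<noteq> 0" "y j \<noteq> 0"
    using B(2)[of j j] bih11_zero[OF B(1)[of j]] by auto
qed

lemma decomposes_dual_forms:
  assumes dec: "decomposes m y"
  obtains E where "\<And>j. bih 3 1 (E j)" "\<And>j k. E j (m k) (y k) = (if k = j then 1 else 0)"
proof -
  obtain q B where q: "\<And>j. bih 2 0 (\<lambda>x u. q j x)" "\<And>j k. q j (m k) = (if k = j then 1 else 0)"
    and B: "\<And>j. bih 1 1 (B j)" "\<And>j k. B j (m k) (y k) = (if k = j then 1 else 0)"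
    by (rule decomposes_duals[OF dec]) (rule that; assumption)
  show ?thesis
  proof (rule that[of "\<lambda>j x u. q j x * B j x u"])
    show "bih 3 1 (\<lambda>x u. q j x * B j x u)" for j by (intro bih_quad_bil q B)
    show "q j (m k) * B j (m k) (y k) = (if k = j then 1 else 0)" for j k by (simp add: q(2) B(2))
  qed
qed

lemma decomposes_self: "decomposes l v"
  by (simp add: decomposes_def)

end

section \<open>Tangential derivatives and the chord relations\<close>

locale sextuple_tangent = sextuple l v for l v :: "'p::finite \<Rightarrow> complex ^ 3" +
  fixes hh kk :: "'p \<Rightarrow> complex ^ 3" and G :: "'p \<Rightarrow> complex ^ 3 \<Rightarrow> complex ^ 3 \<Rightarrow> complex"
  assumes tangents: "\<And>i. tangent i (hh i) (kk i)"
    and G_bih: "\<And>i. bih 3 1 (G i)"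
    and G_zero: "\<And>i j. G i (l j) (v j) = 0"
    and G_tangent: "\<And>i j. DD (G i) (l j) (v j) (hh j) (kk j) = (if j = i then 1 else 0)"
begin

definition \<Theta> :: "'p \<Rightarrow> (complex ^ 3 \<Rightarrow> complex ^ 3 \<Rightarrow> complex) \<Rightarrow> complex" where
  "\<Theta> i X = DD X (l i) (v i) (hh i) (kk i)"

text \<open>The constants are quantified outside \<open>X\<close>, so the relation that they impose
  on tangential derivatives is the same for every second decomposition.\<close>

definition chord_const :: "'p \<Rightarrow> 'p \<Rightarrow> complex \<Rightarrow> complex \<Rightarrow> bool" where
  "chord_const i k \<kappa> \<kappa>' \<longleftrightarrow> \<kappa> \<noteq> 0 \<and> \<kappa>' \<noteq> 0 \<and>
     (\<forall>X. bih 3 1 X \<longrightarrow> X (l i) (v i) = 0 \<longrightarrow> X (l k) (v k) = 0 \<longrightarrow>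
       (\<exists>H. bih 3 1 H \<and> H (l i) (v i) = \<kappa> * \<Theta> i X \<and> H (l k) (v k) = \<kappa>' * \<Theta> k X \<and> vanishing_off i k X H))"

lemma chord_const_ex:
  assumes "i \<noteq> k"
  obtains \<kappa> \<kappa>' where "chord_const i k \<kappa> \<kappa>'"
proof -
  obtain r m1 m2 where m: "m1 \<noteq> 0" "m2 \<noteq> 0"
    and ex: "\<And>X. bih 3 1 X \<Longrightarrow> X (l i) (v i) = 0 \<Longrightarrow> X (l k) (v k) = 0 \<Longrightarrow> \<exists>H. chord_split i k r m1 m2 X H"
    by (rule chord_split_ex[OF assms]) (rule that; assumption)
  have ex': "\<exists>H. bih 3 1 H \<and> m1 * \<Theta> i X = H (l i) (v i) * r (hh i) \<and>
      m2 * \<Theta> k X = H (l k) (v k) * r (hh k) \<and> vanishing_off i k X H"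
    if X: "bih 3 1 X" "X (l i) (v i) = 0" "X (l k) (v k) = 0" for X
    using ex[OF X] chord_split_tangent[OF _ tangents tangents]
    unfolding \<Theta>_def chord_split_def by blast
  \<comment> \<open>The tangential derivative of \<open>G i\<close> at point \<open>i\<close> is 1,
    so \<open>r (hh i) = 0\<close> would give \<open>m1 = 0\<close>.\<close>
  have "r (hh i) \<noteq> 0"
    using ex'[OF G_bih[of i] G_zero G_zero] m(1) by (auto simp: \<Theta>_def G_tangent)
  moreover have "r (hh k) \<noteq> 0"
    using ex'[OF G_bih[of k] G_zero G_zero] m(2) by (auto simp: \<Theta>_def G_tangent)
  ultimately have "chord_const i k (m1 / r (hh i)) (m2 / r (hh k))"
    unfolding chord_const_def using m ex' by (fastforce simp: field_simps)
  then show ?thesis by (rule that)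
qed

text \<open>Subtracting suitable products of dual conics with elements of \<open>K\<close> makes a form that is
  tangent to the curve at all six points singular there, so the jet condition kills it.\<close>

lemma vanishes_on_curve:
  assumes X: "bih 3 1 X" "\<And>j. X (l j) (v j) = 0" "\<And>j. \<Theta> j X = 0" and "on_curve x u"
  shows "X x u = 0"
proof -
  obtain q where q: "\<And>i. bih 2 0 (\<lambda>x u. q i x)" "\<And>i j. q i (l j) = (if j = i then 1 else 0)"
    by (rule conic_duals) (rule that; assumption)
  \<comment> \<open>A zero tangential derivative makes \<open>H\<close> vanish at point
    \<open>i\<close>, so the full derivative of \<open>X\<close> there is that of a member of
    \<open>K\<close>.\<close>
  have "\<exists>B. B \<in> K \<and> (\<forall>h k. DD X (l i) (v i) h k = DD B (l i) (v i) h k)" for i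
  proof -
    obtain k where "i \<noteq> k" using other_index by metis
    then obtain r m1 m2 where m: "m1 \<noteq> 0" "m2 \<noteq> 0"
      and ex: "\<And>X. bih 3 1 X \<Longrightarrow> X (l i) (v i) = 0 \<Longrightarrow> X (l k) (v k) = 0 \<Longrightarrow> \<exists>H. chord_split i k r m1 m2 X H"
      by (rule chord_split_ex) (rule that; assumption)
    obtain H where split: "chord_split i k r m1 m2 X H" using ex[OF X(1,2,2)] by blast
    then obtain B where H: "B \<in> K"
        "\<And>h k'. m1 * DD X (l i) (v i) h k' = DD B (l i) (v i) h k' + H (l i) (v i) * r h"
      unfolding chord_split_def by blast
    have "r (hh i) \<noteq> 0"
    proof -
      obtain H' where "chord_split i k r m1 m2 (G i) H'" using ex[OF G_bih[of i] G_zero G_zero] by blast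
      from chord_split_tangent(1)[OF this tangents tangents] m(1) show ?thesis by (auto simp: G_tangent)
    qed
    moreover have "H (l i) (v i) * r (hh i) = 0"
      using chord_split_tangent(1)[OF split tangents tangents] X(3)[of i] by (simp add: \<Theta>_def)
    ultimately have "DD X (l i) (v i) h k' = inverse m1 * DD B (l i) (v i) h k'" for h k'
      using H(2)[of h k'] m(1) by (simp add: field_simps)
    then show ?thesis
      using K_scale[OF H(1), of "inverse m1"] DD_scale[OF K_bih[OF H(1)]]
      by (intro exI[of _ "\<lambda>x u. inverse m1 * B x u"]) simp
  qed
  then have "\<exists>B. \<forall>i. B i \<in> K \<and> (\<forall>h k. DD X (l i) (v i) h k = DD (B i) (l i) (v i) h k)"
    by (intro choice allI)
  then obtain B where B: "\<And>i. B i \<in> K" "\<And>i h k. DD X (l i) (v i) h k = DD (B i) (l i) (v i) h k"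
    by blast
  have qB: "bih 3 1 (\<lambda>x u. q i x * B i x u)" for i
    by (intro bih_quad_bil q K_bih B)
  have sum_bih: "bih 3 1 (\<lambda>x u. \<Sum>i\<in>UNIV. q i x * B i x u)"
    by (intro bih_sum qB)
  have "DD (\<lambda>x u. X x u - (\<Sum>i\<in>UNIV. q i x * B i x u)) (l j) (v j) h k = 0" for j h k
  proof -
    have "DD (\<lambda>x u. q i x * B i x u) (l j) (v j) h k = (if j = i then DD (B i) (l j) (v j) h k else 0)" for i
      using B(1)[of i] by (simp add: DD_mult[OF q(1) K_bih[OF B(1)]] q(2) K_def)
    then show ?thesis
      by (simp add: DD_diff[OF X(1) sum_bih] DD_sum[OF _ qB] B(2))
  qed
  then have "X x u - (\<Sum>i\<in>UNIV. q i x * B i x u) = 0"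
    by (intro jet_inj[OF bih_diff[OF X(1) sum_bih]])
  moreover have "B i x u = 0" for i
    using assms(4) B(1) by (auto simp: on_curve_def)
  ultimately show ?thesis by simp
qed

definition G_comb :: "('p \<Rightarrow> complex) \<Rightarrow> complex ^ 3 \<Rightarrow> complex ^ 3 \<Rightarrow> complex" where
  "G_comb \<theta> x u = (\<Sum>i\<in>UNIV. \<theta> i * G i x u)"

lemma G_comb_bih: "bih 3 1 (G_comb \<theta>)"
  unfolding G_comb_def[abs_def] by (intro bih_sum bih_scale G_bih)

lemma G_comb_zero: "G_comb \<theta> (l j) (v j) = 0"
  by (simp add: G_comb_def G_zero)

lemma \<Theta>_G_comb: "\<Theta> j (G_comb \<theta>) = \<theta> j"
  unfolding \<Theta>_def G_comb_def[abs_def]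
  by (simp add: DD_sum[OF _ bih_scale[OF G_bih]] DD_scale[OF G_bih] G_tangent
      if_distrib[of "\<lambda>x. _ * x"] cong: if_cong)

lemma prop_to_scale:
  assumes "prop_to i x u"
  obtains c where "\<And>X. bih 3 1 X \<Longrightarrow> X x u = c * X (l i) (v i)"
proof -
  obtain \<alpha> \<beta> where "x = \<alpha> *s l i" "u = \<beta> *s v i" using assms unfolding prop_to_def by blast
  then show ?thesis
    using that[of "\<alpha> ^ 3 * \<beta> ^ 1"] bih_homogeneous by blast
qed

text \<open>The other four points lie on the curve and are zeros of \<open>G_comb \<theta>\<close>,
  hence of \<open>H\<close>; only two terms are left when \<open>H\<close> is summed over the first
  decomposition.\<close>

lemma chord_relation:
  assumes ik: "i \<noteq> k" and c: "chord_const i k \<kappa> \<kappa>'"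
  obtains H where "bih 3 1 H" "H (l i) (v i) = \<kappa> * \<theta> i" "H (l k) (v k) = \<kappa>' * \<theta> k"
    "vanishing_off i k (G_comb \<theta>) H" "\<And>n. n \<noteq> i \<Longrightarrow> n \<noteq> k \<Longrightarrow> H (l n) (v n) = 0"
proof -
  obtain H where H: "bih 3 1 H" "H (l i) (v i) = \<kappa> * \<theta> i" "H (l k) (v k) = \<kappa>' * \<theta> k"
      "vanishing_off i k (G_comb \<theta>) H"
    using c G_comb_bih[of \<theta>] G_comb_zero[of \<theta>] \<Theta>_G_comb[of _ \<theta>] unfolding chord_const_def by metis
  have "H (l n) (v n) = 0" if "n \<noteq> i" "n \<noteq> k" for n
  proof -
    have self: "prop_to n (l n) (v n)"
      unfolding prop_to_def by (intro exI[of _ 1]) simp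
    have "\<not> prop_to i (l n) (v n)" "\<not> prop_to k (l n) (v n)"
      using prop_to_unique[OF self _ point_nonzero] that by blast+
    then show ?thesis
      using H(4) point_on_curve[of n] G_comb_zero[of \<theta> n] point_nonzero[of n]
      unfolding vanishing_off_def by blast
  qed
  with H that show ?thesis by blast
qed

lemma sum_two:
  fixes f :: "'p \<Rightarrow> complex"
  assumes "i \<noteq> k" "\<And>n. n \<noteq> i \<Longrightarrow> n \<noteq> k \<Longrightarrow> f n = 0"
  shows "sum f UNIV = f i + f k"
proof -
  have "sum f UNIV = sum f {i, k}"
    using assms(2) by (intro sum.mono_neutral_right) auto
  then show ?thesis using assms(1) by simp
qed

text \<open>The six conditions \<open>G_comb \<theta> (m j) (y j) = 0\<close> on \<open>\<theta>\<close> are dependent, since the left-hand sides add up to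
  the sum of \<open>G_comb \<theta>\<close> over the first decomposition, which is zero.  The matrix \<open>M\<close> replaces the void
  condition at a point shared by both decompositions by \<open>\<theta> n = 0\<close>; the chord relations then exclude
  shared points.\<close>

lemma other_decomposition:
  assumes dec: "decomposes m y"
    and ne: "(\<lambda>j. ev (m j) (y j)) ` UNIV \<noteq> (\<lambda>j. ev (l j) (v j)) ` UNIV"
  obtains \<theta> where "\<And>i. \<theta> i \<noteq> 0" "\<And>j. G_comb \<theta> (m j) (y j) = 0"
    and "\<And>i k \<kappa> \<kappa>'. i \<noteq> k \<Longrightarrow> chord_const i k \<kappa> \<kappa>' \<Longrightarrow> \<kappa> * \<theta> i + \<kappa>' * \<theta> k = 0"
    and "\<And>i j. \<not> prop_to i (m j) (y j)"
proof -
  note nz = decomposes_nonzero[OF dec]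
  \<comment> \<open>The equation to be dropped must belong to an unshared point, so that every
    shared point keeps its condition \<open>\<theta> n = 0\<close>. Such a point exists, since
    otherwise \<open>same_points\<close> would identify the two decompositions.\<close>
  obtain j0 where j0: "\<And>i. \<not> prop_to i (m j0) (y j0)"
  proof (rule ccontr)
    assume "\<not> thesis"
    then have all: "\<exists>i. prop_to i (m j) (y j)" for j using that by blast
    obtain E where E: "\<And>j. bih 3 1 (E j)" "\<And>j k. E j (m k) (y k) = (if k = j then 1 else 0)"
      by (rule decomposes_dual_forms[OF dec]) (rule that; assumption)
    obtain E' where E': "\<And>j. bih 3 1 (E' j)" "\<And>j k. E' j (l k) (v k) = (if k = j then 1 else 0)"
      by (rule decomposes_dual_forms[OF decomposes_self]) (rule that; assumption)
    have "(\<lambda>j. ev (l j) (v j)) ` UNIV = (\<lambda>j. ev (m j) (y j)) ` UNIV"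
    proof (rule same_points[OF _ E' E])
      show "(\<Sum>j\<in>UNIV. X (l j) (v j)) = (\<Sum>j\<in>UNIV. X (m j) (y j))" if "bih 3 1 X" for X
        using decomposes_sum[OF dec that] by simp
      show "\<exists>j c. \<forall>X. bih 3 1 X \<longrightarrow> X (m k) (y k) = c * X (l j) (v j)" for k
        using all[of k] prop_to_scale by metis
    qed
    with ne show False by simp
  qed
  define M where "M = (\<lambda>i j. if \<exists>n. prop_to n (m j) (y j) then (if prop_to i (m j) (y j) then 1 else 0)
    else G i (m j) (y j))"
  obtain \<theta> where \<theta>: "\<exists>i. \<theta> i \<noteq> 0" "\<And>j. j \<noteq> j0 \<Longrightarrow> (\<Sum>i\<in>UNIV. \<theta> i * M i j) = 0"
    by (rule same_count_system[of j0 M]) (rule that; assumption)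
  have shared: "\<theta> n = 0" if n: "prop_to n (m j) (y j)" for n j
  proof -
    have "prop_to i (m j) (y j) \<longleftrightarrow> i = n" for i
      using prop_to_unique[OF _ n nz] n by blast
    then have "M i j = (if i = n then 1 else 0)" for i using n by (auto simp: M_def)
    moreover have "j \<noteq> j0" using j0 n by blast
    ultimately show ?thesis
      using \<theta>(2)[of j] by (simp add: if_distrib[of "\<lambda>x. _ * x"] cong: if_cong)
  qed
  have zero_shared: "G_comb \<theta> (m j) (y j) = 0" if p: "prop_to n (m j) (y j)" for n j
  proof -
    obtain c where "\<And>X. bih 3 1 X \<Longrightarrow> X (m j) (y j) = c * X (l n) (v n)"
      by (rule prop_to_scale[OF p]) (rule that; assumption)
    from this[OF G_comb_bih] show ?thesis by (simp add: G_comb_zero)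
  qed
  have zero': "G_comb \<theta> (m j) (y j) = 0" if "j \<noteq> j0" for j
  proof (cases "\<exists>n. prop_to n (m j) (y j)")
    case True
    then show ?thesis using zero_shared by blast
  next
    case False
    then show ?thesis using \<theta>(2)[OF that] by (simp add: M_def G_comb_def)
  qed
  have "(\<Sum>j\<in>UNIV. G_comb \<theta> (m j) (y j)) = 0"
    using decomposes_sum[OF dec G_comb_bih] by (simp add: G_comb_zero)
  moreover have "(\<Sum>j\<in>UNIV. G_comb \<theta> (m j) (y j)) = G_comb \<theta> (m j0) (y j0)"
    using zero' by (subst sum.remove[of _ j0]) auto
  ultimately have zero: "G_comb \<theta> (m j) (y j) = 0" for j
    using zero' by (cases "j = j0") auto
  have rel: "\<kappa> * \<theta> i + \<kappa>' * \<theta> k = 0" if ik: "i \<noteq> k" and c: "chord_const i k \<kappa> \<kappa>'" for i k \<kappa> \<kappa>'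
  proof -
    obtain H where H: "bih 3 1 H" "H (l i) (v i) = \<kappa> * \<theta> i" "H (l k) (v k) = \<kappa>' * \<theta> k"
      "vanishing_off i k (G_comb \<theta>) H" "\<And>n. n \<noteq> i \<Longrightarrow> n \<noteq> k \<Longrightarrow> H (l n) (v n) = 0"
      by (rule chord_relation[OF ik c, of \<theta>]) (rule that; assumption)
    have "H (m j) (y j) = 0" for j
    proof (cases "prop_to i (m j) (y j) \<or> prop_to k (m j) (y j)")
      case True
      then show ?thesis
      proof
        assume p: "prop_to i (m j) (y j)"
        from prop_to_scale[OF p] shared[OF p] H(1,2) show ?thesis by (metis mult_zero_right)
      next
        assume p: "prop_to k (m j) (y j)"
        from prop_to_scale[OF p] shared[OF p] H(1,3) show ?thesis by (metis mult_zero_right)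
      qed
    next
      case False
      then show ?thesis
        using H(4) decomposes_on_curve[OF dec, of j] zero[of j] nz unfolding vanishing_off_def by blast
    qed
    then have "(\<Sum>n\<in>UNIV. H (l n) (v n)) = 0"
      using decomposes_sum[OF dec H(1)] by simp
    then show ?thesis
      using sum_two[OF ik, of "\<lambda>n. H (l n) (v n)"] H by simp
  qed
  have nonzero: "\<theta> i \<noteq> 0" for i
  proof
    assume i: "\<theta> i = 0"
    have "\<theta> k = 0" for k
    proof (cases "k = i")
      case False
      then obtain \<kappa> \<kappa>' where c: "chord_const i k \<kappa> \<kappa>'"
        using chord_const_ex by metis
      with rel[OF _ c] False i show ?thesis by (auto simp: chord_const_def)
    qed (simp add: i)
    with \<theta>(1) show False by blast
  qed
  show ?thesis
  proof (rule that[OF nonzero zero rel])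
    show "\<not> prop_to i (m j) (y j)" for i j using shared nonzero by blast
  qed
qed

text \<open>By the chord relations \<open>G_comb \<theta>\<close> vanishes at the points of both other decompositions.  A point of one
  of them and five points of the other therefore satisfy a linear relation modulo the first
  decomposition, and the chord relations show that the latter enters only through its sum.\<close>

theorem third_decomposition:
  assumes dec: "decomposes m y" "decomposes m' y'"
    and ne: "(\<lambda>j. ev (m j) (y j)) ` UNIV \<noteq> (\<lambda>j. ev (l j) (v j)) ` UNIV"
      "(\<lambda>j. ev (m' j) (y' j)) ` UNIV \<noteq> (\<lambda>j. ev (l j) (v j)) ` UNIV"
  shows "(\<lambda>j. ev (m j) (y j)) ` UNIV = (\<lambda>j. ev (m' j) (y' j)) ` UNIV"
proof -
  obtain \<theta> where \<theta>: "\<And>i. \<theta> i \<noteq> 0" "\<And>j. G_comb \<theta> (m j) (y j) = 0"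
    "\<And>i k \<kappa> \<kappa>'. i \<noteq> k \<Longrightarrow> chord_const i k \<kappa> \<kappa>' \<Longrightarrow> \<kappa> * \<theta> i + \<kappa>' * \<theta> k = 0"
    "\<And>i j. \<not> prop_to i (m j) (y j)"
    by (rule other_decomposition[OF dec(1) ne(1)]) (rule that; assumption)
  obtain \<theta>' where \<theta>': "\<And>i. \<theta>' i \<noteq> 0" "\<And>j. G_comb \<theta>' (m' j) (y' j) = 0"
    "\<And>i k \<kappa> \<kappa>'. i \<noteq> k \<Longrightarrow> chord_const i k \<kappa> \<kappa>' \<Longrightarrow> \<kappa> * \<theta>' i + \<kappa>' * \<theta>' k = 0"
    "\<And>i j. \<not> prop_to i (m' j) (y' j)"
    by (rule other_decomposition[OF dec(2) ne(2)]) (rule that; assumption)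
  fix i0 :: 'p
  \<comment> \<open>The chord relations with \<open>i0\<close> fix all ratios
    \<open>\<theta> k / \<theta> i0\<close>, so the coefficient vectors of the two competitors are
    proportional.\<close>
  have ratio: "\<theta>' i0 * \<theta> k = \<theta>' k * \<theta> i0" for k
  proof (cases "k = i0")
    case False
    then obtain \<kappa> \<kappa>' where c: "chord_const i0 k \<kappa> \<kappa>'" using chord_const_ex by metis
    have "\<kappa> * \<theta> i0 + \<kappa>' * \<theta> k = 0" "\<kappa> * \<theta>' i0 + \<kappa>' * \<theta>' k = 0"
      using \<theta>(3)[OF _ c] \<theta>'(3)[OF _ c] False by auto
    then have "\<kappa>' * \<theta> k = - (\<kappa> * \<theta> i0)" "\<kappa>' * \<theta>' k = - (\<kappa> * \<theta>' i0)"
      by (simp_all add: eq_neg_iff_add_eq_0 add.commute)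
    then have "\<kappa>' * (\<theta>' i0 * \<theta> k) = \<kappa>' * (\<theta>' k * \<theta> i0)"
      by (metis (no_types, lifting) mult.assoc mult.commute mult_minus_left)
    then show ?thesis using c by (simp add: chord_const_def)
  qed simp
  have "G_comb \<theta>' x u * \<theta> i0 = \<theta>' i0 * G_comb \<theta> x u" for x u
    unfolding G_comb_def sum_distrib_left sum_distrib_right
  proof (intro sum.cong refl)
    fix k
    have "\<theta>' k * G k x u * \<theta> i0 = (\<theta>' k * \<theta> i0) * G k x u" by simp
    also have "\<dots> = (\<theta>' i0 * \<theta> k) * G k x u" by (simp only: ratio)
    finally show "\<theta>' k * G k x u * \<theta> i0 = \<theta>' i0 * (\<theta> k * G k x u)" by simp
  qed
  then have G': "G_comb \<theta> (m' j) (y' j) = 0" for j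
    using \<theta>'(1)[of i0] \<theta>'(2)[of j] by (metis mult_eq_0_iff)
  obtain q B where q: "\<And>j. bih 2 0 (\<lambda>x u. q j x)" "\<And>j k. q j (m k) = (if k = j then 1 else 0)"
    and B: "\<And>j. bih 1 1 (B j)" "\<And>j k. B j (m k) (y k) = (if k = j then 1 else 0)"
    by (rule decomposes_duals[OF dec(1)]) (rule that; assumption)
  obtain E' where E': "\<And>j. bih 3 1 (E' j)" "\<And>j k. E' j (m' k) (y' k) = (if k = j then 1 else 0)"
    by (rule decomposes_dual_forms[OF dec(2)]) (rule that; assumption)
  obtain E0 where E0: "\<And>j. bih 3 1 (E0 j)" "\<And>j k. E0 j (l k) (v k) = (if k = j then 1 else 0)"
    by (rule decomposes_dual_forms[OF decomposes_self]) (rule that; assumption)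
  note E = bih_quad_bil[OF q(1) B(1)]
  have E_val: "q j (m k) * B j (m k) (y k) = (if k = j then 1 else 0)" for j k
    by (simp add: q(2) B(2))
  show ?thesis
  proof (rule same_points[OF _ E E_val E'])
    show "(\<Sum>j\<in>UNIV. X (m j) (y j)) = (\<Sum>j\<in>UNIV. X (m' j) (y' j))" if "bih 3 1 X" for X
      using decomposes_sum[OF dec(1) that] decomposes_sum[OF dec(2) that] by simp
    fix k
    let ?x = "m' k" and ?u = "y' k"
    fix j0 :: 'p
    \<comment> \<open>Six coefficients and five conditions. The condition for \<open>i0\<close> is
      recovered in \<open>\<Phi>_G\<close>, because \<open>G_comb \<theta>\<close> vanishes at all
      points involved and \<open>\<theta> i0\<close> is nonzero.\<close>
    obtain a where a: "\<exists>j. a j \<noteq> 0"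
      "\<And>i. i \<noteq> i0 \<Longrightarrow> (\<Sum>j\<in>UNIV. a j * (if j = j0 then G i ?x ?u else G i (m j) (y j))) = 0"
      by (rule same_count_system[of i0 "\<lambda>j i. if j = j0 then G i ?x ?u else G i (m j) (y j)"])
        (rule that; assumption)
    define \<Phi> :: "(complex ^ 3 \<Rightarrow> complex ^ 3 \<Rightarrow> complex) \<Rightarrow> complex" where
      "\<Phi> = (\<lambda>X. \<Sum>j\<in>UNIV. a j * (if j = j0 then X ?x ?u else X (m j) (y j)))"
    have \<Phi>_add: "\<Phi> (\<lambda>x u. X x u + Y x u) = \<Phi> X + \<Phi> Y" for X Y
      by (simp add: \<Phi>_def if_distrib[of "\<lambda>x. _ * x"] distrib_left sum.distrib[symmetric] cong: if_cong)
        (intro sum.cong, auto simp: distrib_left)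
    have \<Phi>_sum: "\<Phi> (\<lambda>x u. \<Sum>i\<in>UNIV. c i * Y i x u) = (\<Sum>i\<in>UNIV. c i * \<Phi> (Y i))"
      for c :: "'p \<Rightarrow> complex" and Y
    proof -
      have "\<Phi> (\<lambda>x u. \<Sum>i\<in>UNIV. c i * Y i x u) =
          (\<Sum>j\<in>UNIV. \<Sum>i\<in>UNIV. c i * (a j * (if j = j0 then Y i ?x ?u else Y i (m j) (y j))))"
        unfolding \<Phi>_def by (intro sum.cong refl) (auto simp: sum_distrib_left mult_ac)
      then show ?thesis
        unfolding \<Phi>_def sum_distrib_left by (subst sum.swap) simp
    qed
    have \<Phi>_vanish: "\<Phi> X = 0" if "X ?x ?u = 0" "\<And>j. X (m j) (y j) = 0" for X
      unfolding \<Phi>_def using that by (intro sum.neutral) auto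
    have \<Phi>_G: "\<Phi> (G i) = 0" for i
    proof -
      have other: "\<Phi> (G i) = 0" if "i \<noteq> i0" for i using a(2)[OF that] by (simp add: \<Phi>_def)
      have "0 = \<Phi> (G_comb \<theta>)" using \<theta>(2) G' by (intro \<Phi>_vanish[symmetric])
      also have "\<dots> = (\<Sum>i\<in>UNIV. \<theta> i * \<Phi> (G i))"
        unfolding G_comb_def[abs_def] by (rule \<Phi>_sum)
      also have "\<dots> = \<theta> i0 * \<Phi> (G i0)"
        using other by (subst sum.remove[of _ i0]) auto
      finally have "\<Phi> (G i0) = 0" using \<theta>(1)[of i0] by simp
      with other show ?thesis by (cases "i = i0") auto
    qed
    \<comment> \<open>Removing from \<open>X\<close> its values at the first decomposition with
      \<open>E0\<close>, and then its tangential derivatives with \<open>G\<close>, leaves a form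
      that vanishes on the curve.\<close>
    have \<Phi>_eq: "\<Phi> X = (\<Sum>n\<in>UNIV. X (l n) (v n) * \<Phi> (E0 n))" if X: "bih 3 1 X" for X
    proof -
      define Y where "Y = (\<lambda>x u. X x u + (\<Sum>n\<in>UNIV. (- X (l n) (v n)) * E0 n x u))"
      have Y: "bih 3 1 Y" unfolding Y_def by (intro bih_add bih_sum bih_scale E0 X)
      have Y0: "Y (l j) (v j) = 0" for j
        by (simp add: Y_def E0(2) if_distrib[of "\<lambda>x. _ * x"] sum_negf cong: if_cong)
      define Z where "Z = (\<lambda>x u. Y x u + (\<Sum>n\<in>UNIV. (- \<Theta> n Y) * G n x u))"
      have Z: "bih 3 1 Z" unfolding Z_def by (intro bih_add bih_sum bih_scale G_bih Y)
      have Z0: "Z (l j) (v j) = 0" for j by (simp add: Z_def Y0 G_zero)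
      have "\<Theta> j (G_comb (\<lambda>n. - \<Theta> n Y)) = - \<Theta> j Y" for j by (rule \<Theta>_G_comb)
      then have Z1: "\<Theta> j Z = 0" for j
        unfolding Z_def G_comb_def[symmetric] using DD_add[OF Y G_comb_bih] by (simp add: \<Theta>_def)
      have "\<Phi> Z = 0"
        using vanishes_on_curve[OF Z Z0 Z1] decomposes_on_curve[OF dec(1)] decomposes_on_curve[OF dec(2)]
        by (intro \<Phi>_vanish) auto
      then have "\<Phi> Y = 0"
        unfolding Z_def \<Phi>_add \<Phi>_sum by (simp add: \<Phi>_G)
      then show ?thesis
        unfolding Y_def \<Phi>_add \<Phi>_sum by (simp add: sum_negf)
    qed
    \<comment> \<open>\<open>\<Phi>\<close> kills the chord form \<open>H\<close>, whose only two
      values at the first decomposition are opposite by the chord relation.\<close>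
    have "\<Phi> (E0 i) = \<Phi> (E0 n)" for i n
    proof (cases "i = n")
      case False
      then obtain \<kappa> \<kappa>' where c: "chord_const i n \<kappa> \<kappa>'" using chord_const_ex by metis
      obtain H where H: "bih 3 1 H" "H (l i) (v i) = \<kappa> * \<theta> i" "H (l n) (v n) = \<kappa>' * \<theta> n"
        "vanishing_off i n (G_comb \<theta>) H" "\<And>j. j \<noteq> i \<Longrightarrow> j \<noteq> n \<Longrightarrow> H (l j) (v j) = 0"
        by (rule chord_relation[OF False c, of \<theta>]) (rule that; assumption)
      have "H ?x ?u = 0"
        using H(4) decomposes_on_curve[OF dec(2), of k] G'[of k] decomposes_nonzero[OF dec(2), of k] \<theta>'(4)
        unfolding vanishing_off_def by blast
      moreover have "H (m j) (y j) = 0" for j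
        using H(4) decomposes_on_curve[OF dec(1), of j] \<theta>(2)[of j] decomposes_nonzero[OF dec(1), of j] \<theta>(4)
        unfolding vanishing_off_def by blast
      ultimately have "0 = \<Phi> H" using \<Phi>_vanish by simp
      also have "\<dots> = H (l i) (v i) * \<Phi> (E0 i) + H (l n) (v n) * \<Phi> (E0 n)"
        unfolding \<Phi>_eq[OF H(1)] by (intro sum_two False) (simp add: H(5))
      also have "\<dots> = \<kappa> * \<theta> i * (\<Phi> (E0 i) - \<Phi> (E0 n))"
      proof -
        have "\<kappa>' * \<theta> n = - (\<kappa> * \<theta> i)"
          using \<theta>(3)[OF False c] by (simp add: eq_neg_iff_add_eq_0 add.commute)
        then show ?thesis by (simp add: H(2,3) algebra_simps)
      qed
      finally show ?thesis using c \<theta>(1)[of i] by (simp add: chord_const_def)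
    qed simp
    then have "\<Phi> X = (\<Sum>n\<in>UNIV. X (l n) (v n)) * \<Phi> (E0 i0)" if "bih 3 1 X" for X
      unfolding \<Phi>_eq[OF that] sum_distrib_right by (intro sum.cong refl) metis
    then have \<Phi>_m: "\<Phi> X = (\<Sum>j\<in>UNIV. X (m j) (y j)) * \<Phi> (E0 i0)" if "bih 3 1 X" for X
      using decomposes_sum[OF dec(1) that] that by simp
    define b where "b = (\<lambda>j. \<Phi> (E0 i0) - (if j = j0 then 0 else a j))"
    have lin_rel: "a j0 * X ?x ?u = (\<Sum>j\<in>UNIV. b j * X (m j) (y j))" if X: "bih 3 1 X" for X
    proof -
      have "\<Phi> X = (\<Sum>j\<in>UNIV. (if j = j0 then a j0 * X ?x ?u else 0) +
          (if j = j0 then 0 else a j) * X (m j) (y j))"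
        unfolding \<Phi>_def by (intro sum.cong) auto
      then have "\<Phi> X = a j0 * X ?x ?u + (\<Sum>j\<in>UNIV. (if j = j0 then 0 else a j) * X (m j) (y j))"
        by (simp add: sum.distrib)
      moreover have "(\<Sum>j\<in>UNIV. b j * X (m j) (y j)) = \<Phi> (E0 i0) * (\<Sum>j\<in>UNIV. X (m j) (y j)) -
          (\<Sum>j\<in>UNIV. (if j = j0 then 0 else a j) * X (m j) (y j))"
        unfolding b_def left_diff_distrib sum_subtractf sum_distrib_left ..
      ultimately show ?thesis
        using \<Phi>_m[OF X] by (simp add: mult.commute)
    qed
    have b_eq: "b j = a j0 * (q j ?x * B j ?x ?u)" for j
      using lin_rel[OF E, of j j] by (simp add: E_val if_distrib[of "\<lambda>x. _ * x"] cong: if_cong)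
    \<comment> \<open>Otherwise the relation would involve only the independent points
      \<open>(m, y)\<close>, and all coefficients would be zero.\<close>
    have a0: "a j0 \<noteq> 0"
    proof
      assume z: "a j0 = 0"
      then have bz: "b j = 0" for j using b_eq by simp
      have "\<Phi> (E0 i0) = 0" using bz[of j0] by (simp add: b_def)
      then have "a j = 0" for j
        using bz[of j] z by (simp add: b_def split: if_splits)
      with a(1) show False by blast
    qed
    obtain j where j: "b j \<noteq> 0"
    proof (rule ccontr)
      assume "\<not> thesis"
      then have "b j = 0" for j using that by blast
      then have "a j0 * E' k ?x ?u = 0" using lin_rel[OF E'(1)] by simp
      with a0 show False by (simp add: E'(2))
    qed
    \<comment> \<open>The product of a conic and a bilinear form dual to two different points
      vanishes at all of \<open>(m, y)\<close>; tested on the relation it shows that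
      \<open>b j\<close> and \<open>b j'\<close> are not both nonzero.\<close>
    have others: "b j' = 0" if j': "j' \<noteq> j" for j'
    proof (rule ccontr)
      assume nz: "b j' \<noteq> 0"
      have "a j0 * (q j' ?x * B j ?x ?u) = 0"
        using lin_rel[OF bih_quad_bil[OF q(1) B(1)], of j' j] j'
        by (simp add: q(2) B(2) if_distrib[of "\<lambda>x. x * _"] if_distrib[of "\<lambda>x. _ * x"] cong: if_cong)
      moreover have "q j' ?x \<noteq> 0" using nz b_eq[of j'] by auto
      ultimately have "B j ?x ?u = 0" using a0 by simp
      with j b_eq[of j] show False by simp
    qed
    have "X ?x ?u = b j / a j0 * X (m j) (y j)" if X: "bih 3 1 X" for X
    proof -
      have "(\<Sum>j\<in>UNIV. b j * X (m j) (y j)) = b j * X (m j) (y j)"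
        using others by (subst sum.remove[of _ j]) auto
      then show ?thesis using lin_rel[OF X] a0 by (simp add: field_simps)
    qed
    then show "\<exists>j c. \<forall>X. bih 3 1 X \<longrightarrow> X ?x ?u = c * X (m j) (y j)" by blast
  qed
qed

end

theorem (in sextuple) at_most_two_decompositions:
  assumes "decomposes m y" "decomposes m' y'"
    and "(\<lambda>j. ev (m j) (y j)) ` UNIV \<noteq> (\<lambda>j. ev (l j) (v j)) ` UNIV"
      "(\<lambda>j. ev (m' j) (y' j)) ` UNIV \<noteq> (\<lambda>j. ev (l j) (v j)) ` UNIV"
  shows "(\<lambda>j. ev (m j) (y j)) ` UNIV = (\<lambda>j. ev (m' j) (y' j)) ` UNIV"
proof -
  obtain hh kk G where "\<And>i. tangent i (hh i) (kk i)" "\<And>i. bih 3 1 (G i)"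
    "\<And>i j. G i (l j) (v j) = 0"
    "\<And>i j. DD (G i) (l j) (v j) (hh j) (kk j) = (if j = i then 1 else 0)"
    by (rule tangent_frame) (rule that; assumption)
  then interpret sextuple_tangent l v hh kk G by unfold_locales
  show ?thesis using assms by (rule third_decomposition)
qed

section \<open>Generic sextuples\<close>

definition det3 :: "complex ^ 3 \<Rightarrow> complex ^ 3 \<Rightarrow> complex ^ 3 \<Rightarrow> complex" where
  "det3 a b c = a $ 1 * (b $ 2 * c $ 3 - b $ 3 * c $ 2) - b $ 1 * (a $ 2 * c $ 3 - a $ 3 * c $ 2)
    + c $ 1 * (a $ 2 * b $ 3 - a $ 3 * b $ 2)"

lemma det3_same [simp]: "det3 a a b = 0" "det3 a b a = 0" "det3 b a a = 0"
  by (simp_all add: det3_def algebra_simps)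

lemma det3_cramer: "det3 a b c *s x = det3 x b c *s a + det3 a x c *s b + det3 a b x *s c"
  unfolding vec_eq_iff forall_3 by (simp add: det3_def) algebra

lemma lin_scaled: "lin f \<Longrightarrow> lin (\<lambda>x. k * f x)"
proof -
  assume "lin f"
  then obtain c where "\<And>x. f x = (\<Sum>a\<in>UNIV. c a * x $ a)" by (auto simp: lin_def)
  then show ?thesis
    unfolding lin_def by (intro exI[of _ "\<lambda>a. k * c a"]) (simp add: sum_distrib_left mult.assoc)
qed

lemma lin_det3: "lin (\<lambda>x. det3 x b c)" "lin (\<lambda>x. det3 a x c)" "lin (\<lambda>x. det3 a b x)"
proof -
  have 1: "lin (\<lambda>x. det3 x b c)" for b c
    unfolding lin_def
    by (intro exI[of _ "\<lambda>i. if i = 1 then b $ 2 * c $ 3 - b $ 3 * c $ 2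
        else if i = 2 then b $ 3 * c $ 1 - b $ 1 * c $ 3 else b $ 1 * c $ 2 - b $ 2 * c $ 1"])
      (simp add: sum_3 det3_def algebra_simps)
  show "lin (\<lambda>x. det3 x b c)" by (rule 1)
  have "(\<lambda>x. det3 a x c) = (\<lambda>x. - det3 x a c)" "(\<lambda>x. det3 a b x) = (\<lambda>x. det3 x a b)"
    by (simp_all add: det3_def fun_eq_iff algebra_simps)
  then show "lin (\<lambda>x. det3 a x c)" "lin (\<lambda>x. det3 a b x)"
    using lin_scaled[OF 1, of "-1"] 1 by simp_all
qed

lemma lin_plus: "lin f \<Longrightarrow> lin g \<Longrightarrow> lin (\<lambda>x. f x + g x)"
proof -
  assume "lin f" "lin g"
  then obtain c d where "\<And>x. f x = (\<Sum>a\<in>UNIV. c a * x $ a)" "\<And>x. g x = (\<Sum>a\<in>UNIV. d a * x $ a)"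
    by (auto simp: lin_def)
  then show ?thesis
    unfolding lin_def by (intro exI[of _ "\<lambda>a. c a + d a"]) (simp add: sum.distrib distrib_right)
qed

lemma lin_0: "lin (\<lambda>x. 0)"
  unfolding lin_def by (intro exI[of _ "\<lambda>_. 0"]) simp

locale hexad =
  fixes l v :: "'p::finite \<Rightarrow> complex ^ 3" and i k p q m n :: 'p
begin

definition r' :: "complex ^ 3 \<Rightarrow> complex" where "r' x = det3 (l i) (l k) x"
definition s' :: "complex ^ 3 \<Rightarrow> complex" where "s' x = det3 x (l k) (l p)"
definition t' :: "complex ^ 3 \<Rightarrow> complex" where "t' x = det3 (l i) x (l p)"
definition cq :: complex where "cq = det3 (v p) (v m) (v n)"
definition cm :: complex where "cm = det3 (v q) (v p) (v n)"
definition cn :: complex where "cn = det3 (v q) (v m) (v p)"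
definition D :: complex where "D = det3 (v q) (v m) (v n)"

text \<open>The relation between \<open>v p\<close>, \<open>v q\<close>, \<open>v m\<close>, \<open>v n\<close> produces an element
  \<open>l i \<otimes> a + l k \<otimes> b\<close> of the span of the six points; a bilinear form on the line through \<open>l i\<close> and
  \<open>l k\<close> extends to one vanishing at the other four points iff it vanishes there.\<close>

definition a :: "complex ^ 3" where
  "a = (cq * s' (l q) * (r' (l m) * r' (l n))) *s v q + (cm * s' (l m) * (r' (l q) * r' (l n))) *s v m
    + (cn * s' (l n) * (r' (l q) * r' (l m))) *s v n"
definition b :: "complex ^ 3" where
  "b = (cq * t' (l q) * (r' (l m) * r' (l n))) *s v q + (cm * t' (l m) * (r' (l q) * r' (l n))) *s v m
    + (cn * t' (l n) * (r' (l q) * r' (l m))) *s v n"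

definition genpoly :: complex where
  "genpoly = r' (l p) * r' (l q) * r' (l m) * r' (l n) * D * det3 (v i) (v k) a * det3 (v i) (v k) b"

end

locale generic_hexad = hexad +
  assumes exhaust: "UNIV = {i, k, p, q, m, n}" and dist: "distinct [i, k, p, q, m, n]"
    and gen: "genpoly \<noteq> 0"
begin

lemma nz: "r' (l p) \<noteq> 0" "r' (l q) \<noteq> 0" "r' (l m) \<noteq> 0" "r' (l n) \<noteq> 0" "D \<noteq> 0"
  "det3 (v i) (v k) a \<noteq> 0" "det3 (v i) (v k) b \<noteq> 0"
  using gen by (auto simp: genpoly_def)

definition \<Delta> :: complex where "\<Delta> = r' (l p)"
definition r :: "complex ^ 3 \<Rightarrow> complex" where "r x = inverse \<Delta> * r' x"
definition s :: "complex ^ 3 \<Rightarrow> complex" where "s x = inverse \<Delta> * s' x"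
definition t :: "complex ^ 3 \<Rightarrow> complex" where "t x = inverse \<Delta> * t' x"

lemma lin_rst: "lin r" "lin s" "lin t"
  unfolding r_def[abs_def] s_def[abs_def] t_def[abs_def] r'_def s'_def t'_def
  by (intro lin_scaled lin_det3)+

lemma Delta: "\<Delta> \<noteq> 0" "\<Delta> = det3 (l i) (l k) (l p)"
  using nz(1) by (simp_all add: \<Delta>_def r'_def)

lemma expand_fst: "x = s x *s l i + t x *s l k + r x *s l p"
proof -
  have "\<Delta> *s x = s' x *s l i + t' x *s l k + r' x *s l p"
    unfolding Delta(2) s'_def t'_def r'_def by (rule det3_cramer)
  then have "inverse \<Delta> *s (\<Delta> *s x) = inverse \<Delta> *s (s' x *s l i + t' x *s l k + r' x *s l p)"
    by simp
  then show ?thesis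
    using Delta(1) by (simp add: s_def t_def r_def vector_add_ldistrib)
qed

lemma rst: "s (l i) = 1" "t (l i) = 0" "r (l i) = 0" "s (l k) = 0" "t (l k) = 1" "r (l k) = 0"
  "s (l p) = 0" "t (l p) = 0" "r (l p) = 1"
  using Delta by (simp_all add: s_def t_def r_def s'_def t'_def r'_def)

lemma r_nz: "r (l q) \<noteq> 0" "r (l m) \<noteq> 0" "r (l n) \<noteq> 0"
  using nz Delta by (simp_all add: r_def)

text \<open>The conditions at \<open>q\<close>, \<open>m\<close>, \<open>n\<close> fix
  \<open>\<beta>3\<close> on the basis \<open>v q\<close>, \<open>v m\<close>, \<open>v n\<close>.
  At \<open>p\<close>, where \<open>s\<close> and \<open>t\<close> vanish, the last condition is
  \<open>\<beta>3 (v p) = 0\<close>; expanding \<open>v p\<close> in that basis and clearing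
  denominators turns it into \<open>rel\<close>.\<close>

lemma extension:
  assumes "lin \<beta>1" "lin \<beta>2" and rel: "\<beta>1 a + \<beta>2 b = 0"
  obtains \<beta>3 where "lin \<beta>3"
    "\<And>j. j \<in> {p, q, m, n} \<Longrightarrow> s (l j) * \<beta>1 (v j) + t (l j) * \<beta>2 (v j) + r (l j) * \<beta>3 (v j) = 0"
proof -
  define y where "y = (\<lambda>j. - (s (l j) * \<beta>1 (v j) + t (l j) * \<beta>2 (v j)) / r (l j))"
  define \<beta>3 where "\<beta>3 = (\<lambda>u. y q / D * det3 u (v m) (v n) + y m / D * det3 (v q) u (v n) + y n / D * det3 (v q) (v m) u)"
  have lin: "lin \<beta>3"
    unfolding \<beta>3_def by (intro lin_plus lin_scaled lin_det3)
  have vals: "\<beta>3 (v q) = y q" "\<beta>3 (v m) = y m" "\<beta>3 (v n) = y n"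
    using nz(5) by (simp_all add: \<beta>3_def D_def)
  have "\<beta>3 (v p) = (y q * cq + y m * cm + y n * cn) / D"
    by (simp add: \<beta>3_def cq_def cm_def cn_def add_divide_distrib)
  moreover have "y q * cq + y m * cm + y n * cn = 0"
  proof -
    let ?R = "r' (l q) * r' (l m) * r' (l n)"
    have y': "y j * r' (l j) = - (s' (l j) * \<beta>1 (v j) + t' (l j) * \<beta>2 (v j))" if "r' (l j) \<noteq> 0" for j
      using that Delta(1) by (simp add: y_def r_def s_def t_def field_simps)
    have "?R * (y q * cq + y m * cm + y n * cn) =
        (y q * r' (l q)) * cq * (r' (l m) * r' (l n)) + (y m * r' (l m)) * cm * (r' (l q) * r' (l n))
        + (y n * r' (l n)) * cn * (r' (l q) * r' (l m))"
      by (simp add: algebra_simps)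
    also have "\<dots> = - (\<beta>1 a + \<beta>2 b)"
      unfolding y'[OF nz(2)] y'[OF nz(3)] y'[OF nz(4)] a_def b_def lin_add[OF assms(1)] lin_add[OF assms(2)]
        lin_scale[OF assms(1)] lin_scale[OF assms(2)]
      by (simp add: algebra_simps)
    finally show ?thesis using rel nz by simp
  qed
  ultimately have vp: "\<beta>3 (v p) = 0" by simp
  show ?thesis
  proof (rule that[OF lin])
    fix j assume "j \<in> {p, q, m, n}"
    then show "s (l j) * \<beta>1 (v j) + t (l j) * \<beta>2 (v j) + r (l j) * \<beta>3 (v j) = 0"
      using r_nz by (auto simp: rst vp vals y_def)
  qed
qed

text \<open>Coordinates adjusted to \<open>extension\<close>: \<open>u1 b = 0\<close> and
  \<open>u2 a = 0\<close> are what lets \<open>t * u1\<close> and \<open>s * u2\<close> extend to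
  members of the net, while \<open>u3\<close>, with \<open>u3 b = 1\<close>, extends after
  multiplication by \<open>s - u3 a * t\<close>. The vector \<open>w\<close> corrects
  \<open>b\<close> so that \<open>u1\<close>, \<open>u2\<close>, \<open>u3\<close> become dual to
  \<open>v i\<close>, \<open>v k\<close>, \<open>w\<close>.\<close>

definition u1 :: "complex ^ 3 \<Rightarrow> complex" where
  "u1 u = inverse (det3 (v i) (v k) b) * det3 u (v k) b"
definition u2 :: "complex ^ 3 \<Rightarrow> complex" where
  "u2 u = inverse (det3 (v i) (v k) a) * det3 (v i) u a"
definition u3 :: "complex ^ 3 \<Rightarrow> complex" where
  "u3 u = inverse (det3 (v i) (v k) b) * det3 (v i) (v k) u"
definition w :: "complex ^ 3" where "w = b + (- u2 b) *s v k"

lemma lin_u: "lin u1" "lin u2" "lin u3"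
  unfolding u1_def[abs_def] u2_def[abs_def] u3_def[abs_def] by (intro lin_scaled lin_det3)+

lemma u_vals: "u1 (v i) = 1" "u2 (v i) = 0" "u3 (v i) = 0" "u1 (v k) = 0" "u2 (v k) = 1" "u3 (v k) = 0"
  "u1 b = 0" "u2 a = 0" "u3 b = 1"
  using nz by (simp_all add: u1_def u2_def u3_def)

lemma w_vals: "u1 w = 0" "u2 w = 0" "u3 w = 1"
  unfolding w_def by (simp_all only: lin_u lin_add lin_scale) (simp_all add: u_vals)

lemma expand_snd: "u = u1 u *s v i + u2 u *s v k + u3 u *s w"
proof -
  let ?d = "det3 (v i) (v k) b"
  define B where "B = inverse ?d * det3 (v i) u b"
  have "?d *s u = det3 u (v k) b *s v i + det3 (v i) u b *s v k + det3 (v i) (v k) u *s b"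
    by (rule det3_cramer)
  then have "inverse ?d *s (?d *s u) =
      inverse ?d *s (det3 u (v k) b *s v i + det3 (v i) u b *s v k + det3 (v i) (v k) u *s b)"
    by simp
  then have u: "u = u1 u *s v i + B *s v k + u3 u *s b"
    using nz by (simp add: u1_def u3_def B_def vector_add_ldistrib)
  then have "u2 u = u2 (u1 u *s v i + B *s v k + u3 u *s b)" by simp
  then have "u2 u = B + u3 u * u2 b"
    by (simp add: lin_add[OF lin_u(2)] lin_scale[OF lin_u(2)] u_vals)
  then have "u1 u *s v i + u2 u *s v k + u3 u *s w = u1 u *s v i + B *s v k + u3 u *s b"
    by (simp add: w_def vec_eq_iff algebra_simps)
  then show ?thesis using u by simp
qed

lemma chord_coords_ex:
  "\<exists>e w s t r u1 u2 u3 b1 b2 b3 m1 m2. chord_coords l v i k e w s t r u1 u2 u3 b1 b2 b3 m1 m2"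
proof -
  have all: "(\<forall>j. P j) \<longleftrightarrow> P i \<and> P k \<and> (\<forall>j\<in>{p, q, m, n}. P j)" for P
    using exhaust by auto
  obtain b1 where b1: "lin b1"
    "\<And>j. j \<in> {p, q, m, n} \<Longrightarrow> s (l j) * 0 + t (l j) * u1 (v j) + r (l j) * b1 (v j) = 0"
    using extension[OF lin_0 lin_u(1)] u_vals(7) by auto
  obtain b2 where b2: "lin b2"
    "\<And>j. j \<in> {p, q, m, n} \<Longrightarrow> s (l j) * u2 (v j) + t (l j) * 0 + r (l j) * b2 (v j) = 0"
    using extension[OF lin_u(2) lin_0] u_vals(8) by auto
  let ?\<alpha> = "u3 a"
  have \<alpha>: "?\<alpha> \<noteq> 0" using nz by (simp add: u3_def)
  obtain b3 where b3: "lin b3"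
    "\<And>j. j \<in> {p, q, m, n} \<Longrightarrow> s (l j) * (1 * u3 (v j)) + t (l j) * (- ?\<alpha> * u3 (v j)) + r (l j) * b3 (v j) = 0"
    by (rule extension[OF lin_scaled[OF lin_u(3), of 1] lin_scaled[OF lin_u(3), of "- ?\<alpha>"]])
      (auto simp: u_vals intro: that)
  have "chord_coords l v i k (l p) w s t r u1 u2 u3 b1 b2 b3 1 (- ?\<alpha>)"
    unfolding chord_coords_def all
    using lin_rst lin_u b1 b2 b3 expand_fst expand_snd rst u_vals w_vals \<alpha>
    by (auto simp: algebra_simps)
  then show ?thesis by blast
qed

lemma bilinear_dual_ex: "\<exists>B. bih 1 1 B \<and> (\<forall>j. B (l j) (v j) = (if j = i then 1 else 0))"
proof -
  let ?\<beta> = "\<lambda>u. inverse (det3 (v i) (v k) a) * det3 u (v k) a"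
  have lin: "lin ?\<beta>" by (intro lin_scaled lin_det3)
  obtain b where b: "lin b"
    "\<And>j. j \<in> {p, q, m, n} \<Longrightarrow> s (l j) * ?\<beta> (v j) + t (l j) * 0 + r (l j) * b (v j) = 0"
    by (rule extension[OF lin lin_0]) (auto intro: that)
  let ?B = "\<lambda>x u. s x * ?\<beta> u + r x * b u"
  have "bih 1 1 ?B"
    by (intro bih_add bih_mult'[OF lin_bih(1)[OF lin_rst(2)] lin_bih(2)[OF lin]]
        bih_mult'[OF lin_bih(1)[OF lin_rst(1)] lin_bih(2)[OF b(1)]]) auto
  moreover have "?B (l j) (v j) = (if j = i then 1 else 0)" for j
  proof -
    have "j \<in> {i, k, p, q, m, n}" using exhaust by blast
    then consider "j = i" | "j = k" | "j \<in> {p, q, m, n}" "j \<noteq> i" using dist by auto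
    then show ?thesis
      using b(2)[of j] nz(6) dist by cases (auto simp: rst)
  qed
  ultimately show ?thesis by blast
qed

end

lemma hexad_enumeration:
  fixes i k :: "'p::finite"
  assumes "CARD('p) = 6" "i \<noteq> k"
  obtains p q m n where "UNIV = {i, k, p, q, m, n}" "distinct [i, k, p, q, m, n]"
proof -
  have "card (UNIV - {i, k}) = 4" using assms by (simp add: card_Diff_subset)
  then obtain xs where xs: "set xs = UNIV - {i, k}" "length xs = 4" "distinct xs"
    by (metis finite_distinct_list distinct_card finite)
  then obtain p q m n where "xs = [p, q, m, n]"
    by (auto simp: length_Suc_conv eval_nat_numeral)
  with xs assms(2) show ?thesis by (intro that[of p q m n]) auto
qed

section \<open>The parametrisation by sextuples\<close>

definition deg3 :: "(3 \<Rightarrow>\<^sub>0 nat) set" where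
  "deg3 = {m. (\<Sum>i\<in>UNIV. Poly_Mapping.lookup m i) = 3}"

definition expo :: "nat \<Rightarrow> nat \<Rightarrow> nat \<Rightarrow> 3 \<Rightarrow>\<^sub>0 nat" where
  "expo a b c = Poly_Mapping.single 1 a + Poly_Mapping.single 2 b + Poly_Mapping.single 3 c"

lemma lookup_expo:
  "Poly_Mapping.lookup (expo a b c) 1 = a" "Poly_Mapping.lookup (expo a b c) 2 = b"
  "Poly_Mapping.lookup (expo a b c) 3 = c"
  by (simp_all add: expo_def lookup_add lookup_single)

lemma expo_lookup:
  "expo (Poly_Mapping.lookup m 1) (Poly_Mapping.lookup m 2) (Poly_Mapping.lookup m 3) = m"
  by (rule poly_mapping_eqI) (metis exhaust_3 lookup_expo)

definition triples :: "(nat \<times> nat) set" where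
  "triples = (SIGMA a:{..3}. {..3 - a})"

lemma deg3_image: "deg3 = (\<lambda>(a, b). expo a b (3 - a - b)) ` triples"
proof
  show "deg3 \<subseteq> (\<lambda>(a, b). expo a b (3 - a - b)) ` triples"
  proof
    fix m assume "m \<in> deg3"
    then have s: "Poly_Mapping.lookup m 1 + Poly_Mapping.lookup m 2 + Poly_Mapping.lookup m 3 = 3"
      by (simp add: deg3_def sum_3)
    then have "3 - Poly_Mapping.lookup m 1 - Poly_Mapping.lookup m 2 = Poly_Mapping.lookup m 3" by simp
    then have "m = (\<lambda>(a, b). expo a b (3 - a - b)) (Poly_Mapping.lookup m 1, Poly_Mapping.lookup m 2)"
      by (simp add: expo_lookup)
    moreover have "(Poly_Mapping.lookup m 1, Poly_Mapping.lookup m 2) \<in> triples"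
      using s by (auto simp: triples_def)
    ultimately show "m \<in> (\<lambda>(a, b). expo a b (3 - a - b)) ` triples" by (rule image_eqI)
  qed
qed (auto simp: deg3_def sum_3 lookup_expo triples_def)

lemma inj_expo: "inj_on (\<lambda>(a, b). expo a b (3 - a - b)) triples"
  by (rule inj_onI) (auto dest!: arg_cong[where f = Poly_Mapping.lookup] simp: fun_eq_iff, (metis lookup_expo)+)

lemma finite_deg3 [simp]: "finite deg3"
  unfolding deg3_image by (simp add: triples_def)

lemma card_deg3: "card deg3 = 10"
  unfolding deg3_image card_image[OF inj_expo] by (simp add: triples_def eval_nat_numeral)

lemma sum_deg3: "(\<Sum>m\<in>deg3. f m) = (\<Sum>a\<le>3. \<Sum>b\<le>3 - a. f (expo a b (3 - a - b)))"
  unfolding deg3_image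
  by (subst sum.reindex[OF inj_expo]) (simp add: triples_def sum.Sigma case_prod_unfold)

type_synonym param = "complex ^ (6 \<times> (2 + 3))"

text \<open>Indexing the 30 coefficients by the type that indexes the 30 parameters makes the Jacobian matrix
  square.\<close>

definition cubic_index :: "6 \<times> (2 + 3) \<Rightarrow> 3 \<times> (3 \<Rightarrow>\<^sub>0 nat)" where
  "cubic_index = (SOME f. bij_betw f UNIV (UNIV \<times> deg3))"

lemma bij_cubic_index: "bij_betw cubic_index UNIV (UNIV \<times> deg3)"
proof -
  have "card (UNIV :: (6 \<times> (2 + 3)) set) = card ((UNIV :: 3 set) \<times> deg3)"
    by (simp add: card_cartesian_product card_deg3)
  then have "\<exists>f. bij_betw f (UNIV :: (6 \<times> (2 + 3)) set) ((UNIV :: 3 set) \<times> deg3)"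
    by (intro finite_same_card_bij) auto
  then show ?thesis unfolding cubic_index_def by (rule someI_ex)
qed

lemma cubic_index_deg3: "snd (cubic_index c) \<in> deg3"
  using bij_betw_apply[OF bij_cubic_index, of c] by (simp add: mem_Times_iff)

definition cmon :: "complex ^ 3 \<Rightarrow> (3 \<Rightarrow>\<^sub>0 nat) \<Rightarrow> complex" where
  "cmon x m = (\<Prod>i\<in>UNIV. x $ i ^ Poly_Mapping.lookup m i)"

lemma prod_3: "prod f (UNIV :: 3 set) = f 1 * f 2 * f 3"
  unfolding UNIV_3 by (simp add: mult.assoc)

lemma bih_power: "bih d 0 (\<lambda>x u. f x) \<Longrightarrow> bih (k * d) 0 (\<lambda>x u. f x ^ k)"
proof (induction k)
  case 0
  show ?case using bih_const[of 1] by simp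
next
  case (Suc k)
  then show ?case using bih_mult[of d 0 "\<lambda>x u. f x" "k * d" 0 "\<lambda>x u. f x ^ k"] by simp
qed

lemma bih_cmon:
  assumes "m \<in> deg3"
  shows "bih 3 0 (\<lambda>x u. cmon x m)"
proof -
  have p: "bih k 0 (\<lambda>x u. x $ i ^ k)" for i k
    using bih_power[OF bih_fst[of i], of k] by simp
  show ?thesis
    unfolding cmon_def prod_3
    by (rule bih_mult'[OF bih_mult'[OF p p] p]) (use assms in \<open>auto simp: deg3_def sum_3\<close>)
qed

definition form :: "(6 \<times> (2 + 3) \<Rightarrow> complex) \<Rightarrow> complex ^ 3 \<Rightarrow> complex ^ 3 \<Rightarrow> complex" where
  "form g x u = (\<Sum>c\<in>UNIV. g c * (cmon x (snd (cubic_index c)) * u $ fst (cubic_index c)))"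

lemma bih_form: "bih 3 1 (form g)"
  unfolding form_def[abs_def]
  by (intro bih_sum bih_scale bih_mult'[OF bih_cmon[OF cubic_index_deg3] bih_snd]) auto

lemma cmon_add: "cmon x (m + m') = cmon x m * cmon x m'"
  by (simp add: cmon_def lookup_add power_add prod.distrib)

lemma cmon_single: "cmon x (Poly_Mapping.single a 1) = x $ a"
  by (simp add: cmon_def lookup_single when_def if_distrib[of "\<lambda>k. _ ^ k"] cong: if_cong)

lemma form_ex:
  assumes "bih 3 1 X"
  obtains g where "X = form g"
proof -
  have "\<exists>g. X = form g"
    using assms
  proof (induction rule: bih31_induct)
    case zero
    show ?case by (intro exI[of _ "\<lambda>_. 0"]) (simp add: form_def fun_eq_iff)
  next
    case (step X a b c d k)
    then obtain g where g: "X = form g" by blast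
    let ?m = "Poly_Mapping.single a 1 + Poly_Mapping.single b 1 + Poly_Mapping.single c (1 :: nat)"
    have one: "(\<Sum>j\<in>UNIV. Poly_Mapping.lookup (Poly_Mapping.single a (1::nat)) j) = 1" for a :: 3
      by (simp add: lookup_single when_def)
    have "?m \<in> deg3"
      by (simp add: deg3_def lookup_add sum.distrib one del: One_nat_def)
    then obtain z where z: "cubic_index z = (d, ?m)"
      using bij_betw_imp_surj_on[OF bij_cubic_index] by (metis (no_types, lifting) SigmaI UNIV_I imageE)
    have "form (\<lambda>z'. g z' + (if z' = z then k else 0)) x u = form g x u + k * (x $ a * x $ b * x $ c * u $ d)" for x u
    proof -
      have "form (\<lambda>z'. g z' + (if z' = z then k else 0)) x u =
          form g x u + form (\<lambda>z'. if z' = z then k else 0) x u"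
        by (simp add: form_def distrib_right sum.distrib)
      also have "form (\<lambda>z'. if z' = z then k else 0) x u = k * (cmon x ?m * u $ d)"
        by (simp add: form_def z if_distrib[of "\<lambda>c. c * _"] del: One_nat_def cong: if_cong)
      finally show ?thesis by (simp add: cmon_add cmon_single del: One_nat_def)
    qed
    then show ?case
      unfolding g by (intro exI[of _ "\<lambda>z'. g z' + (if z' = z then k else 0)"]) (simp add: fun_eq_iff)
  qed
  with that show ?thesis by blast
qed

text \<open>The chart of sextuples whose linear forms have first coefficient 1; \<open>dl\<close> is the linear part of \<open>pl\<close>.\<close>

definition pl :: "param \<Rightarrow> 6 \<Rightarrow> complex ^ 3" where
  "pl x i = vector [1, x $ (i, Inl 1), x $ (i, Inl 2)]"
definition dl :: "param \<Rightarrow> 6 \<Rightarrow> complex ^ 3" where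
  "dl x i = vector [0, x $ (i, Inl 1), x $ (i, Inl 2)]"
definition pv :: "param \<Rightarrow> 6 \<Rightarrow> complex ^ 3" where
  "pv x i = (\<chi> d. x $ (i, Inr d))"

lemma pl_line: "pl (x + t *s y) i = pl x i + t *s dl y i" "pv (x + t *s y) i = pv x i + t *s pv y i"
  by (simp_all add: pl_def dl_def pv_def vec_eq_iff forall_3)

lemma cpoly_pl: "cpoly (\<lambda>x. pl x i $ a)"
  using exhaust_3[of a] by (auto simp: pl_def intro: cpoly.intros)

lemma cpoly_pv: "cpoly (\<lambda>x. pv x i $ a)"
  by (simp add: pv_def cpoly_comp)

text \<open>These are the coefficients of the sum of the six summands divided by the trinomial
  coefficients; in this normalisation, pairing with the coefficients of a form is evaluation at the
  six points.\<close>

definition waring_map :: "param \<Rightarrow> param" where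
  "waring_map x = (\<chi> c. \<Sum>i\<in>UNIV. cmon (pl x i) (snd (cubic_index c)) * pv x i $ fst (cubic_index c))"

lemma cpoly_waring_map: "cpoly (\<lambda>x. waring_map x $ c)"
  unfolding waring_map_def cmon_def vec_lambda_beta
  by (intro cpoly_sum cpoly_mult cpoly_prod cpoly_power cpoly_pl cpoly_pv)

lemma form_waring_map:
  "(\<Sum>c\<in>UNIV. g c * waring_map x $ c) = (\<Sum>i\<in>UNIV. form g (pl x i) (pv x i))"
  unfolding waring_map_def form_def vec_lambda_beta sum_distrib_left by (rule sum.swap)

lemma polynomial_map_ex:
  fixes F :: "complex ^ 'n \<Rightarrow> complex ^ 'n"
  assumes F: "\<And>i. cpoly (\<lambda>x. F x $ i)"
  shows "\<exists>jac. polynomial_map F jac"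
proof -
  have "\<forall>i. \<exists>D. (\<forall>j. cpoly (D j)) \<and>
      (\<forall>x. ((\<lambda>x. F x $ i) has_derivative (\<lambda>h. \<Sum>j\<in>UNIV. D j x * h $ j)) (at x))"
    by (intro allI, rule cpoly_has_derivative[OF F]) blast
  from choice[OF this] obtain D where D: "\<And>i j. cpoly (D i j)"
    "\<And>i x. ((\<lambda>x. F x $ i) has_derivative (\<lambda>h. \<Sum>j\<in>UNIV. D i j x * h $ j)) (at x)" by blast
  let ?jac = "\<lambda>x. \<chi> i j. D i j x"
  have ax: "bounded_linear (\<lambda>z. axis i z :: complex ^ 'n)" for i
    by (simp add: linear_conv_bounded_linear[symmetric] linear_iff vec_eq_iff axis_def)
  have sum_axis: "(\<Sum>i\<in>UNIV. axis i (f i)) = (\<chi> i. f i)" for f :: "'n \<Rightarrow> complex"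
    by (simp add: vec_eq_iff axis_def)
  have "(F has_derivative (\<lambda>h. ?jac x *v h)) (at x)" for x
  proof -
    have "((\<lambda>x. \<Sum>i\<in>UNIV. axis i (F x $ i) :: complex ^ 'n) has_derivative
        (\<lambda>h. \<Sum>i\<in>UNIV. axis i (\<Sum>j\<in>UNIV. D i j x * h $ j))) (at x)"
      by (intro has_derivative_sum bounded_linear.has_derivative[OF ax] D)
    then show ?thesis by (simp add: sum_axis matrix_vector_mult_def)
  qed
  then show ?thesis
    by (intro exI[of _ ?jac]) (unfold_locales, simp_all add: F D)
qed

section \<open>The Jacobian and first-order interpolation at six points\<close>

definition jacobian :: "param \<Rightarrow> complex ^ (6 \<times> (2 + 3)) ^ (6 \<times> (2 + 3))" where
  "jacobian = (SOME jac. polynomial_map waring_map jac)"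

interpretation waring: polynomial_map waring_map jacobian
  unfolding jacobian_def by (rule someI_ex[OF polynomial_map_ex[OF cpoly_waring_map]])

text \<open>Obtained by differentiating \<open>form_waring_map\<close> along a line. It identifies
  the transposed Jacobian with the map from (3,1)-forms to their first-order data at the six points,
  so that regularity means unique interpolation of these data.\<close>

lemma jet_pairing:
  "(\<Sum>c\<in>UNIV. g c * (jacobian x *v y) $ c) = (\<Sum>i\<in>UNIV. DD (form g) (pl x i) (pv x i) (dl y i) (pv y i))"
proof -
  let ?f = "\<lambda>t. \<Sum>c\<in>UNIV. g c * waring_map (x + t *s y) $ c"
  have line: "((\<lambda>t. x + t *s y) has_derivative (\<lambda>t. t *s y)) (at 0)"
  proof -
    have "bounded_linear (\<lambda>t. t *s y)"
      by (simp add: linear_conv_bounded_linear[symmetric] linear_iff vec_eq_iff distrib_right)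
    from bounded_linear.has_derivative[OF this has_derivative_ident]
    show ?thesis by (auto intro!: derivative_eq_intros)
  qed
  have "((\<lambda>t. waring_map (x + t *s y)) has_derivative (\<lambda>t. jacobian x *v (t *s y))) (at 0)"
    using has_derivative_compose[OF line, of waring_map "\<lambda>h. jacobian x *v h"] waring.deriv_F[of x] by simp
  then have "(?f has_derivative (\<lambda>t. \<Sum>c\<in>UNIV. g c * (jacobian x *v (t *s y)) $ c)) (at 0)"
    by (intro has_derivative_sum has_derivative_mult_right bounded_linear.has_derivative[OF bounded_linear_vec_nth])
  moreover have "(\<lambda>t. \<Sum>c\<in>UNIV. g c * (jacobian x *v (t *s y)) $ c) =
      (*) (\<Sum>c\<in>UNIV. g c * (jacobian x *v y) $ c)"
    by (simp add: fun_eq_iff matrix_vector_mult_def sum_distrib_left sum_distrib_right mult_ac)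
  ultimately have 1: "(?f has_field_derivative (\<Sum>c\<in>UNIV. g c * (jacobian x *v y) $ c)) (at 0)"
    by (simp add: has_field_derivative_def)
  have "((\<lambda>t. \<Sum>i\<in>UNIV. form g (pl x i + t *s dl y i) (pv x i + t *s pv y i)) has_field_derivative
      (\<Sum>i\<in>UNIV. DD (form g) (pl x i) (pv x i) (dl y i) (pv y i))) (at 0)"
    by (intro DERIV_sum DD_has_derivative[OF bih_form])
  then have 2: "(?f has_field_derivative (\<Sum>i\<in>UNIV. DD (form g) (pl x i) (pv x i) (dl y i) (pv y i))) (at 0)"
    unfolding form_waring_map pl_line .
  show ?thesis using 1 2 by (rule DERIV_unique)
qed

lemma jet_inj_param:
  assumes "det (jacobian x) \<noteq> 0" and X: "bih 3 1 X"
    and z: "\<And>j h k. DD X (pl x j) (pv x j) h k = 0"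
  shows "X a b = 0"
proof -
  obtain g where g: "X = form g" by (rule form_ex[OF X])
  obtain B where B: "jacobian x ** B = mat 1" using waring.inverse_matrix[OF assms(1)] by blast
  have "g c = 0" for c
  proof -
    have "0 = (\<Sum>c'\<in>UNIV. g c' * (jacobian x *v (B *v axis c 1)) $ c')"
      unfolding jet_pairing using z by (simp add: g)
    also have "\<dots> = (\<Sum>c'\<in>UNIV. g c' * axis c 1 $ c')" by (simp add: matrix_vector_mul_assoc B)
    also have "\<dots> = g c" by (simp add: axis_def if_distrib[of "\<lambda>x. _ * x"] cong: if_cong)
    finally show ?thesis by simp
  qed
  then show ?thesis by (simp add: g form_def)
qed

lemma lin_dl:
  assumes "lin f"
  obtains w where "\<And>y. f (dl y i) = (\<Sum>c\<in>UNIV. w c * y $ c)"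
proof -
  obtain c where c: "\<And>x. f x = (\<Sum>a\<in>UNIV. c a * x $ a)" using assms unfolding lin_def by blast
  have "f (dl y i) = (\<Sum>z\<in>UNIV. (if z = (i, Inl 1) then c 2 else if z = (i, Inl 2) then c 3 else 0) * y $ z)" for y
  proof -
    have "(\<Sum>z\<in>UNIV. (if z = (i, Inl 1) then c 2 else if z = (i, Inl 2) then c 3 else 0) * y $ z) =
        (\<Sum>z\<in>{(i, Inl 1), (i, Inl 2)}. (if z = (i, Inl 1) then c 2 else if z = (i, Inl 2) then c 3 else 0) * y $ z)"
      by (intro sum.mono_neutral_right) auto
    then show ?thesis by (simp add: c sum_3 dl_def)
  qed
  then show ?thesis by (rule that)
qed

lemma jet_surj_param:
  assumes "det (jacobian x) \<noteq> 0" and f: "lin f" "f (pl x i) = 0"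
  shows "\<exists>X. bih 3 1 X \<and> (\<forall>j h k. DD X (pl x j) (pv x j) h k = (if j = i then f h else 0))"
proof -
  obtain w where w: "\<And>y. f (dl y i) = (\<Sum>c\<in>UNIV. w c * y $ c)" by (rule lin_dl[OF f(1)]) (rule that; assumption)
  obtain B where B: "B ** jacobian x = mat 1" using waring.inverse_matrix[OF assms(1)] by blast
  \<comment> \<open>The linear functional \<open>f (dl y i)\<close> of \<open>y\<close>, pulled back
    along the inverse of the Jacobian.\<close>
  define g where "g = (\<lambda>c'. \<Sum>c\<in>UNIV. w c * B $ c $ c')"
  have pair: "(\<Sum>j\<in>UNIV. DD (form g) (pl x j) (pv x j) (dl y j) (pv y j)) = f (dl y i)" for y
  proof -
    have "(\<Sum>c'\<in>UNIV. g c' * (jacobian x *v y) $ c') = (\<Sum>c\<in>UNIV. w c * (B *v (jacobian x *v y)) $ c)"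
      unfolding g_def matrix_vector_mult_def[of B] vec_lambda_beta sum_distrib_left sum_distrib_right
      by (subst sum.swap) (simp add: mult.assoc)
    also have "\<dots> = f (dl y i)" by (simp add: matrix_vector_mul_assoc B w)
    finally show ?thesis by (simp add: jet_pairing)
  qed
  have chart: "DD (form g) (pl x j) (pv x j) h k = (if j = i then f h else 0)" if h: "h $ 1 = 0" for j h k
  proof -
    define y :: param where "y = (\<chi> c. if fst c = j then (case snd c of Inl a \<Rightarrow> if a = 1 then h $ 2 else h $ 3 | Inr d \<Rightarrow> k $ d) else 0)"
    have dl: "dl y n = (if n = j then h else 0)" and pv: "pv y n = (if n = j then k else 0)" for n
      using h by (simp_all add: y_def dl_def pv_def vec_eq_iff forall_3)
    have "(\<Sum>n\<in>UNIV. DD (form g) (pl x n) (pv x n) (dl y n) (pv y n)) = DD (form g) (pl x j) (pv x j) h k"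
    proof -
      have "DD (form g) (pl x n) (pv x n) (dl y n) (pv y n) = (if n = j then DD (form g) (pl x j) (pv x j) h k else 0)" for n
        using DD_linear(2)[OF bih_form, of g "pl x n" "pv x n" 0 0 0] by (simp add: dl pv)
      then show ?thesis by simp
    qed
    then show ?thesis using pair[of y] lin_zero[OF f(1)] by (auto simp: dl)
  qed
  have "DD (form g) (pl x j) (pv x j) h k = (if j = i then f h else 0)" for j h k
  proof -
    \<comment> \<open>\<open>chart\<close> covers directions with first coordinate 0 only;
      \<open>h\<close> differs from such a direction by a multiple of \<open>pl x j\<close>, along
      which the derivative is zero by Euler's identity.\<close>
    let ?h = "h + (- h $ 1) *s pl x j"
    have "form g (pl x j) (pv x j) = 0"
      using chart[of 0 j "pv x j"] DD_euler(2)[OF bih_form, of g "pl x j" "pv x j"] lin_zero[OF f(1)]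
      by (auto split: if_splits)
    then have e: "DD (form g) (pl x j) (pv x j) (pl x j) 0 = 0"
      using DD_euler(1)[OF bih_form, of g "pl x j" "pv x j"] by simp
    have "h = ?h + h $ 1 *s pl x j" "k = k + h $ 1 *s 0" by (simp_all add: vec_eq_iff)
    then have "DD (form g) (pl x j) (pv x j) h k =
        DD (form g) (pl x j) (pv x j) (?h + h $ 1 *s pl x j) (k + h $ 1 *s 0)" by simp
    also have "\<dots> = DD (form g) (pl x j) (pv x j) ?h k"
      unfolding DD_linear(1)[OF bih_form] DD_linear(2)[OF bih_form] e by simp
    also have "\<dots> = (if j = i then f ?h else 0)" by (rule chart) (simp add: pl_def)
    also have "\<dots> = (if j = i then f h else 0)"
      using f(2) by (simp only: lin_add[OF f(1)] lin_scale[OF f(1)]) simp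
    finally show ?thesis .
  qed
  then show ?thesis using bih_form by blast
qed

lemma det_jacobian_nonzeroI:
  assumes "\<And>g. (\<And>y. (\<Sum>i\<in>UNIV. DD (form g) (pl x i) (pv x i) (dl y i) (pv y i)) = 0) \<Longrightarrow> g = (\<lambda>_. 0)"
  shows "det (jacobian x) \<noteq> 0"
proof -
  have "w = 0" if w: "Finite_Cartesian_Product.transpose (jacobian x) *v w = 0" for w
  proof -
    have "(\<Sum>c\<in>UNIV. w $ c * (jacobian x *v y) $ c) = (\<Sum>c\<in>UNIV. (Finite_Cartesian_Product.transpose (jacobian x) *v w) $ c * y $ c)" for y
      unfolding matrix_vector_mult_def vec_lambda_beta sum_distrib_left sum_distrib_right Finite_Cartesian_Product.transpose_def
      by (subst sum.swap) (simp add: mult_ac)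
    then have "(\<lambda>c. w $ c) = (\<lambda>_. 0)"
      using assms[of "\<lambda>c. w $ c"] w by (simp add: jet_pairing)
    then show ?thesis by (simp add: vec_eq_iff fun_eq_iff)
  qed
  then have "invertible (Finite_Cartesian_Product.transpose (jacobian x))"
    unfolding invertible_left_inverse matrix_left_invertible_ker by blast
  then show ?thesis
    by (simp add: invertible_det_nz)
qed

section \<open>An example with two decompositions\<close>

definition cub :: "(nat \<Rightarrow> nat \<Rightarrow> complex) \<Rightarrow> complex \<Rightarrow> complex \<Rightarrow> complex" where
  "cub c a b = c 0 0 + c 0 1 * b + c 0 2 * b ^ 2 + c 0 3 * b ^ 3 + c 1 0 * a + c 1 1 * a * b
    + c 1 2 * a * b ^ 2 + c 2 0 * a ^ 2 + c 2 1 * a ^ 2 * b + c 3 0 * a ^ 3"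

definition cub_a :: "(nat \<Rightarrow> nat \<Rightarrow> complex) \<Rightarrow> complex \<Rightarrow> complex \<Rightarrow> complex" where
  "cub_a c a b = c 1 0 + c 1 1 * b + c 1 2 * b ^ 2 + 2 * c 2 0 * a + 2 * c 2 1 * a * b + 3 * c 3 0 * a ^ 2"

definition cub_b :: "(nat \<Rightarrow> nat \<Rightarrow> complex) \<Rightarrow> complex \<Rightarrow> complex \<Rightarrow> complex" where
  "cub_b c a b = c 0 1 + 2 * c 0 2 * b + 3 * c 0 3 * b ^ 2 + c 1 1 * a + 2 * c 1 2 * a * b + c 2 1 * a ^ 2"

lemma pairs_le_3:
  fixes q r :: nat
  assumes "q + r \<le> 3"
  shows "q = 0 \<and> (r = 0 \<or> r = 1 \<or> r = 2 \<or> r = 3) \<or> q = 1 \<and> (r = 0 \<or> r = 1 \<or> r = 2) \<or>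
    q = 2 \<and> (r = 0 \<or> r = 1) \<or> q = 3 \<and> r = 0"
  using assms by arith

lemmas cub_defs = cub_def cub_a_def cub_b_def

text \<open>\<open>cjqr\<close> is the coefficient of \<open>a^q b^r\<close> in the
  \<open>j\<close>-th cubic, and the 30 equations say that a (3,1)-form has zero first-order data at
  the six points of \<open>example_A\<close>. Each \<open>e\<close> fact solves for one unknown, and
  the \<open>z\<close> facts substitute back.\<close>

lemma example_A_nondegenerate_real:
  fixes c100 c101 c102 c103 c110 c111 c112 c120 c121 c130 c200 c201 c202 c203 c210 c211 c212 c220
    c221 c230 c300 c301 c302 c303 c310 c311 c312 c320 c321 c330 :: real
  assumes "6 * c110 - 6 * c111 + 6 * c112 + 12 * c210 - 12 * c211 + 12 * c212 + 24 * c310 - 24 * c311 + 24 * c312 = 0"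
    "6 * c101 - 12 * c102 + 18 * c103 + 12 * c201 - 24 * c202 + 36 * c203 + 24 * c301 - 48 * c302 + 72 * c303 = 0"
    "c100 - c101 + c102 - c103 = 0"
    "c200 - c201 + c202 - c203 = 0"
    "c300 - c301 + c302 - c303 = 0"
    "2 * c110 + 2 * c111 + 2 * c112 + 4 * c210 + 4 * c211 + 4 * c212 + 24 * c310 + 24 * c311 + 24 * c312 = 0"
    "2 * c101 + 4 * c102 + 6 * c103 + 4 * c201 + 8 * c202 + 12 * c203 + 24 * c301 + 48 * c302 + 72 * c303 = 0"
    "c100 + c101 + c102 + c103 = 0"
    "c200 + c201 + c202 + c203 = 0"
    "c300 + c301 + c302 + c303 = 0"
    "- 2 * c110 + 2 * c111 - 2 * c112 - 4 * c120 + 4 * c121 - 6 * c130 + 4 * c310 - 4 * c311 + 4 * c312 + 8 * c320 - 8 * c321 + 12 * c330 = 0"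
    "- 2 * c101 + 4 * c102 - 6 * c103 - 2 * c111 + 4 * c112 - 2 * c121 + 4 * c301 - 8 * c302 + 12 * c303 + 4 * c311 - 8 * c312 + 4 * c321 = 0"
    "c100 - c101 + c102 - c103 + c110 - c111 + c112 + c120 - c121 + c130 = 0"
    "c200 - c201 + c202 - c203 + c210 - c211 + c212 + c220 - c221 + c230 = 0"
    "c300 - c301 + c302 - c303 + c310 - c311 + c312 + c320 - c321 + c330 = 0"
    "2 * c110 + 2 * c111 + 2 * c112 + 4 * c120 + 4 * c121 + 6 * c130 + 4 * c310 + 4 * c311 + 4 * c312 + 8 * c320 + 8 * c321 + 12 * c330 = 0"
    "2 * c101 + 4 * c102 + 6 * c103 + 2 * c111 + 4 * c112 + 2 * c121 + 4 * c301 + 8 * c302 + 12 * c303 + 4 * c311 + 8 * c312 + 4 * c321 = 0"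
    "c100 + c101 + c102 + c103 + c110 + c111 + c112 + c120 + c121 + c130 = 0"
    "c200 + c201 + c202 + c203 + c210 + c211 + c212 + c220 + c221 + c230 = 0"
    "c300 + c301 + c302 + c303 + c310 + c311 + c312 + c320 + c321 + c330 = 0"
    "6 * c210 - 12 * c220 + 18 * c230 + 6 * c310 - 12 * c320 + 18 * c330 = 0"
    "6 * c201 - 6 * c211 + 6 * c221 + 6 * c301 - 6 * c311 + 6 * c321 = 0"
    "c100 - c110 + c120 - c130 = 0"
    "c200 - c210 + c220 - c230 = 0"
    "c300 - c310 + c320 - c330 = 0"
    "- 8 * c210 + 8 * c211 - 8 * c212 + 16 * c220 - 16 * c221 - 24 * c230 = 0"
    "- 8 * c201 + 16 * c202 - 24 * c203 + 8 * c211 - 16 * c212 - 8 * c221 = 0"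
    "c100 - c101 + c102 - c103 - c110 + c111 - c112 + c120 - c121 - c130 = 0"
    "c200 - c201 + c202 - c203 - c210 + c211 - c212 + c220 - c221 - c230 = 0"
    "c300 - c301 + c302 - c303 - c310 + c311 - c312 + c320 - c321 - c330 = 0"
  shows "c100 = 0 \<and> c101 = 0 \<and> c102 = 0 \<and> c103 = 0 \<and> c110 = 0 \<and>
    c111 = 0 \<and> c112 = 0 \<and> c120 = 0 \<and> c121 = 0 \<and> c130 = 0 \<and>
    c200 = 0 \<and> c201 = 0 \<and> c202 = 0 \<and> c203 = 0 \<and> c210 = 0 \<and>
    c211 = 0 \<and> c212 = 0 \<and> c220 = 0 \<and> c221 = 0 \<and> c230 = 0 \<and>
    c300 = 0 \<and> c301 = 0 \<and> c302 = 0 \<and> c303 = 0 \<and> c310 = 0 \<and>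
    c311 = 0 \<and> c312 = 0 \<and> c320 = 0 \<and> c321 = 0 \<and> c330 = 0"
proof -
  have e1: "c100 = c101 - c102 + c103"
    using assms(3) by linarith
  have e2: "c101 = - c103"
    using assms(8) e1 by linarith
  have e3: "c200 = c201 - c202 + c203"
    using assms(4) by linarith
  have e4: "c203 = - c201"
    using assms(9) e3 by linarith
  have e5: "c300 = c301 - c302 + c303"
    using assms(5) by linarith
  have e6: "c303 = - c301"
    using assms(10) e5 by linarith
  have e7: "c102 = - c110 + c120 - c130"
    using assms(23) e1 e2 by linarith
  have e8: "c202 = - c210 + c220 - c230"
    using assms(24) e3 e4 by linarith
  have e9: "c302 = - c310 + c320 - c330"
    using assms(25) e5 e6 by linarith
  have e10: "c121 = c110 - c111 + c112 + c120 + c130"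
    using assms(13) e1 by linarith
  have e11: "c120 = - c110 - c112 - c130"
    using assms(18) e1 e2 e10 by linarith
  have e12: "c111 = c110 + c112 + c130"
    using assms(28) e1 e10 by linarith
  have e13: "c221 = c210 - c211 + c212 + c220 + c230"
    using assms(14) e3 by linarith
  have e14: "c220 = - c210 - c212 - c230"
    using assms(19) e3 e4 e13 by linarith
  have e15: "c211 = c210 + c212 + 5 / 3 * c230"
    using assms(26) e13 by linarith
  have e16: "c230 = 0"
    using assms(29) e3 e13 e15 by linarith
  have e17: "c201 = c210 + c212"
    using assms(27) e4 e8 e13 e14 e15 e16 by linarith
  have e18: "c130 = 4 * c310 - 4 * c311 + 4 * c312"
    using assms(1) e12 e15 e16 by linarith
  have e19: "c212 = - 3 / 2 * c210 - 1 / 2 * c310 + c320 - 3 / 2 * c330"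
    using assms(21) e14 e16 by linarith
  have e20: "c321 = - 3 / 2 * c310 + 3 / 2 * c311 - 3 / 2 * c312 + c320 + 3 / 2 * c330"
    using assms(11) e10 e12 e18 by linarith
  have e21: "c330 = 5 * c310 - 5 * c311 + 5 * c312"
    using assms(15) e5 e20 by linarith
  have e22: "c310 = c311 - c312"
    using assms(30) e5 e20 e21 by linarith
  have e23: "c320 = - c311"
    using assms(20) e5 e6 e20 e21 e22 by linarith
  have e24: "c112 = - c110 - 2 * c311"
    using assms(16) e10 e11 e12 e20 e21 e22 e23 by linarith
  have e25: "c210 = 7 * c311 + c312"
    using assms(6) e12 e15 e16 e18 e19 e21 e22 e23 e24 by linarith
  have e26: "c301 = - 3 * c311"
    using assms(22) e13 e14 e15 e16 e17 e19 e20 e21 e22 e25 by linarith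
  have e27: "c103 = - c110 - 32 * c311 + 2 * c312"
    using assms(2) e2 e4 e6 e7 e8 e9 e11 e14 e16 e17 e18 e21 e22 e23 e24 e25 e26 by linarith
  have e28: "c110 = - 6 * c311 + 6 * c312"
    using assms(7) e2 e4 e6 e7 e8 e9 e11 e14 e16 e17 e18 e19 e21 e22 e23 e24 e26 e27 by linarith
  have e29: "c312 = 4 * c311"
    using assms(12) e2 e6 e7 e9 e10 e11 e18 e20 e21 e22 e23 e26 e27 e28 by linarith
  have e30: "c311 = 0"
    using assms(17) e2 e6 e7 e9 e10 e11 e18 e20 e21 e22 e23 e26 e27 e28 e29 by linarith
  note z30 = e30
  note z29 = e29[unfolded z30, simplified]
  note z28 = e28[unfolded z30 z29, simplified]
  note z27 = e27[unfolded z28 z30 z29, simplified]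
  note z26 = e26[unfolded z30, simplified]
  note z25 = e25[unfolded z30 z29, simplified]
  note z24 = e24[unfolded z28 z30, simplified]
  note z23 = e23[unfolded z30, simplified]
  note z22 = e22[unfolded z30 z29, simplified]
  note z21 = e21[unfolded z22 z30 z29, simplified]
  note z20 = e20[unfolded z22 z30 z29 z23 z21, simplified]
  note z19 = e19[unfolded z25 z22 z23 z21, simplified]
  note z18 = e18[unfolded z22 z30 z29, simplified]
  note z17 = e17[unfolded z19 z25, simplified]
  note z16 = e16
  note z15 = e15[unfolded z25 z19 z16, simplified]
  note z14 = e14[unfolded z25 z19 z16, simplified]
  note z13 = e13[unfolded z25 z15 z19 z14 z16, simplified]
  note z12 = e12[unfolded z28 z24 z18, simplified]
  note z11 = e11[unfolded z28 z24 z18, simplified]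
  note z10 = e10[unfolded z28 z12 z24 z11 z18, simplified]
  note z9 = e9[unfolded z22 z23 z21, simplified]
  note z8 = e8[unfolded z25 z14 z16, simplified]
  note z7 = e7[unfolded z28 z11 z18, simplified]
  note z6 = e6[unfolded z26, simplified]
  note z5 = e5[unfolded z26 z9 z6, simplified]
  note z4 = e4[unfolded z17, simplified]
  note z3 = e3[unfolded z17 z8 z4, simplified]
  note z2 = e2[unfolded z27, simplified]
  note z1 = e1[unfolded z2 z7 z27, simplified]
  show ?thesis
    by (intro conjI z1 z2 z3 z4 z5 z6 z7 z8 z9 z10 z11 z12 z13 z14 z15 z16 z17 z18 z19 z20 z21 z22 z23 z24 z25
      z26 z27 z28 z29 z30)
qed

text \<open>The system has real coefficients, so the real and the imaginary parts of a solution
  solve it separately.\<close>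

lemma example_A_nondegenerate:
  fixes c :: "3 \<Rightarrow> nat \<Rightarrow> nat \<Rightarrow> complex"
  assumes "\<And>j. cub (c j) 0 (- 1) = 0"
    "6 * cub_a (c 1) 0 (- 1) + 12 * cub_a (c 2) 0 (- 1) + 24 * cub_a (c 3) 0 (- 1) = 0"
    "6 * cub_b (c 1) 0 (- 1) + 12 * cub_b (c 2) 0 (- 1) + 24 * cub_b (c 3) 0 (- 1) = 0"
    "\<And>j. cub (c j) 0 1 = 0"
    "2 * cub_a (c 1) 0 1 + 4 * cub_a (c 2) 0 1 + 24 * cub_a (c 3) 0 1 = 0"
    "2 * cub_b (c 1) 0 1 + 4 * cub_b (c 2) 0 1 + 24 * cub_b (c 3) 0 1 = 0"
    "\<And>j. cub (c j) 1 (- 1) = 0"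
    "(- 2) * cub_a (c 1) 1 (- 1) + 0 * cub_a (c 2) 1 (- 1) + 4 * cub_a (c 3) 1 (- 1) = 0"
    "(- 2) * cub_b (c 1) 1 (- 1) + 0 * cub_b (c 2) 1 (- 1) + 4 * cub_b (c 3) 1 (- 1) = 0"
    "\<And>j. cub (c j) 1 1 = 0"
    "2 * cub_a (c 1) 1 1 + 0 * cub_a (c 2) 1 1 + 4 * cub_a (c 3) 1 1 = 0"
    "2 * cub_b (c 1) 1 1 + 0 * cub_b (c 2) 1 1 + 4 * cub_b (c 3) 1 1 = 0"
    "\<And>j. cub (c j) (- 1) 0 = 0"
    "0 * cub_a (c 1) (- 1) 0 + 6 * cub_a (c 2) (- 1) 0 + 6 * cub_a (c 3) (- 1) 0 = 0"
    "0 * cub_b (c 1) (- 1) 0 + 6 * cub_b (c 2) (- 1) 0 + 6 * cub_b (c 3) (- 1) 0 = 0"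
    "\<And>j. cub (c j) (- 1) (- 1) = 0"
    "0 * cub_a (c 1) (- 1) (- 1) + (- 8) * cub_a (c 2) (- 1) (- 1) + 0 * cub_a (c 3) (- 1) (- 1) = 0"
    "0 * cub_b (c 1) (- 1) (- 1) + (- 8) * cub_b (c 2) (- 1) (- 1) + 0 * cub_b (c 3) (- 1) (- 1) = 0"
  shows "q + r \<le> 3 \<Longrightarrow> c j q r = 0"
proof -
  have all: "f (c 1 0 0) = 0 \<and> f (c 1 0 1) = 0 \<and> f (c 1 0 2) = 0 \<and> f (c 1 0 3) = 0 \<and>
    f (c 1 1 0) = 0 \<and> f (c 1 1 1) = 0 \<and> f (c 1 1 2) = 0 \<and> f (c 1 2 0) = 0 \<and>
    f (c 1 2 1) = 0 \<and> f (c 1 3 0) = 0 \<and> f (c 2 0 0) = 0 \<and> f (c 2 0 1) = 0 \<and>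
    f (c 2 0 2) = 0 \<and> f (c 2 0 3) = 0 \<and> f (c 2 1 0) = 0 \<and> f (c 2 1 1) = 0 \<and>
    f (c 2 1 2) = 0 \<and> f (c 2 2 0) = 0 \<and> f (c 2 2 1) = 0 \<and> f (c 2 3 0) = 0 \<and>
    f (c 3 0 0) = 0 \<and> f (c 3 0 1) = 0 \<and> f (c 3 0 2) = 0 \<and> f (c 3 0 3) = 0 \<and>
    f (c 3 1 0) = 0 \<and> f (c 3 1 1) = 0 \<and> f (c 3 1 2) = 0 \<and> f (c 3 2 0) = 0 \<and>
    f (c 3 2 1) = 0 \<and> f (c 3 3 0) = 0"
    if f: "f = Re \<or> f = Im" for f
  proof -
    note E = assms[THEN arg_cong[where f = f]]
    show ?thesis
      apply (rule example_A_nondegenerate_real)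
      subgoal using E(2) f by (auto simp: cub_defs)
      subgoal using E(3) f by (auto simp: cub_defs)
      subgoal using E(1)[of 1] f by (auto simp: cub_defs)
      subgoal using E(1)[of 2] f by (auto simp: cub_defs)
      subgoal using E(1)[of 3] f by (auto simp: cub_defs)
      subgoal using E(5) f by (auto simp: cub_defs)
      subgoal using E(6) f by (auto simp: cub_defs)
      subgoal using E(4)[of 1] f by (auto simp: cub_defs)
      subgoal using E(4)[of 2] f by (auto simp: cub_defs)
      subgoal using E(4)[of 3] f by (auto simp: cub_defs)
      subgoal using E(8) f by (auto simp: cub_defs)
      subgoal using E(9) f by (auto simp: cub_defs)
      subgoal using E(7)[of 1] f by (auto simp: cub_defs)
      subgoal using E(7)[of 2] f by (auto simp: cub_defs)
      subgoal using E(7)[of 3] f by (auto simp: cub_defs)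
      subgoal using E(11) f by (auto simp: cub_defs)
      subgoal using E(12) f by (auto simp: cub_defs)
      subgoal using E(10)[of 1] f by (auto simp: cub_defs)
      subgoal using E(10)[of 2] f by (auto simp: cub_defs)
      subgoal using E(10)[of 3] f by (auto simp: cub_defs)
      subgoal using E(14) f by (auto simp: cub_defs)
      subgoal using E(15) f by (auto simp: cub_defs)
      subgoal using E(13)[of 1] f by (auto simp: cub_defs)
      subgoal using E(13)[of 2] f by (auto simp: cub_defs)
      subgoal using E(13)[of 3] f by (auto simp: cub_defs)
      subgoal using E(17) f by (auto simp: cub_defs)
      subgoal using E(18) f by (auto simp: cub_defs)
      subgoal using E(16)[of 1] f by (auto simp: cub_defs)
      subgoal using E(16)[of 2] f by (auto simp: cub_defs)
      subgoal using E(16)[of 3] f by (auto simp: cub_defs)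
      done
  qed
  show "c j q r = 0" if "q + r \<le> 3"
    using pairs_le_3[OF that] exhaust_3[of j] all[of Re] all[of Im] unfolding complex_eq_iff
    by (elim disjE conjE) simp_all
qed

text \<open>The corresponding system for the six points of \<open>example_B\<close>.\<close>

lemma example_B_nondegenerate_real:
  fixes c100 c101 c102 c103 c110 c111 c112 c120 c121 c130 c200 c201 c202 c203 c210 c211 c212 c220
    c221 c230 c300 c301 c302 c303 c310 c311 c312 c320 c321 c330 :: real
  assumes "2 * c110 - 4 * c111 + 8 * c112 + 4 * c210 - 8 * c211 + 16 * c212 = 0"
    "2 * c101 - 8 * c102 + 24 * c103 + 4 * c201 - 16 * c202 + 48 * c203 = 0"
    "c100 - 2 * c101 + 4 * c102 - 8 * c103 = 0"
    "c200 - 2 * c201 + 4 * c202 - 8 * c203 = 0"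
    "c300 - 2 * c301 + 4 * c302 - 8 * c303 = 0"
    "6 * c110 + 12 * c210 + 48 * c310 = 0"
    "6 * c101 + 12 * c201 + 48 * c301 = 0"
    "c100 = 0"
    "c200 = 0"
    "c300 = 0"
    "- c110 + 2 * c111 - 4 * c112 - 2 * c120 + 4 * c121 - 3 * c130 + 4 * c310 - 8 * c311 + 16 * c312 + 8 * c320 - 16 * c321 + 12 * c330 = 0"
    "- c101 + 4 * c102 - 12 * c103 - c111 + 4 * c112 - c121 + 4 * c301 - 16 * c302 + 48 * c303 + 4 * c311 - 16 * c312 + 4 * c321 = 0"
    "c100 - 2 * c101 + 4 * c102 - 8 * c103 + c110 - 2 * c111 + 4 * c112 + c120 - 2 * c121 + c130 = 0"
    "c200 - 2 * c201 + 4 * c202 - 8 * c203 + c210 - 2 * c211 + 4 * c212 + c220 - 2 * c221 + c230 = 0"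
    "c300 - 2 * c301 + 4 * c302 - 8 * c303 + c310 - 2 * c311 + 4 * c312 + c320 - 2 * c321 + c330 = 0"
    "c110 + 2 * c111 + 4 * c112 + 2 * c120 + 4 * c121 + 3 * c130 + 4 * c310 + 8 * c311 + 16 * c312 + 8 * c320 + 16 * c321 + 12 * c330 = 0"
    "c101 + 4 * c102 + 12 * c103 + c111 + 4 * c112 + c121 + 4 * c301 + 16 * c302 + 48 * c303 + 4 * c311 + 16 * c312 + 4 * c321 = 0"
    "c100 + 2 * c101 + 4 * c102 + 8 * c103 + c110 + 2 * c111 + 4 * c112 + c120 + 2 * c121 + c130 = 0"
    "c200 + 2 * c201 + 4 * c202 + 8 * c203 + c210 + 2 * c211 + 4 * c212 + c220 + 2 * c221 + c230 = 0"
    "c300 + 2 * c301 + 4 * c302 + 8 * c303 + c310 + 2 * c311 + 4 * c312 + c320 + 2 * c321 + c330 = 0"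
    "- 3 * c210 + 6 * c211 - 12 * c212 + 6 * c220 - 12 * c221 - 9 * c230 + 3 * c310 - 6 * c311 + 12 * c312 - 6 * c320 + 12 * c321 + 9 * c330 = 0"
    "- 3 * c201 + 12 * c202 - 36 * c203 + 3 * c211 - 12 * c212 - 3 * c221 + 3 * c301 - 12 * c302 + 36 * c303 - 3 * c311 + 12 * c312 + 3 * c321 = 0"
    "c100 - 2 * c101 + 4 * c102 - 8 * c103 - c110 + 2 * c111 - 4 * c112 + c120 - 2 * c121 - c130 = 0"
    "c200 - 2 * c201 + 4 * c202 - 8 * c203 - c210 + 2 * c211 - 4 * c212 + c220 - 2 * c221 - c230 = 0"
    "c300 - 2 * c301 + 4 * c302 - 8 * c303 - c310 + 2 * c311 - 4 * c312 + c320 - 2 * c321 - c330 = 0"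
    "c210 + 2 * c211 + 4 * c212 - 2 * c220 - 4 * c221 + 3 * c230 + 3 * c310 + 6 * c311 + 12 * c312 - 6 * c320 - 12 * c321 + 9 * c330 = 0"
    "c201 + 4 * c202 + 12 * c203 - c211 - 4 * c212 + c221 + 3 * c301 + 12 * c302 + 36 * c303 - 3 * c311 - 12 * c312 + 3 * c321 = 0"
    "c100 + 2 * c101 + 4 * c102 + 8 * c103 - c110 - 2 * c111 - 4 * c112 + c120 + 2 * c121 - c130 = 0"
    "c200 + 2 * c201 + 4 * c202 + 8 * c203 - c210 - 2 * c211 - 4 * c212 + c220 + 2 * c221 - c230 = 0"
    "c300 + 2 * c301 + 4 * c302 + 8 * c303 - c310 - 2 * c311 - 4 * c312 + c320 + 2 * c321 - c330 = 0"
  shows "c100 = 0 \<and> c101 = 0 \<and> c102 = 0 \<and> c103 = 0 \<and> c110 = 0 \<and>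
    c111 = 0 \<and> c112 = 0 \<and> c120 = 0 \<and> c121 = 0 \<and> c130 = 0 \<and>
    c200 = 0 \<and> c201 = 0 \<and> c202 = 0 \<and> c203 = 0 \<and> c210 = 0 \<and>
    c211 = 0 \<and> c212 = 0 \<and> c220 = 0 \<and> c221 = 0 \<and> c230 = 0 \<and>
    c300 = 0 \<and> c301 = 0 \<and> c302 = 0 \<and> c303 = 0 \<and> c310 = 0 \<and>
    c311 = 0 \<and> c312 = 0 \<and> c320 = 0 \<and> c321 = 0 \<and> c330 = 0"
proof -
  have e1: "c100 = 0"
    using assms(8) by linarith
  have e2: "c200 = 0"
    using assms(9) by linarith
  have e3: "c300 = 0"
    using assms(10) by linarith
  have e4: "c102 = 1 / 2 * c101 + 2 * c103"
    using assms(3) e1 by linarith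
  have e5: "c202 = 1 / 2 * c201 + 2 * c203"
    using assms(4) e2 by linarith
  have e6: "c302 = 1 / 2 * c301 + 2 * c303"
    using assms(5) e3 by linarith
  have e7: "c110 = - 2 * c210 - 8 * c310"
    using assms(6) by linarith
  have e8: "c101 = - 2 * c201 - 8 * c301"
    using assms(7) by linarith
  have e9: "c103 = - 2 * c203 - 2 * c301"
    using assms(2) e4 e5 e8 by linarith
  have e10: "c111 = 2 * c112 - 2 * c211 + 4 * c212 - 4 * c310"
    using assms(1) e7 by linarith
  have e11: "c120 = 2 * c121 - c130 + 2 * c210 - 4 * c211 + 8 * c212"
    using assms(13) e1 e4 e7 e10 by linarith
  have e12: "c130 = 2 * c210 - 4 * c211 + 8 * c212"
    using assms(23) e1 e4 e7 e10 e11 by linarith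
  have e13: "c220 = - c210 + 2 * c211 - 4 * c212 + 2 * c221 - c230"
    using assms(14) e2 e5 by linarith
  have e14: "c221 = - c201 - 4 * c203 - c211"
    using assms(19) e2 e5 e13 by linarith
  have e15: "c230 = - c210 + 2 * c211 - 4 * c212"
    using assms(24) e2 e5 e13 by linarith
  have e16: "c211 = 0"
    using assms(29) e2 e5 e13 e14 e15 by linarith
  have e17: "c320 = - c310 + 2 * c311 - 4 * c312 + 2 * c321 - c330"
    using assms(15) e3 e6 by linarith
  have e18: "c303 = - 1 / 4 * c301 - 1 / 4 * c311 - 1 / 4 * c321"
    using assms(20) e3 e6 e17 by linarith
  have e19: "c330 = - c310 + 2 * c311 - 4 * c312"
    using assms(25) e3 e6 e17 by linarith
  have e20: "c311 = 0"
    using assms(30) e3 e6 e17 e18 e19 by linarith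
  have e21: "c210 = - 4 * c212 - 2 * c310 - 8 * c312"
    using assms(11) e7 e10 e11 e12 e16 e17 e19 e20 by linarith
  have e22: "c310 = - 4 * c312"
    using assms(21) e13 e15 e16 e17 e19 e20 e21 by linarith
  have e23: "c321 = 1 / 3 * c201 + 4 / 3 * c203"
    using assms(26) e13 e14 e15 e16 e17 e19 e20 e21 e22 by linarith
  have e24: "c301 = c201 - 2 * c212 + 2 * c312"
    using assms(22) e5 e6 e14 e16 e18 e20 by linarith
  have e25: "c201 = c212 - 3 * c312"
    using assms(27) e5 e6 e14 e16 e18 e20 e23 e24 by linarith
  have e26: "c121 = 2 * c112 + 8 * c203 + 2 * c212 - 18 * c312"
    using assms(12) e4 e6 e8 e9 e10 e16 e18 e22 e24 e25 by linarith
  have e27: "c212 = c312"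
    using assms(28) e1 e4 e7 e8 e9 e10 e11 e12 e16 e22 e24 e25 e26 by linarith
  have e28: "c112 = - 10 * c312"
    using assms(18) e1 e4 e7 e8 e9 e10 e11 e16 e22 e24 e25 e26 e27 by linarith
  have e29: "c203 = 29 / 10 * c312"
    using assms(16) e7 e10 e11 e12 e16 e17 e19 e20 e21 e22 e23 e25 e26 e27 e28 by linarith
  have e30: "c312 = 0"
    using assms(17) e4 e6 e8 e9 e10 e16 e18 e20 e22 e23 e24 e25 e26 e27 e28 e29 by linarith
  note z30 = e30
  note z29 = e29[unfolded z30, simplified]
  note z28 = e28[unfolded z30, simplified]
  note z27 = e27[unfolded z30, simplified]
  note z26 = e26[unfolded z28 z30 z29 z27, simplified]
  note z25 = e25[unfolded z27 z30, simplified]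
  note z24 = e24[unfolded z25 z27 z30, simplified]
  note z23 = e23[unfolded z25 z29, simplified]
  note z22 = e22[unfolded z30, simplified]
  note z21 = e21[unfolded z22 z30 z27, simplified]
  note z20 = e20
  note z19 = e19[unfolded z22 z20 z30, simplified]
  note z18 = e18[unfolded z24 z20 z23, simplified]
  note z17 = e17[unfolded z22 z20 z30 z23 z19, simplified]
  note z16 = e16
  note z15 = e15[unfolded z21 z16 z27, simplified]
  note z14 = e14[unfolded z25 z29 z16, simplified]
  note z13 = e13[unfolded z21 z16 z27 z14 z15, simplified]
  note z12 = e12[unfolded z21 z16 z27, simplified]
  note z11 = e11[unfolded z26 z12 z21 z16 z27, simplified]
  note z10 = e10[unfolded z28 z16 z27 z22, simplified]
  note z9 = e9[unfolded z29 z24, simplified]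
  note z8 = e8[unfolded z25 z24, simplified]
  note z7 = e7[unfolded z21 z22, simplified]
  note z6 = e6[unfolded z24 z18, simplified]
  note z5 = e5[unfolded z25 z29, simplified]
  note z4 = e4[unfolded z8 z9, simplified]
  note z3 = e3
  note z2 = e2
  note z1 = e1
  show ?thesis
    by (intro conjI z1 z2 z3 z4 z5 z6 z7 z8 z9 z10 z11 z12 z13 z14 z15 z16 z17 z18 z19 z20 z21 z22 z23 z24 z25
      z26 z27 z28 z29 z30)
qed

lemma example_B_nondegenerate:
  fixes c :: "3 \<Rightarrow> nat \<Rightarrow> nat \<Rightarrow> complex"
  assumes "\<And>j. cub (c j) 0 (- 2) = 0"
    "2 * cub_a (c 1) 0 (- 2) + 4 * cub_a (c 2) 0 (- 2) + 0 * cub_a (c 3) 0 (- 2) = 0"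
    "2 * cub_b (c 1) 0 (- 2) + 4 * cub_b (c 2) 0 (- 2) + 0 * cub_b (c 3) 0 (- 2) = 0"
    "\<And>j. cub (c j) 0 0 = 0"
    "6 * cub_a (c 1) 0 0 + 12 * cub_a (c 2) 0 0 + 48 * cub_a (c 3) 0 0 = 0"
    "6 * cub_b (c 1) 0 0 + 12 * cub_b (c 2) 0 0 + 48 * cub_b (c 3) 0 0 = 0"
    "\<And>j. cub (c j) 1 (- 2) = 0"
    "(- 1) * cub_a (c 1) 1 (- 2) + 0 * cub_a (c 2) 1 (- 2) + 4 * cub_a (c 3) 1 (- 2) = 0"
    "(- 1) * cub_b (c 1) 1 (- 2) + 0 * cub_b (c 2) 1 (- 2) + 4 * cub_b (c 3) 1 (- 2) = 0"
    "\<And>j. cub (c j) 1 2 = 0"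
    "1 * cub_a (c 1) 1 2 + 0 * cub_a (c 2) 1 2 + 4 * cub_a (c 3) 1 2 = 0"
    "1 * cub_b (c 1) 1 2 + 0 * cub_b (c 2) 1 2 + 4 * cub_b (c 3) 1 2 = 0"
    "\<And>j. cub (c j) (- 1) (- 2) = 0"
    "0 * cub_a (c 1) (- 1) (- 2) + (- 3) * cub_a (c 2) (- 1) (- 2) + 3 * cub_a (c 3) (- 1) (- 2) = 0"
    "0 * cub_b (c 1) (- 1) (- 2) + (- 3) * cub_b (c 2) (- 1) (- 2) + 3 * cub_b (c 3) (- 1) (- 2) = 0"
    "\<And>j. cub (c j) (- 1) 2 = 0"
    "0 * cub_a (c 1) (- 1) 2 + 1 * cub_a (c 2) (- 1) 2 + 3 * cub_a (c 3) (- 1) 2 = 0"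
    "0 * cub_b (c 1) (- 1) 2 + 1 * cub_b (c 2) (- 1) 2 + 3 * cub_b (c 3) (- 1) 2 = 0"
  shows "q + r \<le> 3 \<Longrightarrow> c j q r = 0"
proof -
  have all: "f (c 1 0 0) = 0 \<and> f (c 1 0 1) = 0 \<and> f (c 1 0 2) = 0 \<and> f (c 1 0 3) = 0 \<and>
    f (c 1 1 0) = 0 \<and> f (c 1 1 1) = 0 \<and> f (c 1 1 2) = 0 \<and> f (c 1 2 0) = 0 \<and>
    f (c 1 2 1) = 0 \<and> f (c 1 3 0) = 0 \<and> f (c 2 0 0) = 0 \<and> f (c 2 0 1) = 0 \<and>
    f (c 2 0 2) = 0 \<and> f (c 2 0 3) = 0 \<and> f (c 2 1 0) = 0 \<and> f (c 2 1 1) = 0 \<and>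
    f (c 2 1 2) = 0 \<and> f (c 2 2 0) = 0 \<and> f (c 2 2 1) = 0 \<and> f (c 2 3 0) = 0 \<and>
    f (c 3 0 0) = 0 \<and> f (c 3 0 1) = 0 \<and> f (c 3 0 2) = 0 \<and> f (c 3 0 3) = 0 \<and>
    f (c 3 1 0) = 0 \<and> f (c 3 1 1) = 0 \<and> f (c 3 1 2) = 0 \<and> f (c 3 2 0) = 0 \<and>
    f (c 3 2 1) = 0 \<and> f (c 3 3 0) = 0"
    if f: "f = Re \<or> f = Im" for f
  proof -
    note E = assms[THEN arg_cong[where f = f]]
    show ?thesis
      apply (rule example_B_nondegenerate_real)
      subgoal using E(2) f by (auto simp: cub_defs)
      subgoal using E(3) f by (auto simp: cub_defs)
      subgoal using E(1)[of 1] f by (auto simp: cub_defs)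
      subgoal using E(1)[of 2] f by (auto simp: cub_defs)
      subgoal using E(1)[of 3] f by (auto simp: cub_defs)
      subgoal using E(5) f by (auto simp: cub_defs)
      subgoal using E(6) f by (auto simp: cub_defs)
      subgoal using E(4)[of 1] f by (auto simp: cub_defs)
      subgoal using E(4)[of 2] f by (auto simp: cub_defs)
      subgoal using E(4)[of 3] f by (auto simp: cub_defs)
      subgoal using E(8) f by (auto simp: cub_defs)
      subgoal using E(9) f by (auto simp: cub_defs)
      subgoal using E(7)[of 1] f by (auto simp: cub_defs)
      subgoal using E(7)[of 2] f by (auto simp: cub_defs)
      subgoal using E(7)[of 3] f by (auto simp: cub_defs)
      subgoal using E(11) f by (auto simp: cub_defs)
      subgoal using E(12) f by (auto simp: cub_defs)
      subgoal using E(10)[of 1] f by (auto simp: cub_defs)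
      subgoal using E(10)[of 2] f by (auto simp: cub_defs)
      subgoal using E(10)[of 3] f by (auto simp: cub_defs)
      subgoal using E(14) f by (auto simp: cub_defs)
      subgoal using E(15) f by (auto simp: cub_defs)
      subgoal using E(13)[of 1] f by (auto simp: cub_defs)
      subgoal using E(13)[of 2] f by (auto simp: cub_defs)
      subgoal using E(13)[of 3] f by (auto simp: cub_defs)
      subgoal using E(17) f by (auto simp: cub_defs)
      subgoal using E(18) f by (auto simp: cub_defs)
      subgoal using E(16)[of 1] f by (auto simp: cub_defs)
      subgoal using E(16)[of 2] f by (auto simp: cub_defs)
      subgoal using E(16)[of 3] f by (auto simp: cub_defs)
      done
  qed
  show "c j q r = 0" if "q + r \<le> 3"
    using pairs_le_3[OF that] exhaust_3[of j] all[of Re] all[of Im] unfolding complex_eq_iff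
    by (elim disjE conjE) simp_all
qed

text \<open>The coefficient of \<open>x_1^(3 - q - r) x_2^q x_3^r\<close> in the \<open>j\<close>-th component.\<close>

definition coeffs_of :: "(6 \<times> (2 + 3) \<Rightarrow> complex) \<Rightarrow> 3 \<Rightarrow> nat \<Rightarrow> nat \<Rightarrow> complex" where
  "coeffs_of g j q r = g (the_inv_into UNIV cubic_index (j, expo (3 - q - r) q r))"

lemma form_sum_deg3:
  "form g x u = (\<Sum>j\<in>UNIV. \<Sum>m\<in>deg3. g (the_inv_into UNIV cubic_index (j, m)) * (cmon x m * u $ j))"
proof -
  have inj: "inj cubic_index" using bij_cubic_index by (rule bij_betw_imp_inj_on)
  have "form g x u = (\<Sum>c\<in>UNIV. (\<lambda>(j, m). g (the_inv_into UNIV cubic_index (j, m)) * (cmon x m * u $ j)) (cubic_index c))"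
    unfolding form_def by (intro sum.cong refl) (simp add: case_prod_unfold the_inv_into_f_f[OF inj])
  also have "\<dots> = (\<Sum>(j, m)\<in>UNIV \<times> deg3. g (the_inv_into UNIV cubic_index (j, m)) * (cmon x m * u $ j))"
    by (rule sum.reindex_bij_betw[OF bij_cubic_index])
  finally show ?thesis by (simp add: sum.cartesian_product)
qed

lemma cmon_expo: "cmon x (expo p q r) = x $ 1 ^ p * x $ 2 ^ q * x $ 3 ^ r"
  by (simp add: cmon_def prod_3 lookup_expo)

lemma sum_atMost_3: "(\<Sum>a\<le>3. f a) = f 0 + f 1 + f 2 + f (3 :: nat)"
  by (simp add: numeral_3_eq_3 numeral_2_eq_2)

lemma sum_deg3_explicit:
  "(\<Sum>m\<in>deg3. f m) = f (expo 3 0 0) + f (expo 2 1 0) + f (expo 2 0 1) + f (expo 1 2 0) + f (expo 1 1 1)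
    + f (expo 1 0 2) + f (expo 0 3 0) + f (expo 0 2 1) + f (expo 0 1 2) + f (expo 0 0 3)"
  unfolding sum_deg3 sum_atMost_3 by (simp add: numeral_3_eq_3 numeral_2_eq_2 add_ac)

lemma form_chart:
  "form g (vector [1, a, b]) u = (\<Sum>j\<in>UNIV. u $ j * cub (coeffs_of g j) a b)"
  unfolding form_sum_deg3 sum_deg3_explicit cub_def coeffs_of_def
  by (intro sum.cong refl) (simp add: cmon_expo algebra_simps numeral_3_eq_3 numeral_2_eq_2)

lemma cub_derivative:
  "((\<lambda>t. cub c (a + t * h) (b + t * k)) has_field_derivative h * cub_a c a b + k * cub_b c a b) (at 0)"
  unfolding cub_defs
  by (rule DERIV_cong, (rule derivative_eq_intros refl)+) (simp add: algebra_simps power2_eq_square)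

lemma DD_form_chart:
  "DD (form g) (vector [1, a, b]) u (vector [0, h, h']) k =
    (\<Sum>j\<in>UNIV. k $ j * cub (coeffs_of g j) a b +
      u $ j * (h * cub_a (coeffs_of g j) a b + h' * cub_b (coeffs_of g j) a b))"
proof -
  have "vector [1, a, b] + t *s vector [0, h, h'] = (vector [1, a + t * h, b + t * h'] :: complex ^ 3)" for t
    by (simp add: vec_eq_iff forall_3)
  then have "form g (vector [1, a, b] + t *s vector [0, h, h']) (u + t *s k) =
      (\<Sum>j\<in>UNIV. (u $ j + t * k $ j) * cub (coeffs_of g j) (a + t * h) (b + t * h'))" for t
    by (simp add: form_chart)
  moreover have "((\<lambda>t. \<Sum>j\<in>UNIV. (u $ j + t * k $ j) * cub (coeffs_of g j) (a + t * h) (b + t * h')) has_field_derivative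
      (\<Sum>j\<in>UNIV. k $ j * cub (coeffs_of g j) a b +
      u $ j * (h * cub_a (coeffs_of g j) a b + h' * cub_b (coeffs_of g j) a b))) (at 0)"
  proof (intro DERIV_sum)
    fix j
    have "((\<lambda>t. u $ j + t * k $ j) has_field_derivative k $ j) (at 0)"
      by (auto intro!: derivative_eq_intros)
    from DERIV_mult[OF this cub_derivative[of "coeffs_of g j" a h b h']]
    show "((\<lambda>t. (u $ j + t * k $ j) * cub (coeffs_of g j) (a + t * h) (b + t * h')) has_field_derivative
      k $ j * cub (coeffs_of g j) a b + u $ j * (h * cub_a (coeffs_of g j) a b + h' * cub_b (coeffs_of g j) a b)) (at 0)"
      by (rule DERIV_cong) (simp add: algebra_simps)
  qed
  ultimately show ?thesis
    unfolding DD_def by (intro DERIV_imp_deriv) simp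
qed

definition chart_point :: "(6 \<Rightarrow> complex) \<Rightarrow> (6 \<Rightarrow> complex) \<Rightarrow> (6 \<Rightarrow> complex ^ 3) \<Rightarrow> param" where
  "chart_point a b w = (\<chi> c. case snd c of Inl e \<Rightarrow> if e = 1 then a (fst c) else b (fst c) | Inr d \<Rightarrow> w (fst c) $ d)"

lemma chart_point_simps:
  "pl (chart_point a b w) i = vector [1, a i, b i]" "dl (chart_point a b w) i = vector [0, a i, b i]"
  "pv (chart_point a b w) i = w i"
  by (simp_all add: chart_point_def pl_def dl_def pv_def vec_eq_iff)

text \<open>Moving the second component of a point tests the values of the three cubics there,
  moving the first tests their weighted partial derivatives: five conditions at each of six
  points.\<close>

lemma det_jacobian_chart_point:
  assumes "\<And>c. \<lbrakk>\<And>i j. cub (c j) (a i) (b i) = 0; \<And>i. (\<Sum>j\<in>UNIV. w i $ j * cub_a (c j) (a i) (b i)) = 0;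
      \<And>i. (\<Sum>j\<in>UNIV. w i $ j * cub_b (c j) (a i) (b i)) = 0\<rbrakk> \<Longrightarrow> (\<And>j q r. q + r \<le> 3 \<Longrightarrow> c j q r = 0)"
  shows "det (jacobian (chart_point a b w)) \<noteq> 0"
proof (rule det_jacobian_nonzeroI)
  fix g
  let ?x = "chart_point a b w"
  let ?c = "coeffs_of g"
  assume z: "\<And>y. (\<Sum>i\<in>UNIV. DD (form g) (pl ?x i) (pv ?x i) (dl y i) (pv y i)) = 0"
  have z': "(\<Sum>j\<in>UNIV. k $ j * cub (?c j) (a i) (b i) +
      w i $ j * (h * cub_a (?c j) (a i) (b i) + h' * cub_b (?c j) (a i) (b i))) = 0" for i h h' k
  proof -
    let ?y = "chart_point (\<lambda>n. if n = i then h else 0) (\<lambda>n. if n = i then h' else 0) (\<lambda>n. if n = i then k else 0)"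
    have "DD (form g) (pl ?x n) (pv ?x n) (dl ?y n) (pv ?y n) =
      (if n = i then DD (form g) (pl ?x i) (pv ?x i) (vector [0, h, h']) k else 0)" for n
      by (simp add: chart_point_simps DD_form_chart)
    then show ?thesis
      using z[of ?y] by (simp add: chart_point_simps DD_form_chart)
  qed
  have "?c j q r = 0" if "q + r \<le> 3" for j q r
  proof (rule assms[of ?c])
    show "cub (?c j) (a i) (b i) = 0" for i j
      using z'[where i = i and h = 0 and h' = 0 and k = "axis j 1"]
      by (simp add: axis_def if_distrib[of "\<lambda>x. x * _"] cong: if_cong)
    show "(\<Sum>j\<in>UNIV. w i $ j * cub_a (?c j) (a i) (b i)) = 0" for i
      using z'[where i = i and h = 1 and h' = 0 and k = 0] by simp
    show "(\<Sum>j\<in>UNIV. w i $ j * cub_b (?c j) (a i) (b i)) = 0" for i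
      using z'[where i = i and h = 0 and h' = 1 and k = 0] by simp
  qed (rule that)
  show "g = (\<lambda>_. 0)"
  proof
    fix z
    obtain j m where jm: "cubic_index z = (j, m)" by force
    then have "m \<in> deg3" using cubic_index_deg3[of z] by simp
    then obtain p q where m: "m = expo p q (3 - p - q)" "(p, q) \<in> triples" unfolding deg3_image by auto
    then have "3 - q - (3 - p - q) = p" "q + (3 - p - q) \<le> 3" by (auto simp: triples_def)
    then have "?c j q (3 - p - q) = g z"
      using jm m(1) by (simp add: coeffs_of_def the_inv_into_f_eq[OF bij_betw_imp_inj_on[OF bij_cubic_index]])
    then show "g z = 0" using \<open>\<And>r q j. q + r \<le> 3 \<Longrightarrow> ?c j q r = 0\<close> \<open>q + (3 - p - q) \<le> 3\<close> by metis
  qed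
qed

lemma UNIV_6: "(UNIV :: 6 set) = {0, 1, 2, 3, 4, 5}"
proof -
  have "card {0, 1, 2, 3, 4, 5 :: 6} = CARD(6)" by simp
  then show ?thesis by (intro card_subset_eq[symmetric]) auto
qed

lemma sum_6: "(\<Sum>i\<in>UNIV. f i) = f 0 + f 1 + f 2 + f 3 + f 4 + f (5 :: 6)"
  unfolding UNIV_6 by (simp add: add_ac)

definition pick :: "'a list \<Rightarrow> 6 \<Rightarrow> 'a" where
  "pick xs i = (if i = 0 then xs ! 0 else if i = 1 then xs ! 1 else if i = 2 then xs ! 2
    else if i = 3 then xs ! 3 else if i = 4 then xs ! 4 else xs ! 5)"

text \<open>Twelve points on the three lines \<open>a = -1, 0, 1\<close>, four on each: a plane cubic contains them,
  so their cubes satisfy three linear relations, and the six-six splitting of the points turns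
  these into two decompositions of one vector of cubics.\<close>

definition example_A :: param where
  "example_A = chart_point (pick [0, 0, 1, 1, -1, -1]) (pick [-1, 1, -1, 1, 0, -1])
    (pick [vector [6, 12, 24], vector [2, 4, 24], vector [-2, 0, 4], vector [2, 0, 4], vector [0, 6, 6], vector [0, -8, 0]])"

definition example_B :: param where
  "example_B = chart_point (pick [0, 0, 1, 1, -1, -1]) (pick [-2, 0, -2, 2, -2, 2])
    (pick [vector [2, 4, 0], vector [6, 12, 48], vector [-1, 0, 4], vector [1, 0, 4], vector [0, -3, 3], vector [0, 1, 3]])"

lemma pick_simps: "pick xs 0 = xs ! 0" "pick xs 1 = xs ! 1" "pick xs 2 = xs ! 2" "pick xs 3 = xs ! 3"
  "pick xs 4 = xs ! 4" "pick xs 5 = xs ! 5"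
  by (simp_all add: pick_def)

lemma example_A_regular: "det (jacobian example_A) \<noteq> 0"
  unfolding example_A_def
proof (rule det_jacobian_chart_point)
  let ?a = "pick [0, 0, 1, 1, -1, -1 :: complex]" and ?b = "pick [-1, 1, -1, 1, 0, -1 :: complex]"
  let ?w = "pick [vector [6, 12, 24], vector [2, 4, 24], vector [-2, 0, 4], vector [2, 0, 4], vector [0, 6, 6], vector [0, -8, 0 :: complex] :: complex ^ 3]"
  fix c j q r
  assume z: "\<And>i j. cub (c j) (?a i) (?b i) = 0"
    "\<And>i. (\<Sum>j\<in>UNIV. ?w i $ j * cub_a (c j) (?a i) (?b i)) = 0"
    "\<And>i. (\<Sum>j\<in>UNIV. ?w i $ j * cub_b (c j) (?a i) (?b i)) = 0" and qr: "q + r \<le> (3 :: nat)"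
  show "c j q r = 0"
    using z(1)[where i = 0] z(1)[where i = 1] z(1)[where i = 2] z(1)[where i = 3] z(1)[where i = 4] z(1)[where i = 5]
      z(2)[where i = 0] z(2)[where i = 1] z(2)[where i = 2] z(2)[where i = 3] z(2)[where i = 4] z(2)[where i = 5]
      z(3)[where i = 0] z(3)[where i = 1] z(3)[where i = 2] z(3)[where i = 3] z(3)[where i = 4] z(3)[where i = 5] qr
    by (intro example_A_nondegenerate[of c]) (simp_all add: pick_simps sum_3)
qed

lemma example_B_regular: "det (jacobian example_B) \<noteq> 0"
  unfolding example_B_def
proof (rule det_jacobian_chart_point)
  let ?a = "pick [0, 0, 1, 1, -1, -1 :: complex]" and ?b = "pick [-2, 0, -2, 2, -2, 2 :: complex]"
  let ?w = "pick [vector [2, 4, 0], vector [6, 12, 48], vector [-1, 0, 4], vector [1, 0, 4], vector [0, -3, 3], vector [0, 1, 3 :: complex] :: complex ^ 3]"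
  fix c j q r
  assume z: "\<And>i j. cub (c j) (?a i) (?b i) = 0"
    "\<And>i. (\<Sum>j\<in>UNIV. ?w i $ j * cub_a (c j) (?a i) (?b i)) = 0"
    "\<And>i. (\<Sum>j\<in>UNIV. ?w i $ j * cub_b (c j) (?a i) (?b i)) = 0" and qr: "q + r \<le> (3 :: nat)"
  show "c j q r = 0"
    using z(1)[where i = 0] z(1)[where i = 1] z(1)[where i = 2] z(1)[where i = 3] z(1)[where i = 4] z(1)[where i = 5]
      z(2)[where i = 0] z(2)[where i = 1] z(2)[where i = 2] z(2)[where i = 3] z(2)[where i = 4] z(2)[where i = 5]
      z(3)[where i = 0] z(3)[where i = 1] z(3)[where i = 2] z(3)[where i = 3] z(3)[where i = 4] z(3)[where i = 5] qr
    by (intro example_B_nondegenerate[of c]) (simp_all add: pick_simps sum_3)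
qed

text \<open>Each component is a linear relation between cubes. The first involves only the eight
  points on \<open>a = 0\<close> and \<open>a = 1\<close>, the second only those on
  \<open>a = 0\<close> and \<open>a = -1\<close>.\<close>

lemma example_equal: "waring_map example_A = waring_map example_B"
proof -
  have all: "(\<forall>m\<in>deg3. P m) \<longleftrightarrow> P (expo 3 0 0) \<and> P (expo 2 1 0) \<and> P (expo 2 0 1) \<and> P (expo 1 2 0) \<and>
      P (expo 1 1 1) \<and> P (expo 1 0 2) \<and> P (expo 0 3 0) \<and> P (expo 0 2 1) \<and> P (expo 0 1 2) \<and> P (expo 0 0 3)" for P
    unfolding deg3_image triples_def
    by (auto simp: numeral_3_eq_3 numeral_2_eq_2 atMost_Suc)
  have "\<forall>m\<in>deg3. \<forall>d. (\<Sum>i\<in>UNIV. cmon (pl example_A i) m * pv example_A i $ d) =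
      (\<Sum>i\<in>UNIV. cmon (pl example_B i) m * pv example_B i $ d)"
    unfolding all forall_3 sum_6 example_A_def example_B_def chart_point_simps pick_simps cmon_expo
    by simp
  then show ?thesis
    using cubic_index_deg3 by (simp add: waring_map_def vec_eq_iff)
qed

section \<open>Generic decompositions\<close>

lemma cpoly_det3:
  assumes "\<And>d. cpoly (\<lambda>x. f x $ d)" "\<And>d. cpoly (\<lambda>x. g x $ d)" "\<And>d. cpoly (\<lambda>x. h x $ d)"
  shows "cpoly (\<lambda>x. det3 (f x) (g x) (h x))"
  unfolding det3_def by (intro cpoly_add cpoly_diff cpoly_mult assms)

definition hexgen :: "6 \<Rightarrow> 6 \<Rightarrow> 6 \<Rightarrow> 6 \<Rightarrow> 6 \<Rightarrow> 6 \<Rightarrow> param \<Rightarrow> complex" where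
  "hexgen i k p q m n x = hexad.genpoly (pl x) (pv x) i k p q m n"

lemmas hexad_defs = hexad.genpoly_def hexad.a_def hexad.b_def hexad.D_def hexad.cq_def hexad.cm_def
  hexad.cn_def hexad.r'_def hexad.s'_def hexad.t'_def

lemma cpoly_hexgen: "cpoly (hexgen i k p q m n)"
  unfolding hexgen_def[abs_def] hexad_defs
  by (intro cpoly_mult cpoly_det3 cpoly_pl cpoly_pv)
    (simp_all only: vector_add_component vector_smult_component,
      (intro cpoly_add cpoly_mult cpoly_det3 cpoly_pl cpoly_pv)+)

text \<open>One small integral configuration, assigned to the six labels in the given order, makes
  all factors of \<open>genpoly\<close> nonzero.\<close>

lemma hexgen_nonzero:
  assumes "distinct [i, k, p, q, m, n]"
  shows "\<exists>x. hexgen i k p q m n x \<noteq> 0"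
proof -
  let ?x = "chart_point (\<lambda>j. if j = k \<or> j = q \<or> j = n then 1 else if j = m then 2 else 0)
    (\<lambda>j. if j = i \<or> j = k then 0 else if j = n then 2 else 1)
    (\<lambda>j. if j = i \<or> j = q then vector [1, 0, 0] else if j = k \<or> j = m then vector [0, 1, 0]
      else if j = n then vector [0, 0, 1] else vector [1, 1, 1])"
  have ne: "i \<noteq> k" "i \<noteq> p" "i \<noteq> q" "i \<noteq> m" "i \<noteq> n" "k \<noteq> p" "k \<noteq> q" "k \<noteq> m" "k \<noteq> n"
    "p \<noteq> q" "p \<noteq> m" "p \<noteq> n" "q \<noteq> m" "q \<noteq> n" "m \<noteq> n"
    using assms by auto
  note ne = ne ne[symmetric]
  have pl: "pl ?x i = vector [1, 0, 0]" "pl ?x k = vector [1, 1, 0]" "pl ?x p = vector [1, 0, 1]"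
    "pl ?x q = vector [1, 1, 1]" "pl ?x m = vector [1, 2, 1]" "pl ?x n = vector [1, 1, 2]"
    unfolding chart_point_simps by (simp_all add: ne)
  have pv: "pv ?x i = vector [1, 0, 0]" "pv ?x k = vector [0, 1, 0]" "pv ?x p = vector [1, 1, 1]"
    "pv ?x q = vector [1, 0, 0]" "pv ?x m = vector [0, 1, 0]" "pv ?x n = vector [0, 0, 1]"
    unfolding chart_point_simps by (simp_all add: ne)
  have "hexgen i k p q m n ?x \<noteq> 0"
    unfolding hexgen_def hexad_defs pl pv by (simp add: det3_def)
  then show ?thesis by blast
qed

definition regular :: "param \<Rightarrow> bool" where
  "regular x \<longleftrightarrow> det (jacobian x) \<noteq> 0 \<and> (\<forall>i k. i \<noteq> k \<longrightarrow>
     (\<exists>p q m n. UNIV = {i, k, p, q, m, n} \<and> distinct [i, k, p, q, m, n] \<and> hexgen i k p q m n x \<noteq> 0))"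

lemma regular_poly:
  obtains g where "cpoly g" "\<exists>x. g x \<noteq> 0" "\<And>x. g x \<noteq> 0 \<Longrightarrow> det (jacobian x) \<noteq> 0 \<Longrightarrow> regular x"
proof -
  have "\<forall>e. \<exists>p q m n. fst e \<noteq> snd e \<longrightarrow> UNIV = {fst e, snd e, p, q, m, n :: 6} \<and> distinct [fst e, snd e, p, q, m, n]"
  proof
    fix e :: "6 \<times> 6"
    show "\<exists>p q m n. fst e \<noteq> snd e \<longrightarrow> UNIV = {fst e, snd e, p, q, m, n} \<and> distinct [fst e, snd e, p, q, m, n]"
    proof (cases "fst e = snd e")
      case False
      show ?thesis by (rule hexad_enumeration[of "fst e" "snd e"]) (use False in auto)
    qed simp
  qed
  then obtain P Q M N where *: "\<And>e. fst e \<noteq> snd e \<Longrightarrow>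
      UNIV = {fst e, snd e, P e, Q e, M e, N e :: 6} \<and> distinct [fst e, snd e, P e, Q e, M e, N e]"
    by metis
  let ?f = "\<lambda>e. hexgen (fst e) (snd e) (P e) (Q e) (M e) (N e)"
  let ?A = "{e :: 6 \<times> 6. fst e \<noteq> snd e}"
  show ?thesis
  proof (rule that[of "\<lambda>x. \<Prod>e\<in>?A. ?f e x"])
    show "cpoly (\<lambda>x. \<Prod>e\<in>?A. ?f e x)" by (intro cpoly_prod cpoly_hexgen)
    show "\<exists>x. (\<Prod>e\<in>?A. ?f e x) \<noteq> 0"
    proof (rule cpoly_prod_nonzero)
      show "\<exists>x. ?f e x \<noteq> 0" if "e \<in> ?A" for e
        using * that by (intro hexgen_nonzero) simp
    qed (auto intro: cpoly_hexgen)
    show "regular x" if "(\<Prod>e\<in>?A. ?f e x) \<noteq> 0" "det (jacobian x) \<noteq> 0" for x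
      unfolding regular_def
    proof (intro conjI allI impI)
      show "det (jacobian x) \<noteq> 0" by fact
      fix i k :: 6 assume ik: "i \<noteq> k"
      then have "?f (i, k) x \<noteq> 0" using that(1) by auto
      then show "\<exists>p q m n. UNIV = {i, k, p, q, m, n} \<and> distinct [i, k, p, q, m, n] \<and> hexgen i k p q m n x \<noteq> 0"
        using *[of "(i, k)"] ik by (intro exI[of _ "P (i, k)"] exI[of _ "Q (i, k)"] exI[of _ "M (i, k)"] exI[of _ "N (i, k)"]) simp
    qed
  qed
qed

lemma regular_hexad:
  assumes "regular x" "i \<noteq> k"
  obtains p q m n where "generic_hexad (pl x) (pv x) i k p q m n"
proof -
  obtain p q m n where "UNIV = {i, k, p, q, m, n}" "distinct [i, k, p, q, m, n]" "hexgen i k p q m n x \<noteq> 0"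
    using assms unfolding regular_def by blast
  then have "generic_hexad (pl x) (pv x) i k p q m n"
    unfolding generic_hexad_def hexgen_def by blast
  then show ?thesis by (rule that)
qed

lemma regular_sextuple:
  assumes "regular x"
  shows "sextuple (pl x) (pv x)"
proof
  show "CARD(6) = 6" by simp
  show "X y u = 0" if "bih 3 1 X" "\<And>j h k. DD X (pl x j) (pv x j) h k = 0" for X y u
    using jet_inj_param[OF _ that] assms by (simp add: regular_def)
  show "\<exists>X. bih 3 1 X \<and> (\<forall>j h k. DD X (pl x j) (pv x j) h k = (if j = i then f h else 0))"
    if "lin f" "f (pl x i) = 0" for f i
    using jet_surj_param[OF _ that] assms by (simp add: regular_def)
  show "\<exists>e w s t r u1 u2 u3 b1 b2 b3 m1 m2. chord_coords (pl x) (pv x) i k e w s t r u1 u2 u3 b1 b2 b3 m1 m2"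
    if "i \<noteq> k" for i k
    by (rule regular_hexad[OF assms that]) (rule generic_hexad.chord_coords_ex)
  show "\<exists>B. bih 1 1 B \<and> (\<forall>j. B (pl x j) (pv x j) = (if j = i then 1 else 0))" for i
  proof -
    obtain k :: 6 where "i \<noteq> k" by (metis zero_neq_one)
    show ?thesis
      by (rule regular_hexad[OF assms \<open>i \<noteq> k\<close>]) (rule generic_hexad.bilinear_dual_ex)
  qed
qed

text \<open>If one coordinate of all \<open>pv x i\<close> vanished, the factor \<open>D\<close> of
  \<open>genpoly\<close> would vanish. This supplies the condition that each of the three scalar
  vectors of a decomposition is nonzero.\<close>

lemma regular_component:
  assumes "regular x"
  shows "\<exists>i. pv x i $ d \<noteq> 0"
proof (rule ccontr)
  assume "\<not> ?thesis"
  then have z: "pv x i $ d = 0" for i by blast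
  have "(0 :: 6) \<noteq> 1" by simp
  then obtain p q m n where h: "generic_hexad (pl x) (pv x) (0 :: 6) 1 p q m n"
    by (rule regular_hexad[OF assms]) (rule that; assumption)
  have "det3 (pv x q) (pv x m) (pv x n) = 0"
    using z exhaust_3[of d] by (auto simp: det3_def)
  then show False
    using generic_hexad.nz(5)[OF h] by (simp add: hexad.D_def)
qed

section \<open>Permutations of the six points\<close>

definition permute :: "(6 \<Rightarrow> 6) \<Rightarrow> param \<Rightarrow> param" where
  "permute \<sigma> x = (\<chi> c. x $ (\<sigma> (fst c), snd c))"

lemma permute_simps: "pl (permute \<sigma> x) i = pl x (\<sigma> i)" "pv (permute \<sigma> x) i = pv x (\<sigma> i)"
  by (simp_all add: permute_def pl_def pv_def)

lemma waring_map_permute: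
  assumes "bij \<sigma>"
  shows "waring_map (permute \<sigma> x) = waring_map x"
  unfolding waring_map_def permute_simps vec_eq_iff vec_lambda_beta
proof
  fix c
  show "(\<Sum>i\<in>UNIV. cmon (pl x (\<sigma> i)) (snd (cubic_index c)) * pv x (\<sigma> i) $ fst (cubic_index c)) =
      (\<Sum>i\<in>UNIV. cmon (pl x i) (snd (cubic_index c)) * pv x i $ fst (cubic_index c))"
    using sum.reindex_bij_betw[OF assms, of "\<lambda>i. cmon (pl x i) (snd (cubic_index c)) * pv x i $ fst (cubic_index c)"] .
qed

lemma continuous_permute: "continuous_on A (permute \<sigma>)"
  unfolding permute_def[abs_def] by (intro continuous_on_vec_lambda continuous_intros)

definition evs :: "param \<Rightarrow> ((complex ^ 3 \<Rightarrow> complex ^ 3 \<Rightarrow> complex) \<Rightarrow> complex) set" where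
  "evs x = (\<lambda>i. ev (pl x i) (pv x i)) ` UNIV"

lemma ev_eqD:
  assumes "ev x u = ev x' u'"
  shows "x $ a * x $ b * x $ c * u $ d = x' $ a * x' $ b * x' $ c * u' $ d"
proof -
  have "bih 3 1 (\<lambda>x u. x $ a * x $ b * x $ c * u $ d)"
    by (rule bih_mult'[OF bih_mult'[OF bih_mult'[OF bih_fst bih_fst] bih_fst] bih_snd]) auto
  then show ?thesis
    using fun_cong[OF assms, of "\<lambda>x u. x $ a * x $ b * x $ c * u $ d"] by (simp add: ev_def)
qed

text \<open>The first coefficient being 1 in the chart, the forms \<open>x_1^3 u_d\<close> recover
  \<open>pv\<close> and then \<open>x_1^2 x_a u_d\<close> recovers \<open>pl\<close>; dual forms
  make the matching of points injective.\<close>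

lemma evs_eq_permute:
  assumes "regular x" "regular x'" "evs x = evs x'"
  obtains \<sigma> where "bij \<sigma>" "x' = permute \<sigma> x"
proof -
  interpret S: sextuple "pl x'" "pv x'" by (rule regular_sextuple) fact
  have "\<forall>i. \<exists>j. ev (pl x' i) (pv x' i) = ev (pl x j) (pv x j)"
  proof
    fix i
    have "ev (pl x' i) (pv x' i) \<in> evs x" using assms(3) by (auto simp: evs_def)
    then show "\<exists>j. ev (pl x' i) (pv x' i) = ev (pl x j) (pv x j)" by (auto simp: evs_def)
  qed
  then obtain \<sigma> where \<sigma>: "\<And>i. ev (pl x' i) (pv x' i) = ev (pl x (\<sigma> i)) (pv x (\<sigma> i))" by metis
  obtain E where E: "\<And>j. bih 3 1 (E j)" "\<And>j k. E j (pl x' k) (pv x' k) = (if k = j then 1 else 0)"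
    by (rule S.decomposes_dual_forms[OF S.decomposes_self]) (rule that; assumption)
  have "inj \<sigma>"
  proof (rule injI)
    fix i j assume "\<sigma> i = \<sigma> j"
    then have "ev (pl x' i) (pv x' i) (E i) = ev (pl x' j) (pv x' j) (E i)" using \<sigma> by simp
    then show "i = j" using E by (simp add: ev_def split: if_splits)
  qed
  then have "bij \<sigma>" by (simp add: bij_def finite_UNIV_inj_surj)
  have pv: "pv x' i = pv x (\<sigma> i)" for i
    using ev_eqD[OF \<sigma>[of i], of 1 1 1] by (simp add: vec_eq_iff pl_def)
  have pl: "pl x' i $ a = pl x (\<sigma> i) $ a" for i a
  proof -
    obtain d where "pv x' i $ d \<noteq> 0" using S.point_nonzero(2)[of i] by (auto simp: vec_eq_iff)
    moreover have "pl x' i $ a * pv x' i $ d = pl x (\<sigma> i) $ a * pv x' i $ d"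
      using ev_eqD[OF \<sigma>[of i], of 1 1 a d] by (simp add: pl_def pv)
    ultimately show ?thesis by simp
  qed
  have "x' $ (i, e) = permute \<sigma> x $ (i, e)" for i e
  proof (cases e)
    case (Inl f)
    then show ?thesis
      using exhaust_2[of f] pl[of i 2] pl[of i 3] by (auto simp: permute_def pl_def)
  next
    case (Inr d)
    then show ?thesis using pv[of i] by (simp add: permute_def pv_def vec_eq_iff)
  qed
  then have "x' = permute \<sigma> x" by (simp add: vec_eq_iff)
  with \<open>bij \<sigma>\<close> show ?thesis by (rule that)
qed

text \<open>The third coordinate -2 of the first point of \<open>example_B\<close> does not occur in
  \<open>example_A\<close>.\<close>

lemma example_not_permuted: "permute \<sigma> example_A \<noteq> example_B"
proof
  assume "permute \<sigma> example_A = example_B"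
  then have "pl example_A (\<sigma> 0) $ 3 = pl example_B 0 $ 3"
    by (metis permute_simps(1))
  then show False
    by (simp add: example_A_def example_B_def chart_point_simps pick_def split: if_splits)
qed

theorem generic_parameters:
  obtains P where "cpoly P" "\<exists>y. P y \<noteq> 0"
    and "\<And>y. P y \<noteq> 0 \<Longrightarrow> \<exists>x x'. waring_map x = y \<and> waring_map x' = y \<and> regular x \<and> regular x' \<and> evs x \<noteq> evs x'"
proof -
  obtain g where g: "cpoly g" "\<exists>x. g x \<noteq> 0" "\<And>x. g x \<noteq> 0 \<Longrightarrow> det (jacobian x) \<noteq> 0 \<Longrightarrow> regular x"
    by (rule regular_poly) (rule that; assumption)
  obtain b where b: "g b \<noteq> 0" using g(2) by blast
  let ?\<Sigma> = "permute ` {\<sigma>. bij \<sigma>}"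
  have fin: "finite ?\<Sigma>" by simp
  have cont: "\<And>\<sigma>. \<sigma> \<in> ?\<Sigma> \<Longrightarrow> continuous_on UNIV \<sigma>"
    and inv: "\<And>\<sigma> x. \<sigma> \<in> ?\<Sigma> \<Longrightarrow> waring_map (\<sigma> x) = waring_map x"
    and sep: "\<And>\<sigma>. \<sigma> \<in> ?\<Sigma> \<Longrightarrow> \<sigma> example_A \<noteq> example_B"
    using continuous_permute waring_map_permute example_not_permuted by auto
  obtain P where P: "cpoly P" "\<exists>y. P y \<noteq> 0"
    "\<And>x. P (waring_map x) \<noteq> 0 \<Longrightarrow> g x \<noteq> 0 \<and> det (jacobian x) \<noteq> 0"
    "\<And>y. P y \<noteq> 0 \<Longrightarrow> \<exists>x x'. waring_map x = y \<and> waring_map x' = y \<and> (\<forall>\<sigma>\<in>?\<Sigma>. \<sigma> x \<noteq> x')"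
    by (rule waring.generic_fibre_pairs[where a = example_A and a' = example_B and \<Sigma> = ?\<Sigma> and g = g and b = b,
        OF example_A_regular example_B_regular example_equal fin _ _ _ g(1) b],
        erule cont, erule inv, erule sep) (rule that; assumption)
  show ?thesis
  proof (rule that[OF P(1,2)])
    fix y assume y: "P y \<noteq> 0"
    obtain x x' where x: "waring_map x = y" "waring_map x' = y" "\<forall>\<sigma>\<in>?\<Sigma>. \<sigma> x \<noteq> x'"
      using P(4)[OF y] by (elim exE conjE) (rule that)
    have reg: "regular x" "regular x'"
      using g(3)[of x] g(3)[of x'] P(3)[of x] P(3)[of x'] x(1,2) y by simp_all
    have "evs x \<noteq> evs x'"
    proof
      assume "evs x = evs x'"
      then obtain \<sigma> where "bij \<sigma>" "x' = permute \<sigma> x"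
        by (rule evs_eq_permute[OF reg])
      with bspec[OF x(3), of "permute \<sigma>"] show False by simp
    qed
    with x reg show "\<exists>x x'. waring_map x = y \<and> waring_map x' = y \<and> regular x \<and> regular x' \<and> evs x \<noteq> evs x'"
      by blast
  qed
qed

section \<open>Evaluation of polynomials\<close>

abbreviation lk :: "('a \<Rightarrow>\<^sub>0 'b::zero) \<Rightarrow> 'a \<Rightarrow> 'b" where "lk \<equiv> Poly_Mapping.lookup"
abbreviation sg :: "'a \<Rightarrow> 'b \<Rightarrow> ('a \<Rightarrow>\<^sub>0 'b::zero)" where "sg \<equiv> Poly_Mapping.single"

definition power_prod :: "('v \<Rightarrow> 'a::comm_ring_1) \<Rightarrow> ('v \<Rightarrow>\<^sub>0 nat) \<Rightarrow> 'a" where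
  "power_prod a m = (\<Prod>v\<in>Poly_Mapping.keys m. a v ^ lk m v)"

lemma power_prod_superset:
  "finite S \<Longrightarrow> Poly_Mapping.keys m \<subseteq> S \<Longrightarrow> power_prod a m = (\<Prod>v\<in>S. a v ^ lk m v)"
  unfolding power_prod_def
  by (rule prod.mono_neutral_left) (auto simp: in_keys_iff)

lemma power_prod_add: "power_prod a (m + m') = power_prod a m * power_prod a m'"
proof -
  let ?S = "Poly_Mapping.keys m \<union> Poly_Mapping.keys m'"
  have "power_prod a (m + m') = (\<Prod>v\<in>?S. a v ^ lk (m + m') v)"
    using keys_add[of m m'] by (intro power_prod_superset) auto
  then show ?thesis
    by (simp add: power_prod_superset[of ?S m] power_prod_superset[of ?S m'] lookup_add power_add prod.distrib)
qed

lemma mpoly_eval_superset: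
  "finite S \<Longrightarrow> Poly_Mapping.keys p \<subseteq> S \<Longrightarrow> mpoly_eval a p = (\<Sum>m\<in>S. lk p m * power_prod a m)"
  unfolding mpoly_eval_def power_prod_def[symmetric]
  by (rule sum.mono_neutral_left) (auto simp: in_keys_iff)

lemma mpoly_eval_add: "mpoly_eval a (p + q) = mpoly_eval a p + mpoly_eval a q"
proof -
  let ?S = "Poly_Mapping.keys p \<union> Poly_Mapping.keys q"
  have "mpoly_eval a (p + q) = (\<Sum>m\<in>?S. lk (p + q) m * power_prod a m)"
    using keys_add[of p q] by (intro mpoly_eval_superset) auto
  then show ?thesis
    by (simp add: mpoly_eval_superset[of ?S p] mpoly_eval_superset[of ?S q] lookup_add distrib_right sum.distrib)
qed

lemma mpoly_eval_single: "mpoly_eval a (sg m c) = c * power_prod a m"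
  using mpoly_eval_superset[of "{m}" "sg m c" a] by (simp add: lookup_single)

lemma mpoly_eval_sum: "mpoly_eval a (\<Sum>i\<in>A. p i) = (\<Sum>i\<in>A. mpoly_eval a (p i))"
proof (induction A rule: infinite_finite_induct)
  case (insert x F)
  then show ?case by (simp add: mpoly_eval_add)
qed (simp_all add: mpoly_eval_def)

lemma sum_singles: "p = (\<Sum>m\<in>Poly_Mapping.keys p. sg m (lk p m))"
  by (rule poly_mapping_eqI)
    (simp add: lookup_sum lookup_single when_def in_keys_iff)

lemma mpoly_eval_mult: "mpoly_eval a (p * q) = mpoly_eval a p * mpoly_eval a q"
proof -
  have "p * q = (\<Sum>m\<in>Poly_Mapping.keys p. \<Sum>m'\<in>Poly_Mapping.keys q. sg (m + m') (lk p m * lk q m'))"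
    by (subst sum_singles[of p], subst sum_singles[of q]) (simp add: sum_product mult_single)
  then have "mpoly_eval a (p * q) =
      (\<Sum>m\<in>Poly_Mapping.keys p. \<Sum>m'\<in>Poly_Mapping.keys q. (lk p m * power_prod a m) * (lk q m' * power_prod a m'))"
    by (simp add: mpoly_eval_sum mpoly_eval_single power_prod_add mult_ac)
  then show ?thesis
    by (simp add: sum_product[symmetric] mpoly_eval_def power_prod_def)
qed

text \<open>The passage from polynomial functions to the polynomials that define Zariski closed
  sets; the divisors \<open>N\<close> will be the trinomial coefficients.\<close>

lemma cpoly_mpoly:
  fixes idx :: "'n::finite \<Rightarrow> 'v"
  assumes "cpoly P"
  obtains Q where "\<And>a. mpoly_eval a Q = P (\<chi> c. a (idx c) / N c)"
proof -
  from assms have "\<exists>Q. \<forall>a. mpoly_eval a Q = P (\<chi> c. a (idx c) / N c)"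
  proof induction
    case (cpoly_const k)
    show ?case
      by (intro exI[of _ "sg 0 k"]) (simp add: mpoly_eval_single power_prod_def)
  next
    case (cpoly_comp c)
    show ?case
      by (intro exI[of _ "sg (sg (idx c) 1) (1 / N c)"]) (simp add: mpoly_eval_single power_prod_def)
  next
    case (cpoly_add f g)
    then show ?case by (metis mpoly_eval_add)
  next
    case (cpoly_mult f g)
    then show ?case by (metis mpoly_eval_mult)
  qed
  with that show ?thesis by blast
qed

section \<open>Cubes of linear forms\<close>

definition linear_form :: "complex ^ 3 \<Rightarrow> ternary" where
  "linear_form x = (\<Sum>a\<in>UNIV. sg (sg a 1) (x $ a))"

definition coeff_vector :: "ternary \<Rightarrow> complex ^ 3" where
  "coeff_vector p = (\<chi> a. lk p (sg a 1))"

lemma sum_lookup_single: "(\<Sum>j\<in>UNIV. lk (sg a k :: 3 \<Rightarrow>\<^sub>0 nat) j) = k"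
  by (simp add: lookup_single when_def)

lemma linear_form_in: "linear_form x \<in> forms 1"
proof -
  have "m \<in> (\<lambda>a. sg a 1) ` UNIV" if "m \<in> Poly_Mapping.keys (linear_form x)" for m
  proof (rule ccontr)
    assume "m \<notin> (\<lambda>a. sg a 1) ` UNIV"
    then have "lk (linear_form x) m = 0"
      by (auto simp: linear_form_def lookup_sum lookup_single when_def simp del: One_nat_def intro!: sum.neutral)
    with that show False by (simp add: in_keys_iff)
  qed
  then show ?thesis
    unfolding forms_def using sum_lookup_single by (auto simp del: One_nat_def)
qed

lemma degree_one_single:
  assumes "(\<Sum>j\<in>UNIV. lk m j) = (1 :: nat)"
  obtains a :: 3 where "m = sg a 1"
proof -
  have "lk m 1 + lk m 2 + lk m 3 = 1" using assms by (simp add: sum_3)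
  then consider "lk m 1 = 1" "lk m 2 = 0" "lk m 3 = 0" | "lk m 1 = 0" "lk m 2 = 1" "lk m 3 = 0"
    | "lk m 1 = 0" "lk m 2 = 0" "lk m 3 = 1" by linarith
  then have "\<exists>a. \<forall>j. lk m j = lk (sg a 1) j"
  proof cases
    case 1
    then show ?thesis by (intro exI[of _ 1]) (simp add: forall_3 lookup_single when_def)
  next
    case 2
    then show ?thesis by (intro exI[of _ 2]) (simp add: forall_3 lookup_single when_def)
  next
    case 3
    then show ?thesis by (intro exI[of _ 3]) (simp add: forall_3 lookup_single when_def)
  qed
  with that show ?thesis by (metis poly_mapping_eqI)
qed

lemma linear_form_coeff_vector:
  assumes "p \<in> forms 1"
  shows "linear_form (coeff_vector p) = p"
proof (rule poly_mapping_eqI)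
  fix m
  have inj: "sg a (1 :: nat) = sg b 1 \<longleftrightarrow> a = b" for a b :: 3
    by (metis lookup_single_eq lookup_single_not_eq zero_neq_one)
  have lhs: "lk (linear_form (coeff_vector p)) m = (\<Sum>a\<in>UNIV. if sg a 1 = m then lk p (sg a 1) else 0)"
    by (simp add: linear_form_def coeff_vector_def lookup_sum lookup_single when_def del: One_nat_def)
  show "lk (linear_form (coeff_vector p)) m = lk p m"
  proof (cases "\<exists>b. m = sg b 1")
    case True
    then obtain b where "m = sg b 1" by blast
    then show ?thesis unfolding lhs by (simp add: inj del: One_nat_def)
  next
    case False
    then have "m \<notin> Poly_Mapping.keys p"
      using assms degree_one_single[of m] unfolding forms_def by blast
    then show ?thesis unfolding lhs using False by (auto simp: in_keys_iff intro!: sum.neutral)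
  qed
qed

text \<open>The trinomial coefficient if \<open>m\<close> has degree 3, and 0 otherwise.\<close>

definition multinom :: "(3 \<Rightarrow>\<^sub>0 nat) \<Rightarrow> complex" where
  "multinom m = of_nat (card {(a, b, c). sg a 1 + sg b 1 + sg c 1 = m})"

lemma lookup_cube:
  "lk (mpoly_const k * linear_form x ^ 3) m = k * multinom m * cmon x m"
proof -
  let ?e = "\<lambda>t :: 3 \<times> 3 \<times> 3. sg (fst t) 1 + sg (fst (snd t)) 1 + sg (snd (snd t)) (1 :: nat)"
  have "linear_form x ^ 3 = (\<Sum>a\<in>UNIV. \<Sum>b\<in>UNIV. \<Sum>c\<in>UNIV. sg (sg a 1 + sg b 1 + sg c 1) (x $ a * x $ b * x $ c))"
    unfolding power3_eq_cube linear_form_def sum_product sum_distrib_left sum_distrib_right mult_single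
    by (simp add: add_ac mult_ac del: One_nat_def)
  also have "\<dots> = (\<Sum>t\<in>UNIV. sg (?e t) (cmon x (?e t)))"
    by (simp add: sum.cartesian_product case_prod_unfold cmon_add cmon_single del: One_nat_def)
  finally have "mpoly_const k * linear_form x ^ 3 = (\<Sum>t\<in>UNIV. sg (?e t) (k * cmon x (?e t)))"
    by (simp add: mpoly_const_def sum_distrib_left mult_single)
  then have "lk (mpoly_const k * linear_form x ^ 3) m = (\<Sum>t\<in>UNIV. if ?e t = m then k * cmon x m else 0)"
    by (simp add: lookup_sum lookup_single when_def del: One_nat_def cong: if_cong)
  also have "\<dots> = (\<Sum>t\<in>{t. ?e t = m}. k * cmon x m)"
    by (simp add: sum.If_cases del: One_nat_def)
  also have "\<dots> = k * multinom m * cmon x m"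
    by (simp add: multinom_def case_prod_unfold mult_ac del: One_nat_def)
  finally show ?thesis .
qed

lemma multinom_outside: "m \<notin> deg3 \<Longrightarrow> multinom m = 0"
proof -
  assume m: "m \<notin> deg3"
  have "sg a 1 + sg b 1 + sg c (1 :: nat) \<noteq> m" for a b c
  proof
    assume "sg a 1 + sg b 1 + sg c (1 :: nat) = m"
    then have "(\<Sum>j\<in>UNIV. lk m j) = 3"
      using sum_lookup_single by (auto simp: lookup_add sum.distrib simp del: One_nat_def)
    with m show False by (simp add: deg3_def)
  qed
  then show ?thesis by (simp add: multinom_def)
qed

lemma multinom_nonzero:
  assumes "m \<in> deg3"
  shows "multinom m \<noteq> 0"
proof -
  have "\<exists>a b c. sg a 1 + sg b 1 + sg c (1 :: nat) = m"
  proof -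
    have e: "sg a 1 + sg b 1 + sg c (1 :: nat) = expo p q r"
      if "\<forall>j. lk (sg a 1 + sg b 1 + sg c (1 :: nat)) j = lk (expo p q r) j" for a b c :: 3 and p q r
      using that by (intro poly_mapping_eqI) blast
    obtain p q where m: "m = expo p q (3 - p - q)" "(p, q) \<in> triples"
      using assms unfolding deg3_image by auto
    \<comment> \<open>The nondecreasing word with \<open>p\<close> ones, \<open>q\<close> twos and
      otherwise threes.\<close>
    let ?a = "if p \<ge> 1 then 1 else if p + q \<ge> 1 then 2 else 3 :: 3"
    let ?b = "if p \<ge> 2 then 1 else if p + q \<ge> 2 then 2 else 3 :: 3"
    let ?c = "if p \<ge> 3 then 1 else if p + q \<ge> 3 then 2 else 3 :: 3"
    have "sg ?a 1 + sg ?b 1 + sg ?c (1 :: nat) = m"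
      unfolding m(1) using m(2)
      by (intro e) (auto simp: forall_3 lookup_add lookup_single lookup_expo when_def triples_def)
    then show ?thesis by blast
  qed
  then have "{(a, b, c). sg a 1 + sg b 1 + sg c 1 = m} \<noteq> {}" by auto
  then show ?thesis by (simp add: multinom_def card_eq_0_iff)
qed

section \<open>Decompositions of vectors of cubics\<close>

definition summand :: "complex ^ 3 \<Rightarrow> complex ^ 3 \<Rightarrow> ternary ^ 3" where
  "summand x u = (\<chi> j. mpoly_const (u $ j) * linear_form x ^ 3)"

lemma lookup_summand: "lk (summand x u $ j) m = u $ j * multinom m * cmon x m"
  by (simp add: summand_def lookup_cube)

lemma summand_ev:
  assumes "ev x u = ev x' u'"
  shows "summand x u = summand x' u'"
proof -
  have "lk (summand x u $ j) m = lk (summand x' u' $ j) m" for j m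
  proof (cases "m \<in> deg3")
    case True
    have "bih 3 1 (\<lambda>x u. cmon x m * u $ j)"
      by (rule bih_mult'[OF bih_cmon[OF True] bih_snd]) auto
    then have "cmon x m * u $ j = cmon x' m * u' $ j"
      using fun_cong[OF assms, of "\<lambda>x u. cmon x m * u $ j"] by (simp add: ev_def)
    then show ?thesis by (simp add: lookup_summand mult_ac)
  qed (simp add: lookup_summand multinom_outside)
  then show ?thesis by (simp add: vec_eq_iff poly_mapping_eq_iff fun_eq_iff)
qed

lemma ev_summand:
  assumes "summand x u = summand x' u'"
  shows "ev x u = ev x' u'"
proof (rule ev_eqI)
  fix X assume "bih 3 1 X"
  then obtain g where g: "X = form g" by (rule form_ex)
  have "cmon x m * u $ j = cmon x' m * u' $ j" if "m \<in> deg3" for m j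
    using arg_cong[OF assms, of "\<lambda>s. lk (s $ j) m"] multinom_nonzero[OF that]
    by (simp add: lookup_summand mult_ac)
  then show "X x u = X x' u'"
    unfolding g form_def using cubic_index_deg3 by simp
qed

text \<open>By \<open>summand_ev\<close> the vector summand is a function \<open>S\<close> of the
  functional, and \<open>S\<close> carries one image to the other.\<close>

lemma summand_image_eq:
  assumes "(\<lambda>i. ev (m i) (y i)) ` A = (\<lambda>i. ev (m' i) (y' i)) ` B"
  shows "(\<lambda>i. summand (m i) (y i)) ` A = (\<lambda>i. summand (m' i) (y' i)) ` B"
proof -
  define S where "S = (\<lambda>\<phi>. THE s. \<exists>x u. \<phi> = ev x u \<and> s = summand x u)"
  have S: "S (ev x u) = summand x u" for x u
    unfolding S_def by (rule the_equality) (auto dest: summand_ev)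
  have "(\<lambda>i. summand (m i) (y i)) ` A = S ` (\<lambda>i. ev (m i) (y i)) ` A" by (simp add: image_image S)
  also have "\<dots> = (\<lambda>i. summand (m' i) (y' i)) ` B" unfolding assms by (simp add: image_image S)
  finally show ?thesis .
qed

lemma ev_image_eq:
  assumes "(\<lambda>i. summand (m i) (y i)) ` A = (\<lambda>i. summand (m' i) (y' i)) ` B"
  shows "(\<lambda>i. ev (m i) (y i)) ` A = (\<lambda>i. ev (m' i) (y' i)) ` B"
proof -
  define S where "S = (\<lambda>s. THE \<phi>. \<exists>x u. s = summand x u \<and> \<phi> = ev x u)"
  have S: "S (summand x u) = ev x u" for x u
    unfolding S_def by (rule the_equality) (auto dest: ev_summand)
  have "(\<lambda>i. ev (m i) (y i)) ` A = S ` (\<lambda>i. summand (m i) (y i)) ` A" by (simp add: image_image S)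
  also have "\<dots> = (\<lambda>i. ev (m' i) (y' i)) ` B" unfolding assms by (simp add: image_image S)
  finally show ?thesis .
qed

definition normal_coords :: "ternary ^ 3 \<Rightarrow> param" where
  "normal_coords f = (\<chi> c. coordinate f (cubic_index c) / multinom (snd (cubic_index c)))"

lemma normal_coords_sum:
  fixes m y :: "6 \<Rightarrow> complex ^ 3"
  assumes "f = (\<Sum>i\<in>UNIV. summand (m i) (y i))"
  shows "normal_coords f $ c = (\<Sum>i\<in>UNIV. cmon (m i) (snd (cubic_index c)) * y i $ fst (cubic_index c))"
  using multinom_nonzero[OF cubic_index_deg3[of c]]
  by (simp add: normal_coords_def coordinate_def assms case_prod_unfold lookup_sum lookup_summand
      sum_divide_distrib mult_ac)

lemma lookup_normal_coords:
  assumes "m \<in> deg3"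
  obtains c where "fst (cubic_index c) = j" "snd (cubic_index c) = m" "\<And>f. lk (f $ j) m = multinom m * normal_coords f $ c"
proof -
  obtain c where c: "cubic_index c = (j, m)"
    using bij_betw_imp_surj_on[OF bij_cubic_index] assms by (metis (no_types, lifting) SigmaI UNIV_I imageE)
  show ?thesis
    by (rule that[of c]) (simp_all add: c normal_coords_def coordinate_def multinom_nonzero[OF assms])
qed

lemma sum_summand_eq_iff:
  fixes m y :: "6 \<Rightarrow> complex ^ 3"
  assumes "f \<in> cubic_vectors"
  shows "f = (\<Sum>i\<in>UNIV. summand (m i) (y i)) \<longleftrightarrow>
    normal_coords f = (\<chi> c. \<Sum>i\<in>UNIV. cmon (m i) (snd (cubic_index c)) * y i $ fst (cubic_index c))"
proof
  assume *: "f = (\<Sum>i\<in>UNIV. summand (m i) (y i))"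
  show "normal_coords f = (\<chi> c. \<Sum>i\<in>UNIV. cmon (m i) (snd (cubic_index c)) * y i $ fst (cubic_index c))"
    using normal_coords_sum[OF *] by (simp add: vec_eq_iff)
next
  assume *: "normal_coords f = (\<chi> c. \<Sum>i\<in>UNIV. cmon (m i) (snd (cubic_index c)) * y i $ fst (cubic_index c))"
  let ?s = "\<Sum>i\<in>UNIV. summand (m i) (y i)"
  have "lk (f $ j) e = lk (?s $ j) e" for j e
  proof (cases "e \<in> deg3")
    case True
    then obtain c where c: "fst (cubic_index c) = j" "snd (cubic_index c) = e"
        "\<And>f. lk (f $ j) e = multinom e * normal_coords f $ c"
      by (rule lookup_normal_coords) (rule that; assumption)
    show ?thesis
      using * normal_coords_sum[OF refl, of m y c] by (simp only: c(3)) simp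
  next
    case False
    have "e \<notin> Poly_Mapping.keys (f $ j)"
      using assms False by (auto simp: cubic_vectors_def forms_def deg3_def)
    then show ?thesis
      using False by (simp add: in_keys_iff lookup_sum lookup_summand multinom_outside)
  qed
  then show "f = ?s" by (simp add: vec_eq_iff poly_mapping_eq_iff fun_eq_iff)
qed

lemma sum_summand_in_cubic_vectors: "(\<Sum>i\<in>A. summand (m i) (y i)) \<in> cubic_vectors"
proof -
  have "e \<in> deg3" if "e \<in> Poly_Mapping.keys ((\<Sum>i\<in>A. summand (m i) (y i)) $ j)" for e j
  proof (rule ccontr)
    assume "e \<notin> deg3"
    then have "lk ((\<Sum>i\<in>A. summand (m i) (y i)) $ j) e = 0"
      by (simp add: lookup_sum lookup_summand multinom_outside)
    with that show False by (simp add: in_keys_iff)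
  qed
  then show ?thesis by (auto simp: cubic_vectors_def forms_def deg3_def)
qed

lemma waring_map_normal_coords:
  assumes "f \<in> cubic_vectors"
  shows "waring_map x = normal_coords f \<longleftrightarrow> f = (\<Sum>i\<in>UNIV. summand (pl x i) (pv x i))"
  unfolding sum_summand_eq_iff[OF assms] waring_map_def by auto

lemma equal_sums_decompose:
  fixes m y m' y' :: "6 \<Rightarrow> complex ^ 3"
  assumes "(\<Sum>i\<in>UNIV. summand (m i) (y i)) = (\<Sum>i\<in>UNIV. summand (m' i) (y' i))" and "bih 3 1 X"
  shows "(\<Sum>i\<in>UNIV. X (m i) (y i)) = (\<Sum>i\<in>UNIV. X (m' i) (y' i))"
proof -
  obtain g where g: "X = form g" using assms(2) by (rule form_ex)
  have *: "(\<Sum>i\<in>UNIV. X (m i) (y i)) = (\<Sum>c\<in>UNIV. g c * normal_coords (\<Sum>i\<in>UNIV. summand (m i) (y i)) $ c)"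
    for m y :: "6 \<Rightarrow> complex ^ 3"
    unfolding g form_def normal_coords_sum[OF refl] sum_distrib_left by (rule sum.swap)
  show ?thesis using *[of m y] *[of m' y'] assms(1) by simp
qed

section \<open>Waring decompositions as families over six indices\<close>

definition enum6 :: "6 \<Rightarrow> nat" where
  "enum6 = (SOME f. bij_betw f UNIV {..<6})"

lemma bij_enum6: "bij_betw enum6 UNIV {..<6}"
proof -
  have "\<exists>f. bij_betw f (UNIV :: 6 set) {..<6::nat}"
    by (intro finite_same_card_bij) auto
  then show ?thesis unfolding enum6_def by (rule someI_ex)
qed

text \<open>Coefficient vectors indexed by the type \<open>6\<close> replace linear forms indexed by
  \<open>{..<6}\<close>. They range over the whole space and not over the chart of
  \<open>pl\<close>, so every competing decomposition is covered.\<close>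

lemma waring_decompositions_eq:
  "waring_decompositions 6 f = {(\<lambda>i. summand (m i) (y i)) ` UNIV | m y :: 6 \<Rightarrow> complex ^ 3.
     f = (\<Sum>i\<in>UNIV. summand (m i) (y i)) \<and> (\<forall>j. \<exists>i. y i $ j \<noteq> 0)}"
proof (intro subset_antisym subsetI)
  fix A assume "A \<in> waring_decompositions 6 f"
  then obtain l c where A: "A = waring_summand l c ` {..<6}" and dec: "is_waring_decomposition 6 f l c"
    by (auto simp: waring_decompositions_def)
  define m where "m = (\<lambda>i. coeff_vector (l (enum6 i)))"
  define y :: "6 \<Rightarrow> complex ^ 3" where "y = (\<lambda>i. \<chi> j. c j (enum6 i))"
  have lt: "enum6 i < 6" for i using bij_betw_apply[OF bij_enum6, of i] by simp
  have s: "waring_summand l c (enum6 i) = summand (m i) (y i)" for i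
  proof -
    have "l (enum6 i) \<in> forms 1" using dec lt[of i] by (auto simp: is_waring_decomposition_def)
    from linear_form_coeff_vector[OF this] show ?thesis
      by (simp add: waring_summand_def summand_def m_def y_def)
  qed
  have "A = (\<lambda>i. summand (m i) (y i)) ` UNIV"
    unfolding A bij_betw_imp_surj_on[OF bij_enum6, symmetric] by (simp add: image_image s)
  moreover have "f = (\<Sum>i\<in>UNIV. summand (m i) (y i))"
    using dec sum.reindex_bij_betw[OF bij_enum6, of "waring_summand l c"]
    by (simp add: is_waring_decomposition_def s)
  moreover have "\<exists>i. y i $ j \<noteq> 0" for j
  proof -
    obtain n where n: "n < 6" "c j n \<noteq> 0" using dec by (auto simp: is_waring_decomposition_def)
    then obtain i where "enum6 i = n" using bij_betw_imp_surj_on[OF bij_enum6] by (metis imageE lessThan_iff)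
    with n show ?thesis by (auto simp: y_def)
  qed
  ultimately show "A \<in> {(\<lambda>i. summand (m i) (y i)) ` UNIV | m y :: 6 \<Rightarrow> complex ^ 3.
     f = (\<Sum>i\<in>UNIV. summand (m i) (y i)) \<and> (\<forall>j. \<exists>i. y i $ j \<noteq> 0)}" by blast
next
  fix A assume "A \<in> {(\<lambda>i. summand (m i) (y i)) ` UNIV | m y :: 6 \<Rightarrow> complex ^ 3.
     f = (\<Sum>i\<in>UNIV. summand (m i) (y i)) \<and> (\<forall>j. \<exists>i. y i $ j \<noteq> 0)}"
  then obtain m y :: "6 \<Rightarrow> complex ^ 3" where A: "A = (\<lambda>i. summand (m i) (y i)) ` UNIV"
    and f: "f = (\<Sum>i\<in>UNIV. summand (m i) (y i))" and y: "\<And>j. \<exists>i. y i $ j \<noteq> 0" by blast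
  let ?d = "the_inv_into UNIV enum6"
  have d: "?d (enum6 i) = i" for i
    by (rule the_inv_into_f_f[OF bij_betw_imp_inj_on[OF bij_enum6]]) simp
  define l where "l = (\<lambda>n. linear_form (m (?d n)))"
  define c where "c = (\<lambda>j n. y (?d n) $ j)"
  have s: "waring_summand l c (enum6 i) = summand (m i) (y i)" for i
    by (simp add: waring_summand_def summand_def l_def c_def d)
  have "A = waring_summand l c ` {..<6}"
    unfolding A bij_betw_imp_surj_on[OF bij_enum6, symmetric] by (simp add: image_image s)
  moreover have "is_waring_decomposition 6 f l c"
    unfolding is_waring_decomposition_def
  proof (intro conjI allI impI)
    show "l i \<in> forms 1" for i unfolding l_def by (rule linear_form_in)
    show "\<exists>n<6. c j n \<noteq> 0" for j
    proof -
      obtain i where "y i $ j \<noteq> 0" using y by blast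
      then have "c j (enum6 i) \<noteq> 0" by (simp add: c_def d)
      then show ?thesis using bij_betw_apply[OF bij_enum6, of i] by auto
    qed
    show "f = (\<Sum>i<6. waring_summand l c i)"
      using sum.reindex_bij_betw[OF bij_enum6, of "waring_summand l c"] by (simp add: f s)
  qed
  ultimately show "A \<in> waring_decompositions 6 f" unfolding waring_decompositions_def by blast
qed

theorem theorem4p4:
  "\<exists>U. zariski_open U \<and> U \<noteq> {} \<and> (\<forall>f\<in>U. card (waring_decompositions 6 f) = 2)"
proof -
  obtain P where P: "cpoly P" "\<exists>y. P y \<noteq> 0"
    "\<And>y. P y \<noteq> 0 \<Longrightarrow> \<exists>x x'. waring_map x = y \<and> waring_map x' = y \<and> regular x \<and> regular x' \<and> evs x \<noteq> evs x'"
    by (rule generic_parameters) (rule that; assumption)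
  obtain Q where Q: "\<And>a. mpoly_eval a Q = P (\<chi> c. a (cubic_index c) / multinom (snd (cubic_index c)))"
    by (rule cpoly_mpoly[OF P(1)]) (rule that; assumption)
  have PQ: "P (normal_coords f) = mpoly_eval (coordinate f) Q" for f
    by (simp add: Q normal_coords_def)
  define U where "U = {f \<in> cubic_vectors. P (normal_coords f) \<noteq> 0}"
  have "cubic_vectors - U = {f \<in> cubic_vectors. \<forall>q\<in>{Q}. mpoly_eval (coordinate f) q = 0}"
    by (auto simp: U_def PQ)
  then have "zariski_open U"
    unfolding zariski_open_def zariski_closed_def by (auto simp: U_def)
  moreover have "U \<noteq> {}"
  proof -
    obtain y where "P y \<noteq> 0" using P(2) by blast
    then obtain x where x: "waring_map x = y" using P(3) by blast
    let ?f = "\<Sum>i\<in>UNIV. summand (pl x i) (pv x i)"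
    have f: "?f \<in> cubic_vectors" by (rule sum_summand_in_cubic_vectors)
    then have "waring_map x = normal_coords ?f" by (simp add: waring_map_normal_coords)
    then have "?f \<in> U" using f x \<open>P y \<noteq> 0\<close> by (simp add: U_def)
    then show ?thesis by blast
  qed
  moreover have "card (waring_decompositions 6 f) = 2" if "f \<in> U" for f
  proof -
    have f: "f \<in> cubic_vectors" "P (normal_coords f) \<noteq> 0" using that by (auto simp: U_def)
    obtain x x' where x: "waring_map x = normal_coords f" "waring_map x' = normal_coords f"
      and reg: "regular x" "regular x'" and ne: "evs x \<noteq> evs x'"
      using P(3)[OF f(2)] by blast
    let ?A = "\<lambda>x. (\<lambda>i. summand (pl x i) (pv x i)) ` UNIV"
    have fx: "f = (\<Sum>i\<in>UNIV. summand (pl x i) (pv x i))" "f = (\<Sum>i\<in>UNIV. summand (pl x' i) (pv x' i))"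
      using x waring_map_normal_coords[OF f(1)] by blast+
    interpret S: sextuple "pl x" "pv x" by (rule regular_sextuple) fact
    have "waring_decompositions 6 f = {?A x, ?A x'}"
    proof (intro subset_antisym subsetI)
      fix A assume "A \<in> waring_decompositions 6 f"
      then obtain m y :: "6 \<Rightarrow> complex ^ 3" where A: "A = (\<lambda>i. summand (m i) (y i)) ` UNIV"
        and fm: "f = (\<Sum>i\<in>UNIV. summand (m i) (y i))"
        unfolding waring_decompositions_eq by blast
      \<comment> \<open>The regular \<open>x\<close> is the base of the locale; the arbitrary
        \<open>(m, y)\<close> and the known \<open>x'\<close> are its two competitors.\<close>
      have dec: "S.decomposes m y" "S.decomposes (pl x') (pv x')"
        unfolding S.decomposes_def
        by (intro allI impI equal_sums_decompose; simp only: fm[symmetric] fx[symmetric])+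
      show "A \<in> {?A x, ?A x'}"
      proof (cases "(\<lambda>i. ev (m i) (y i)) ` UNIV = evs x")
        case True
        then show ?thesis unfolding A evs_def using summand_image_eq by blast
      next
        case False
        then have "(\<lambda>i. ev (m i) (y i)) ` UNIV = (\<lambda>i. ev (pl x' i) (pv x' i)) ` UNIV"
          using S.at_most_two_decompositions[OF dec] ne by (auto simp: evs_def)
        then show ?thesis unfolding A using summand_image_eq by blast
      qed
    next
      fix A assume "A \<in> {?A x, ?A x'}"
      then show "A \<in> waring_decompositions 6 f"
        unfolding waring_decompositions_eq
        using fx regular_component[OF reg(1)] regular_component[OF reg(2)] by blast
    qed
    moreover have "?A x \<noteq> ?A x'"
      using ne ev_image_eq unfolding evs_def by blast
    ultimately show ?thesis by simp
  qed
  ultimately show ?thesis by blast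
qed

end
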